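(* In the setting described in the context, there exist a sequence $\varepsilon_j\to0$, a Borel probability measure $\mu$ on $\mathbb{T}^n\times\mathbb{R}^n$ and a symmetric $n\times n$ matrix $(m_{kj})_{k,j=1}^n$ of finite signed Borel measures on $\mathbb{T}^n\times\mathbb{R}^n$, nonnegative in the sense that $\sum_{k,j}\xi_k\xi_j m_{kj}$ is a nonnegative measure for every $\xi\in\mathbb{R}^n$, such that: (1) $\mu^{\varepsilon_j}\to\mu$ weakly-* in the sense of measures (i.e. $\int\phi\,d\mu^{\varepsilon_j}\to\int\phi\,d\mu$ for all $\phi\in C_c(\mathbb{T}^n\times\mathbb{R}^n)$); (2) $\mu$ is a Mather measure; more precisely it satisfies (a) $\int H\,d\mu=\overline{H}(P)$ and $H=\overline{H}(P)$ $\mu$-a.e., (b) $\int (p-P)\cdot D_pH(x,p)\,d\mu=0$, (c) $\int D_pH(x,p)\cdot D\phi(x)\,d\mu=0$ for all $\phi\in C^1(\mathbb{T}^n)$; (3) for every $\phi\in C^2_c(\mathbb{T}^n\times\mathbb{R}^n)$, $$\int_{\mathbb{T}^n\times\mathbb{R}^n}\{\phi,H\}\,d\mu+\sum_{k,j=1}^n\int_{\mathbb{T}^n\times\mathbb{R}^n}\phi_{p_kp_j}\,dm_{kj}=0;$$ (4) the supports of $\mu$ and of all $m_{kj}$ are compact.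
   Context: $\mathbb{T}^n=\mathbb{R}^n/\mathbb{Z}^n$. $H:\mathbb{T}^n\times\mathbb{R}^n\to\mathbb{R}$ is $C^\infty$ and satisfies $\lim_{|p|\to\infty}\big(\tfrac12|H(x,p)|^2+D_xH(x,p)\cdot p\big)=+\infty$ uniformly in $x$. For $\varepsilon>0$ and $P\in\mathbb{R}^n$, $\overline{H}^\varepsilon(P)$ is the unique real number such that $-\frac{\varepsilon^2}{2}\Delta u+H(x,P+Du)=\overline{H}^\varepsilon(P)$ admits a $\mathbb{Z}^n$-periodic solution; $u^\varepsilon$ denotes such a smooth solution. $\overline{H}(P)=\lim_{\varepsilon\to0}\overline{H}^\varepsilon(P)$, which is the unique real number for which $H(x,P+Du)=\overline{H}(P)$ has a $\mathbb{Z}^n$-periodic viscosity solution. Fix $P$. Let $w_t$ be an $n$-dimensional Brownian motion, $\mathbf{x}^\varepsilon$ the solution of $d\mathbf{x}^\varepsilon=-D_pH(\mathbf{x}^\varepsilon,P+Du^\varepsilon(\mathbf{x}^\varepsilon))dt+\varepsilon\,dw_t$, $\mathbf{x}^\varepsilon(0)=\bar x$, $\mathbf{p}^\varepsilon(t)=P+Du^\varepsilon(\mathbf{x}^\varepsilon(t))$, and for each $\varepsilon>0$ let $\mu^\varepsilon$ be a Borel probability measure on $\mathbb{T}^n\times\mathbb{R}^n$ such that, for some sequence $T_j\to\infty$, $\int\phi\,d\mu^\varepsilon=\lim_j\frac1{T_j}E\big[\int_0^{T_j}\phi(\mathbf{x}^\varepsilon(t),\mathbf{p}^\varepsilon(t))dt\big]$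 for all $\phi\in C_c(\mathbb{T}^n\times\mathbb{R}^n)$. A Mather measure is a Borel probability measure $\mu$ on $\mathbb{T}^n\times\mathbb{R}^n$ for which there is $P$ with properties (a)–(c) of the claim. The Poisson bracket is $\{F,G\}=D_pF\cdot D_xG-D_xF\cdot D_pG$. *)

theory Defs
  imports "HOL-Analysis.Analysis" "HOL-Probability.Probability"
begin

text \<open>The torus T^n = R^n / Z^n is represented by its universal cover R^n:
  functions on T^n are Z^n-periodic functions on R^n, and Borel measures on
  T^n x R^n are represented by their (canonical) lift to the fundamental
  domain [0,1)^n x R^n.\<close>

definition int_vec :: "real^'n \<Rightarrow> bool" where
  "int_vec k \<longleftrightarrow> (\<forall>i. k $ i \<in> \<int>)"

definition periodic :: "(real^'n \<Rightarrow> 'b) \<Rightarrow> bool" where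
  "periodic f \<longleftrightarrow> (\<forall>x k. int_vec k \<longrightarrow> f (x + k) = f x)"

definition periodic_x :: "(real^'n \<Rightarrow> real^'n \<Rightarrow> 'b) \<Rightarrow> bool" where
  "periodic_x f \<longleftrightarrow> (\<forall>x p k. int_vec k \<longrightarrow> f (x + k) p = f x p)"

definition fund_dom :: "(real^'n) set" where
  "fund_dom = {x. \<forall>i. 0 \<le> x $ i \<and> x $ i < 1}"

definition dderiv :: "('a::real_normed_vector \<Rightarrow> real) \<Rightarrow> 'a \<Rightarrow> 'a \<Rightarrow> real" where
  "dderiv f v z = frechet_derivative f (at z) v"

fun Ck :: "nat \<Rightarrow> ('a::euclidean_space \<Rightarrow> real) \<Rightarrow> bool" where
  "Ck 0 f = continuous_on UNIV f"
| "Ck (Suc k) f = ((\<forall>z. f differentiable (at z)) \<and> (\<forall>v. Ck k (\<lambda>z. dderiv f v z)))"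

definition smooth :: "('a::euclidean_space \<Rightarrow> real) \<Rightarrow> bool" where
  "smooth f \<longleftrightarrow> (\<forall>k. Ck k f)"

definition grad :: "(real^'n \<Rightarrow> real) \<Rightarrow> real^'n \<Rightarrow> real^'n" where
  "grad f x = (\<chi> i. dderiv f (axis i 1) x)"

definition laplacian :: "(real^'n \<Rightarrow> real) \<Rightarrow> real^'n \<Rightarrow> real" where
  "laplacian f x = (\<Sum>i\<in>UNIV. dderiv (\<lambda>y. dderiv f (axis i 1) y) (axis i 1) x)"

definition gradx :: "(real^'n \<Rightarrow> real^'n \<Rightarrow> real) \<Rightarrow> real^'n \<Rightarrow> real^'n \<Rightarrow> real^'n" where
  "gradx F x p = grad (\<lambda>y. F y p) x"

definition gradp :: "(real^'n \<Rightarrow> real^'n \<Rightarrow> real) \<Rightarrow> real^'n \<Rightarrow> real^'n \<Rightarrow> real^'n" where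
  "gradp F x p = grad (\<lambda>q. F x q) p"

definition dpp :: "(real^'n \<Rightarrow> real^'n \<Rightarrow> real) \<Rightarrow> 'n \<Rightarrow> 'n \<Rightarrow> real^'n \<Rightarrow> real^'n \<Rightarrow> real" where
  "dpp F k j x p = dderiv (\<lambda>q. dderiv (\<lambda>q'. F x q') (axis j 1) q) (axis k 1) p"

definition poisson :: "(real^'n \<Rightarrow> real^'n \<Rightarrow> real) \<Rightarrow> (real^'n \<Rightarrow> real^'n \<Rightarrow> real) \<Rightarrow> real^'n \<Rightarrow> real^'n \<Rightarrow> real" where
  "poisson F G x p = gradp F x p \<bullet> gradx G x p - gradx F x p \<bullet> gradp G x p"

definition Cc_torus :: "(real^'n \<Rightarrow> real^'n \<Rightarrow> real) \<Rightarrow> bool" where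
  "Cc_torus f \<longleftrightarrow> continuous_on UNIV (\<lambda>z. f (fst z) (snd z)) \<and> periodic_x f \<and>
     (\<exists>R. \<forall>x p. norm p > R \<longrightarrow> f x p = 0)"

definition C2c_torus :: "(real^'n \<Rightarrow> real^'n \<Rightarrow> real) \<Rightarrow> bool" where
  "C2c_torus f \<longleftrightarrow> Ck 2 (\<lambda>z. f (fst z) (snd z)) \<and> periodic_x f \<and>
     (\<exists>R. \<forall>x p. norm p > R \<longrightarrow> f x p = 0)"

definition torus_measure :: "((real^'n) \<times> (real^'n)) measure \<Rightarrow> bool" where
  "torus_measure M \<longleftrightarrow> sets M = sets borel \<and> emeasure M (- (fund_dom \<times> UNIV)) = 0"

text \<open>A finite signed measure is represented as a difference Mp - Mn of two finite measures.\<close>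
definition smeasure :: "'a measure \<Rightarrow> 'a measure \<Rightarrow> 'a set \<Rightarrow> real" where
  "smeasure Mp Mn A = measure Mp A - measure Mn A"

definition sintegral :: "'a measure \<Rightarrow> 'a measure \<Rightarrow> ('a \<Rightarrow> real) \<Rightarrow> real" where
  "sintegral Mp Mn f = (\<integral>z. f z \<partial>Mp) - (\<integral>z. f z \<partial>Mn)"

definition measure_support :: "'a::metric_space measure \<Rightarrow> 'a set" where
  "measure_support M = {z. \<forall>e>0. emeasure M (ball z e) \<noteq> 0}"

definition smeasure_support :: "('a::metric_space set \<Rightarrow> real) \<Rightarrow> 'a set" where
  "smeasure_support m = {z. \<forall>e>0. \<exists>A\<in>sets borel. A \<subseteq> ball z e \<and> m A \<noteq> 0}"

definition brownian_motion :: "'w measure \<Rightarrow> (real \<Rightarrow> 'w \<Rightarrow> real^'n) \<Rightarrow> bool" where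
  "brownian_motion M w \<longleftrightarrow> prob_space M \<and>
     (\<forall>t\<ge>0. w t \<in> borel_measurable M) \<and>
     (\<forall>\<omega>\<in>space M. w 0 \<omega> = 0 \<and> continuous_on {0..} (\<lambda>t. w t \<omega>)) \<and>
     (\<forall>(ts::nat \<Rightarrow> real) k. 0 \<le> ts 0 \<and> (\<forall>i<k. ts i < ts (Suc i)) \<longrightarrow>
        prob_space.indep_vars M (\<lambda>_. borel) (\<lambda>i \<omega>. w (ts (Suc i)) \<omega> - w (ts i) \<omega>) {..<k}) \<and>
     (\<forall>s t. 0 \<le> s \<and> s < t \<longrightarrow>
        distributed M lborel (\<lambda>\<omega>. w t \<omega> - w s \<omega>)
          (\<lambda>x. ennreal ((2 * pi * (t - s)) powr (- real CARD('n) / 2) *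
                          exp (- (norm x)\<^sup>2 / (2 * (t - s))))))"

end

theory Submission
  imports Defs
begin

text \<open>Write \<open>p(x) = P + Du(x)\<close> for a solution of the viscous cell problem. Dynkin's formula shows that
  the ergodic measure is carried by the graph of \<open>p\<close> and annihilates the generator applied to
  \<open>g(x) = \<phi>(x, p(x))\<close>; by the differentiated cell equation this reads
  \<open>\<integral> {\<phi>, H} + \<epsilon>\<^sup>2/2 (\<phi>\<^sub>x\<^sub>x + 2 \<phi>\<^sub>x\<^sub>p D\<^sup>2u + \<phi>\<^sub>p\<^sub>p D\<^sup>2u D\<^sup>2u) d\<mu> = 0\<close>. Bernstein's method bounds \<open>p\<close> uniformly for small
  \<open>\<epsilon>\<close>, and \<open>\<phi> = |p|\<^sup>2/2\<close> then bounds \<open>\<epsilon>\<^sup>2 \<integral> |D\<^sup>2u|\<^sup>2 d\<mu>\<close>. Hence, along a subsequence, \<open>\<mu>\<close> and the matrix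
  measures \<open>\<epsilon>\<^sup>2/2 D\<^sup>2u D\<^sup>2u \<mu>\<close> converge weakly and the remaining terms vanish; the choices \<open>\<phi> = \<phi>(x)\<close> and
  \<open>g = u\<close> give the flow invariance and the momentum identity, and \<open>H - H\<^sup>\<epsilon> = \<epsilon>\<^sup>2/2 \<Delta>u\<close> tends to \<open>0\<close> in \<open>L\<^sup>2\<close>.\<close>

section \<open>Gaussian moments\<close>

text \<open>Three obstacles shape the development. The resulting bound on the expected time integral
  of the generator is twice the supremum of the test function, whatever the time horizon, so
  division by the horizon annihilates it. The torus is modelled by a half-open cell, which is not
  compact: limits are taken on the closed cell times a ball and folded back at the end. Weak limits
  are extracted for positive measures, so each entry of the Gram matrix of the Hessian is split into
  positive and negative part before the limit. Symmetry and semidefiniteness are then no longer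
  visible and have to be recovered on Borel sets from integrals of continuous functions, by
  regularity. Finally, (c) concerns C^1 functions while the generator acts on C^2 ones;
  mollification closes this gap.\<close>

lemma lborel_integral_prod_inner:
  fixes f :: "'a::euclidean_space \<Rightarrow> real \<Rightarrow> real"
  assumes f: "\<And>b. b \<in> Basis \<Longrightarrow> integrable lborel (f b)"
  shows "has_bochner_integral lborel (\<lambda>x::'a. \<Prod>b\<in>Basis. f b (x \<bullet> b)) (\<Prod>b\<in>Basis. integral\<^sup>L lborel (f b))"
proof -
  interpret product_sigma_finite "\<lambda>_::'a. lborel :: real measure" ..
  have [measurable]: "f b \<in> borel_measurable borel" if "b \<in> Basis" for b
    using borel_measurable_integrable[OF f[OF that]] by simp
  have m: "(\<lambda>g. \<Sum>b\<in>Basis. g b *\<^sub>R b) \<in> measurable (\<Pi>\<^sub>M b\<in>(Basis::'a set). lborel) borel" by simp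
  have m2: "(\<lambda>x::'a. \<Prod>b\<in>Basis. f b (x \<bullet> b)) \<in> borel_measurable borel" by measurable
  have eq: "(\<Prod>b\<in>Basis. f b ((\<Sum>c\<in>Basis. g c *\<^sub>R c) \<bullet> b)) = (\<Prod>b\<in>(Basis::'a set). f b (g b))" for g :: "'a \<Rightarrow> real"
    by (intro prod.cong refl) (simp add: inner_sum_left inner_Basis if_distrib cong: if_cong)
  have "integrable (lborel::'a measure) (\<lambda>x. \<Prod>b\<in>Basis. f b (x \<bullet> b))"
    by (subst lborel_eq, subst integrable_distr_eq[OF m])
       (use m2 f in \<open>simp_all only: eq, auto intro!: product_integrable_prod\<close>)
  moreover have "integral\<^sup>L (lborel::'a measure) (\<lambda>x. \<Prod>b\<in>Basis. f b (x \<bullet> b)) = (\<Prod>b\<in>Basis. integral\<^sup>L lborel (f b))"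
    by (subst lborel_eq, subst integral_distr[OF m])
       (use m2 f in \<open>simp_all only: eq, auto intro!: product_integral_prod\<close>)
  ultimately show ?thesis by (simp add: has_bochner_integral_iff)
qed

definition gauss :: "real \<Rightarrow> real^'n \<Rightarrow> real" where
  "gauss t x = (2 * pi * t) powr (- real CARD('n) / 2) * exp (- (norm x)\<^sup>2 / (2 * t))"

lemma prod_Basis_vec: "(\<Prod>b\<in>(Basis::(real^'n) set). f b) = (\<Prod>i\<in>UNIV. f (axis i 1))"
proof -
  have r: "(Basis::(real^'n) set) = range (\<lambda>i. axis i 1)" by (auto simp: Basis_vec_def)
  have "inj (\<lambda>i::'n. axis i (1::real))" by (simp add: inj_on_def axis_eq_axis)
  then have "prod f (range (\<lambda>i::'n. axis i (1::real))) = (\<Prod>i\<in>UNIV. f (axis i 1))"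
    by (simp add: prod.reindex)
  with r show ?thesis by simp
qed

lemma gauss_prod:
  assumes "t > 0"
  shows "gauss t (x::real^'n) = (\<Prod>i\<in>UNIV. normal_density 0 (sqrt t) (x $ i))"
proof -
  have e: "exp (- (norm x)\<^sup>2 / (2 * t)) = (\<Prod>i\<in>UNIV. exp (- (x $ i)\<^sup>2 / (2*t)))"
    by (simp add: exp_sum[symmetric] norm_vec_def L2_set_def sum_nonneg sum_negf sum_divide_distrib)
  have "(2 * pi * t) powr (- real CARD('n) / 2) = (1 / sqrt (2 * pi * t)) ^ CARD('n)"
  proof -
    have "(2 * pi * t) powr (- (1/2)) = 1 / sqrt (2 * pi * t)"
      using assms by (subst powr_minus_divide) (simp add: powr_half_sqrt)
    then have "(1 / sqrt (2 * pi * t)) ^ CARD('n) = ((2 * pi * t) powr (- (1/2))) powr real CARD('n)"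
      using assms by (simp add: powr_realpow)
    then show ?thesis by (simp add: powr_powr)
  qed
  then show ?thesis using assms
    unfolding gauss_def normal_density_def e by (simp add: prod_dividef prod.distrib power_divide)
qed

lemma gauss_moment:
  assumes t: "t > 0"
  shows "has_bochner_integral lborel (\<lambda>x::real^'n. gauss t x * (\<Prod>i\<in>UNIV. (x $ i) ^ k i))
     (\<Prod>i\<in>UNIV. \<integral>r. normal_density 0 (sqrt t) r * r ^ k i \<partial>lborel)"
proof -
  have inj: "\<And>i j::'n. axis i (1::real) = axis j 1 \<longleftrightarrow> i = j" by (simp add: axis_eq_axis)
  \<comment> \<open>The factorisation is indexed by \<open>Basis\<close>, the exponents by
    coordinates; since \<open>axis\<close> is injective, the choice recovers the coordinate of a
    basis vector.\<close>
  define kk where "kk b = k (SOME i. b = axis i (1::real))" for b :: "real^'n"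
  have kk: "kk (axis i 1) = k i" for i unfolding kk_def by (simp add: inj)
  have "integrable lborel (\<lambda>r. normal_density 0 (sqrt t) r * r ^ kk b)" for b
    using integrable_normal_moment[of "sqrt t" 0 "kk b"] t by simp
  from lborel_integral_prod_inner[of "\<lambda>b r. normal_density 0 (sqrt t) r * r ^ kk b", OF this]
  show ?thesis
    by (simp add: prod_Basis_vec inner_axis kk prod.distrib gauss_prod[OF t])
qed

lemma normal_density_moments:
  assumes t: "t > 0"
  shows "(\<integral>r. normal_density 0 (sqrt t) r \<partial>lborel) = 1"
    "(\<integral>r. normal_density 0 (sqrt t) r * r \<partial>lborel) = 0"
    "(\<integral>r. normal_density 0 (sqrt t) r * r^2 \<partial>lborel) = t"
    "(\<integral>r. normal_density 0 (sqrt t) r * r^4 \<partial>lborel) = 3 * t^2"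
  using integral_normal_moment_even[of "sqrt t" 0 0] integral_normal_moment_even[of "sqrt t" 0 1]
    integral_normal_moment_even[of "sqrt t" 0 2] integral_normal_moment_odd[of "sqrt t" 0 0] t
  by (simp_all add: fact_numeral field_simps power2_eq_square)

lemma gauss_total_mass: assumes t: "t > 0"
  shows "has_bochner_integral lborel (\<lambda>x::real^'n. gauss t x) 1"
  using gauss_moment[OF t, of "\<lambda>_. 0"] by (simp add: normal_density_moments[OF t])

lemma prod_power_single: "(\<Prod>l\<in>UNIV. (x $ l) ^ (if l = i then k else 0)) = (x $ i) ^ k" for x :: "real^'n"
proof -
  have "(\<Prod>l\<in>UNIV. (x $ l) ^ (if l = i then k else 0)) = (\<Prod>l\<in>UNIV. if l = i then (x $ l) ^ k else 1)"
    by (intro prod.cong) auto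
  then show ?thesis by (simp add: prod.delta)
qed

lemma gauss_mean: assumes t: "t > 0"
  shows "has_bochner_integral lborel (\<lambda>x::real^'n. gauss t x * x $ i) 0"
proof -
  let ?k = "\<lambda>l. if l = i then 1 else 0 :: nat"
  have 1: "(\<Prod>l\<in>UNIV. (x $ l) ^ ?k l) = x $ i" for x :: "real^'n"
    using prod_power_single[of x i 1] by simp
  have 2: "(\<Prod>j\<in>UNIV. \<integral>r. normal_density 0 (sqrt t) r * r ^ ?k j \<partial>lborel) = 0"
    by (rule prod_zero) (auto intro!: bexI[of _ i] simp: normal_density_moments[OF t])
  show ?thesis using gauss_moment[OF t, of ?k] unfolding 1 2 .
qed

lemma gauss_covariance: assumes t: "t > 0"
  shows "has_bochner_integral lborel (\<lambda>x::real^'n. gauss t x * (x $ i * x $ j)) (if i = j then t else 0)"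
proof -
  let ?k = "\<lambda>l. (if l = i then 1 else 0) + (if l = j then 1 else 0) :: nat"
  have 1: "(\<Prod>l\<in>UNIV. (x $ l) ^ ?k l) = x $ i * x $ j" for x :: "real^'n"
    unfolding power_add prod.distrib prod_power_single by simp
  have 2: "(\<Prod>l\<in>UNIV. \<integral>r. normal_density 0 (sqrt t) r * r ^ ?k l \<partial>lborel) = (if i = j then t else 0)"
  proof (cases "i = j")
    case True
    have "(\<integral>r. normal_density 0 (sqrt t) r * r ^ ?k l \<partial>lborel) = (if l = i then t else 1)" for l
      using True normal_density_moments[OF t] by (auto simp: numeral_2_eq_2)
    then show ?thesis using True by (simp add: prod.delta)
  next
    case False
    then show ?thesis
      by simp (rule exI[of _ i], simp add: normal_density_moments[OF t])
  qed
  show ?thesis using gauss_moment[OF t, of ?k] unfolding 1 2 .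
qed

lemma gauss_fourth_moment: assumes t: "t > 0"
  shows "has_bochner_integral lborel (\<lambda>x::real^'n. gauss t x * (x $ i) ^ 4) (3 * t^2)"
proof -
  let ?k = "\<lambda>l. (if l = i then 4 else 0) :: nat"
  have 1: "(\<Prod>l\<in>UNIV. (x $ l) ^ ?k l) = (x $ i)^4" for x :: "real^'n"
    by (rule prod_power_single)
  have "(\<integral>r. normal_density 0 (sqrt t) r * r ^ ?k l \<partial>lborel) = (if l = i then 3 * t^2 else 1)" for l
      using normal_density_moments[OF t] by auto
  then have 2: "(\<Prod>l\<in>UNIV. \<integral>r. normal_density 0 (sqrt t) r * r ^ ?k l \<partial>lborel) = 3 * t^2"
     by (simp add: prod.delta)
  show ?thesis using gauss_moment[OF t, of ?k] unfolding 1 2 .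
qed

section \<open>The Gaussian measure and its norm moments\<close>

definition gaussian :: "real \<Rightarrow> (real^'n) measure" where
  "gaussian t = density lborel (\<lambda>x. ennreal (gauss t x))"

lemma gauss_measurable[measurable]: "gauss t \<in> borel_measurable borel"
  unfolding gauss_def[abs_def] by measurable

lemma gauss_nonneg: "0 \<le> gauss t x" by (simp add: gauss_def)

lemma sets_gaussian[simp, measurable_cong]: "sets (gaussian t) = sets borel"
  and space_gaussian[simp]: "space (gaussian t) = UNIV"
  by (simp_all add: gaussian_def)

lemma has_bochner_integral_gaussian:
  fixes f :: "real^'n \<Rightarrow> real"
  assumes "has_bochner_integral lborel (\<lambda>x. gauss t x * f x) c" and [measurable]: "f \<in> borel_measurable borel"
  shows "has_bochner_integral (gaussian t) f c"
  unfolding gaussian_def using assms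
  by (intro has_bochner_integral_density) (auto simp: gauss_nonneg)

lemma gaussian_moments:
  assumes t: "t > 0"
  shows "prob_space (gaussian t :: (real^'n) measure)"
    "has_bochner_integral (gaussian t) (\<lambda>x::real^'n. x $ i) 0"
    "has_bochner_integral (gaussian t) (\<lambda>x::real^'n. x $ i * x $ j) (if i = j then t else 0)"
    "has_bochner_integral (gaussian t) (\<lambda>x::real^'n. (x $ i)^4) (3 * t^2)"
proof -
  have "emeasure (gaussian t) (UNIV :: (real^'n) set) = (\<integral>\<^sup>+x. ennreal (gauss t x) \<partial>(lborel :: (real^'n) measure))"
    by (simp add: gaussian_def emeasure_density)
  also have "\<dots> = ennreal 1"
    using gauss_total_mass[OF t] by (subst nn_integral_eq_integral) (auto simp: has_bochner_integral_iff gauss_nonneg)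
  finally show "prob_space (gaussian t :: (real^'n) measure)" by (intro prob_spaceI) simp
qed (intro has_bochner_integral_gaussian gauss_mean gauss_covariance gauss_fourth_moment t; measurable)+

text \<open>Cauchy-Schwarz over the coordinates: with it only fourth moments of single coordinates
  have to be computed, not the mixed ones.\<close>

lemma norm_pow4_le_sum: "norm (x::real^'n) ^ 4 \<le> real CARD('n) * (\<Sum>i\<in>UNIV. (x $ i)^4)"
proof -
  have "norm x ^ 4 = ((norm x)\<^sup>2)\<^sup>2" by (simp add: power_mult[symmetric])
  also have "(norm x)\<^sup>2 = (\<Sum>i\<in>UNIV. (x $ i)\<^sup>2)"
    by (simp add: norm_vec_def L2_set_def sum_nonneg)
  also have "(\<Sum>i\<in>UNIV. (x $ i)\<^sup>2)\<^sup>2 \<le> real CARD('n) * (\<Sum>i\<in>UNIV. ((x $ i)\<^sup>2)\<^sup>2)"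
    by (metis sum_squared_le_sum_of_squares mult.commute)
  finally show ?thesis by (simp add: power_mult[symmetric])
qed

lemma gaussian_norm_moments:
  fixes t :: real
  assumes t: "t > 0"
  shows "integrable (gaussian t) (\<lambda>x::real^'n. (norm x)^2)"
    "(integral\<^sup>L (gaussian t) (\<lambda>x::real^'n. (norm x)^2)) = CARD('n) * t"
    "integrable (gaussian t) (\<lambda>x::real^'n. (norm x)^4)"
    "(integral\<^sup>L (gaussian t) (\<lambda>x::real^'n. (norm x)^4)) \<le> 3 * (CARD('n))^2 * t^2"
proof -
  have eq: "(norm x)\<^sup>2 = (\<Sum>i\<in>UNIV. x $ i * x $ i)" for x :: "real^'n"
    by (simp add: norm_vec_def L2_set_def sum_nonneg power2_eq_square)
  have "has_bochner_integral (gaussian t) (\<lambda>x::real^'n. x $ i * x $ i) t" for i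
    using gaussian_moments(3)[OF t, of i i] by simp
  then have 2: "has_bochner_integral (gaussian t) (\<lambda>x::real^'n. (norm x)^2) (\<Sum>i\<in>(UNIV::'n set). t)"
    unfolding eq by (rule has_bochner_integral_sum)
  then show "integrable (gaussian t) (\<lambda>x::real^'n. (norm x)^2)"
    "(integral\<^sup>L (gaussian t) (\<lambda>x::real^'n. (norm x)^2)) = CARD('n) * t"
    by (simp_all add: has_bochner_integral_iff)
  have 4: "has_bochner_integral (gaussian t) (\<lambda>x::real^'n. real CARD('n) * (\<Sum>i\<in>UNIV. (x $ i)^4)) (real CARD('n) * (\<Sum>i\<in>(UNIV::'n set). 3 * t^2))"
    by (intro has_bochner_integral_sum has_bochner_integral_mult_right gaussian_moments t)
  show i: "integrable (gaussian t) (\<lambda>x::real^'n. (norm x)^4)"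
  proof (rule Bochner_Integration.integrable_bound[OF integrable.intros[OF 4]])
    show "AE x::real^'n in gaussian t. norm (norm x ^ 4) \<le> norm (real CARD('n) * (\<Sum>i\<in>UNIV. (x $ i)^4))"
    proof (rule AE_I2)
      fix x :: "real^'n"
      have "norm (norm x ^ 4) = norm x ^ 4" by simp
      also have "\<dots> \<le> real CARD('n) * (\<Sum>i\<in>UNIV. (x $ i)^4)" by (rule norm_pow4_le_sum)
      also have "\<dots> \<le> norm (real CARD('n) * (\<Sum>i\<in>UNIV. (x $ i)^4))" by simp
      finally show "norm (norm x ^ 4) \<le> norm (real CARD('n) * (\<Sum>i\<in>UNIV. (x $ i)^4))" .
    qed
  qed measurable
  have "(integral\<^sup>L (gaussian t) (\<lambda>x::real^'n. (norm x)^4)) \<le> (integral\<^sup>L (gaussian t) (\<lambda>x::real^'n. real CARD('n) * (\<Sum>i\<in>UNIV. (x $ i)^4)))"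
    by (intro integral_mono i integrable.intros[OF 4] norm_pow4_le_sum)
  also have "\<dots> = real CARD('n) * (\<Sum>i\<in>(UNIV::'n set). 3 * t^2)"
    using 4 by (rule has_bochner_integral_integral_eq)
  finally show "(integral\<^sup>L (gaussian t) (\<lambda>x::real^'n. (norm x)^4)) \<le> 3 * (CARD('n))^2 * t^2"
    by (simp add: power2_eq_square algebra_simps)
qed

section \<open>Dynkin estimate via the Euler scheme\<close>

lemma quadratic_form_sum:
  "v \<bullet> (B *v v) = (\<Sum>i\<in>UNIV. \<Sum>j\<in>UNIV. B $ i $ j * (v $ i * v $ j))" for v :: "real^'n"
  by (simp add: inner_vec_def matrix_vector_mult_def sum_distrib_left mult_ac)

lemma matrix_entry_le_norm: "\<bar>B $ i $ j\<bar> \<le> norm B" for B :: "real^'n^'n"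
  using component_le_norm_cart[of "B $ i" j] Finite_Cartesian_Product.norm_nth_le[of B i] by linarith

text \<open>The entries are estimated one by one, which costs the factor n^2; all that matters later
  is that the constant does not depend on the point.\<close>

lemma quadratic_form_bound:
  fixes B :: "real^'n^'n"
  shows "\<bar>v \<bullet> (B *v v)\<bar> \<le> real (CARD('n))^2 * norm B * (norm v)\<^sup>2"
proof -
  have "\<bar>v \<bullet> (B *v v)\<bar> \<le> (\<Sum>i\<in>UNIV. \<Sum>j\<in>UNIV. \<bar>B $ i $ j * (v $ i * v $ j)\<bar>)"
    unfolding quadratic_form_sum by (rule order_trans[OF sum_abs sum_mono[OF sum_abs]])
  also have "\<dots> \<le> (\<Sum>i\<in>(UNIV::'n set). \<Sum>j\<in>(UNIV::'n set). norm B * (norm v * norm v))"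
    unfolding abs_mult
    by (intro sum_mono mult_mono component_le_norm_cart mult_nonneg_nonneg matrix_entry_le_norm) auto
  finally show ?thesis by (simp add: power2_eq_square mult_ac)
qed

lemma trace_bound: "\<bar>trace (B::real^'n^'n)\<bar> \<le> real (CARD('n)) * norm B"
proof -
  have "\<bar>trace B\<bar> \<le> (\<Sum>i\<in>(UNIV::'n set). norm B)"
    unfolding trace_def
    by (rule order_trans[OF sum_abs sum_mono]) (rule matrix_entry_le_norm)
  then show ?thesis by simp
qed

text \<open>Taylor with Lagrange remainder along the segment from \<open>y\<close> to
  \<open>y + v\<close>. The Hessian is kept at the intermediate point, where uniform continuity can
  compare it with the Hessian at \<open>y\<close>.\<close>

lemma taylor2:
  fixes g :: "real^'n \<Rightarrow> real"
  assumes g: "\<And>x. (g has_derivative (\<lambda>v. Dg x \<bullet> v)) (at x)"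
    and Dg: "\<And>x. (Dg has_derivative (\<lambda>v. A x *v v)) (at x)"
  obtains t where "0 \<le> t" "t \<le> 1" "g (y + v) = g y + Dg y \<bullet> v + (v \<bullet> (A (y + t *\<^sub>R v) *v v)) / 2"
proof -
  define diff where "diff m t = (if m = 0 then g (y + t *\<^sub>R v) else if m = 1 then Dg (y + t *\<^sub>R v) \<bullet> v
     else v \<bullet> (A (y + t *\<^sub>R v) *v v))" for m :: nat and t :: real
  have l: "((\<lambda>t. y + t *\<^sub>R v) has_derivative (\<lambda>s. s *\<^sub>R v)) (at t)" for t
    by (auto intro!: derivative_eq_intros)
  have D0: "DERIV (diff 0) t :> diff 1 t" for t
    using has_derivative_compose[OF l g, of t]
    by (simp add: diff_def[abs_def] has_field_derivative_def mult.commute[of _ "Dg (y + t *\<^sub>R v) \<bullet> v"])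
  have D1: "DERIV (diff 1) t :> diff 2 t" for t
    using has_derivative_inner_left[OF has_derivative_compose[OF l Dg, of t], of v]
    by (simp add: diff_def[abs_def] has_field_derivative_def inner_commute mult.commute[of _ "_ \<bullet> _"]
        matrix_vector_mult_scaleR)
  have "\<exists>t. 0 < t \<and> t < 1 \<and> diff 0 1 = (\<Sum>m<2. (diff m 0 / fact m) * (1 - 0)^m) + (diff 2 t / fact 2) * (1-0)^2"
  proof (rule Taylor_up[of 2 diff "diff 0" 0 1 0])
    show "\<forall>m t. m < 2 \<and> 0 \<le> t \<and> t \<le> 1 \<longrightarrow> (diff m has_real_derivative diff (Suc m) t) (at t)"
    proof (intro allI impI)
      fix m t assume "m < (2::nat) \<and> (0::real) \<le> t \<and> t \<le> 1"
      then consider "m = 0" | "m = 1" by linarith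
      then show "(diff m has_real_derivative diff (Suc m) t) (at t)"
        by cases (use D0[of t] D1[of t] in \<open>simp_all add: numeral_2_eq_2\<close>)
    qed
  qed auto
  then obtain t where "0 < t" "t < 1" "diff 0 1 = (\<Sum>m<2. diff m 0 / fact m) + diff 2 t / 2"
    by auto
  then show ?thesis
    by (intro that[of t]) (auto simp: diff_def numeral_2_eq_2)
qed

text \<open>The remainder is bounded by even powers of the increment only, so that even Gaussian moments
  suffice although the second derivative is merely uniformly continuous.\<close>

lemma taylor2_remainder:
  fixes g :: "real^'n \<Rightarrow> real"
  assumes g: "\<And>x. (g has_derivative (\<lambda>v. Dg x \<bullet> v)) (at x)"
    and Dg: "\<And>x. (Dg has_derivative (\<lambda>v. A x *v v)) (at x)"
    and A: "uniformly_continuous_on UNIV A" and K: "\<And>x. norm (A x) \<le> K"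
    and e: "e > 0"
  obtains C where "C \<ge> 0"
    "\<And>y v. \<bar>g (y + v) - g y - Dg y \<bullet> v - (v \<bullet> (A y *v v)) / 2\<bar> \<le> e * (norm v)^2 + C * (norm v)^4"
proof -
  let ?n = "real (CARD('n))"
  have n: "?n > 0" by simp
  have "e / ?n^2 > 0" using e by simp
  then obtain d where d: "d > 0" "\<And>x y. dist x y < d \<Longrightarrow> dist (A x) (A y) < e / ?n^2"
    using A unfolding uniformly_continuous_on_def by (metis UNIV_I dist_commute)
  have K0: "K \<ge> 0" using K[of 0] norm_ge_zero by (rule order_trans[rotated])
  show ?thesis
  proof (rule that)
    \<comment> \<open>This constant settles the increments of norm at least \<open>d\<close>: there
      the error is at most n^2 K |v|^2, and |v|^2 \<le> |v|^4 / d^2.\<close>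
    show "?n^2 * K / d^2 \<ge> 0" using K0 by simp
    fix y v
    obtain t where t: "0 \<le> t" "t \<le> 1" "g (y + v) = g y + Dg y \<bullet> v + (v \<bullet> (A (y + t *\<^sub>R v) *v v)) / 2"
      using taylor2[OF g Dg] by blast
    let ?B = "A (y + t *\<^sub>R v) - A y"
    have eq: "g (y + v) - g y - Dg y \<bullet> v - (v \<bullet> (A y *v v)) / 2 = (v \<bullet> (?B *v v)) / 2"
      by (simp add: t(3) matrix_vector_mult_diff_rdistrib inner_diff_right diff_divide_distrib)
    have le: "\<bar>(v \<bullet> (?B *v v)) / 2\<bar> \<le> ?n^2 * norm ?B * (norm v)^2 / 2"
      using quadratic_form_bound[of v ?B] by simp
    show "\<bar>g (y + v) - g y - Dg y \<bullet> v - (v \<bullet> (A y *v v)) / 2\<bar> \<le> e * (norm v)^2 + ?n^2 * K / d^2 * (norm v)^4"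
    proof (cases "norm v < d")
      case True
      have "norm (t *\<^sub>R v) < d" using t True mult_left_le_one_le[of "norm v" t] by simp
      then have "norm ?B \<le> e / ?n^2" using d(2)[of "y + t *\<^sub>R v" y] by (simp add: dist_norm)
      then have "?n^2 * norm ?B \<le> e" by (simp add: field_simps)
      then have "?n^2 * norm ?B * (norm v)^2 / 2 \<le> e * (norm v)^2"
      proof -
        have "?n^2 * norm ?B * (norm v)^2 \<le> e * (norm v)^2"
          using \<open>?n^2 * norm ?B \<le> e\<close> by (rule mult_right_mono) simp
        moreover have "0 \<le> e * (norm v)^2" using e by simp
        ultimately show ?thesis by linarith
      qed
      moreover have "0 \<le> ?n^2 * K / d^2 * (norm v)^4" using K0 by simp
      ultimately show ?thesis unfolding eq using le by linarith
    next
      case False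
      then have "1 \<le> (norm v)^2 / d^2" using d(1) by (simp add: field_simps power_mono)
      then have "(norm v)^2 * 1 \<le> (norm v)^2 * ((norm v)^2 / d^2)" by (intro mult_left_mono) auto
      then have v4: "(norm v)^2 \<le> (norm v)^4 / d^2" by (simp add: power_add[symmetric])
      have "norm ?B \<le> 2 * K" using norm_triangle_ineq4[of "A (y + t *\<^sub>R v)" "A y"] K[of y] K[of "y + t *\<^sub>R v"] by linarith
      then have "?n^2 * norm ?B * (norm v)^2 / 2 \<le> ?n^2 * (2*K) * (norm v)^2 / 2"
        by (intro divide_right_mono mult_right_mono mult_left_mono) auto
      also have "\<dots> \<le> ?n^2 * K * ((norm v)^4 / d^2)"
        using mult_left_mono[OF v4, of "?n^2 * K"] K0 by simp
      finally have "?n^2 * norm ?B * (norm v)^2 / 2 \<le> ?n^2 * K / d^2 * (norm v)^4" by simp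
      moreover have "0 \<le> e * (norm v)^2" using e by simp
      ultimately show ?thesis unfolding eq using le by linarith
    qed
  qed
qed

text \<open>Generator of the diffusion dX = b dt + \<epsilon> dw; the test function enters only
  through its gradient field \<open>Dg\<close> and its Hessian field \<open>A\<close>.\<close>

definition generator where
  "generator b \<epsilon> Dg A x = b x \<bullet> Dg x + \<epsilon>\<^sup>2 / 2 * trace (A x :: real^'n^'n)"

lemma gaussian_quadratic:
  assumes h: "h > 0"
  shows "has_bochner_integral (gaussian h) (\<lambda>v::real^'n. v \<bullet> (B *v v)) (h * trace B)"
proof -
  have "has_bochner_integral (gaussian h) (\<lambda>v::real^'n. v \<bullet> (B *v v)) (\<Sum>i\<in>UNIV. \<Sum>j\<in>UNIV. B $ i $ j * (if i = j then h else 0))"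
    unfolding quadratic_form_sum
    by (intro has_bochner_integral_sum has_bochner_integral_mult_right gaussian_moments h)
  moreover have "(\<Sum>i\<in>UNIV. \<Sum>j\<in>UNIV. B $ i $ j * (if i = j then h else 0)) = h * trace B"
    by (simp add: if_distrib trace_def sum_distrib_left mult.commute cong: if_cong)
  ultimately show ?thesis by simp
qed

lemma gaussian_linear:
  assumes h: "h > 0"
  shows "has_bochner_integral (gaussian h) (\<lambda>v::real^'n. a \<bullet> v) 0"
proof -
  have "has_bochner_integral (gaussian h) (\<lambda>v::real^'n. \<Sum>i\<in>UNIV. a $ i * v $ i) (\<Sum>i\<in>UNIV. a $ i * 0)"
    by (intro has_bochner_integral_sum has_bochner_integral_mult_right gaussian_moments h)
  then show ?thesis by (simp add: inner_vec_def)
qed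

text \<open>An Euler step is split into the drift from \<open>y\<close> to \<open>z\<close> and the
  noise around \<open>z\<close>. Under the Gaussian the linear term vanishes and the quadratic one
  gives h times the trace; the quadratic part of the remainder is a small multiple of h, the quartic
  part is O(h^2). All constants are independent of \<open>y\<close>, hence so is
  \<open>h0\<close>.\<close>

lemma one_step_expansion:
  fixes g :: "real^'n \<Rightarrow> real"
  assumes g: "\<And>x. (g has_derivative (\<lambda>v. Dg x \<bullet> v)) (at x)"
    and Dg: "\<And>x. (Dg has_derivative (\<lambda>v. A x *v v)) (at x)"
    and A: "uniformly_continuous_on UNIV A" and K: "\<And>x. norm (A x) \<le> K"
    and G: "\<And>x. \<bar>g x\<bar> \<le> G" and b: "\<And>x. norm (b x) \<le> B"
    and e: "e > 0"
  obtains h0 where "h0 > 0"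
    "\<And>h y. 0 < h \<Longrightarrow> h < h0 \<Longrightarrow>
      \<bar>integral\<^sup>L (gaussian h) (\<lambda>v. g (y + h *\<^sub>R b y + \<epsilon> *\<^sub>R v)) - g y - h * generator b \<epsilon> Dg A y\<bar> \<le> e * h"
proof -
  let ?n = "real (CARD('n))"
  have K0: "K \<ge> 0" using K[of 0] norm_ge_zero by (rule order_trans[rotated])
  have B0: "B \<ge> 0" using b[of 0] norm_ge_zero by (rule order_trans[rotated])
  have [measurable]: "g \<in> borel_measurable borel"
    by (intro borel_measurable_continuous_onI continuous_at_imp_continuous_on ballI has_derivative_continuous[OF g])
  \<comment> \<open>The Taylor remainder and the replacement of \<open>A z\<close> by
    \<open>A y\<close> each cost e1 \<epsilon>^2 n h; the choice makes either at most e h / 4. The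
    summand 1 keeps the denominator positive when \<epsilon> = 0.\<close>
  define e1 where "e1 = e / (4 * ?n * (\<epsilon>\<^sup>2 + 1))"
  have e1: "e1 > 0" using e unfolding e1_def by (intro divide_pos_pos mult_pos_pos) (auto intro: add_nonneg_pos)
  have e1': "e1 * \<epsilon>\<^sup>2 * ?n \<le> e / 4"
  proof -
    have "\<epsilon>\<^sup>2 / (\<epsilon>\<^sup>2 + 1) \<le> 1" by (simp add: divide_simps add_nonneg_pos)
    then have "e / 4 * (\<epsilon>\<^sup>2 / (\<epsilon>\<^sup>2 + 1)) \<le> e / 4 * 1" using e by (intro mult_left_mono) auto
    moreover have "e1 * \<epsilon>\<^sup>2 * ?n = e / 4 * (\<epsilon>\<^sup>2 / (\<epsilon>\<^sup>2 + 1))"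
      unfolding e1_def by simp
    ultimately show ?thesis by simp
  qed
  obtain C where C: "C \<ge> 0"
    "\<And>y v. \<bar>g (y + v) - g y - Dg y \<bullet> v - (v \<bullet> (A y *v v)) / 2\<bar> \<le> e1 * (norm v)^2 + C * (norm v)^4"
    using taylor2_remainder[OF g Dg A K e1] by blast
  obtain d where d: "d > 0" "\<And>x y. dist x y < d \<Longrightarrow> dist (A x) (A y) < e1"
    using A e1 unfolding uniformly_continuous_on_def by (metis UNIV_I dist_commute)
  \<comment> \<open>Collects the coefficients of h^2: the fourth moment of the noise and the
    second-order term of the drift step.\<close>
  define Q where "Q = 3 * C * \<epsilon>^4 * ?n^2 + ?n^2 * K * B^2"
  have Q0: "Q \<ge> 0" unfolding Q_def using C(1) K0 by simp
  \<comment> \<open>The first bound keeps \<open>z\<close> within the continuity radius of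
    \<open>y\<close>, the second makes Q h at most e / 4.\<close>
  define h0 where "h0 = min (d / (B+1)) (e / (4 * (Q + 1)))"
  show ?thesis
  proof (rule that)
    show "h0 > 0" unfolding h0_def using d(1) B0 e Q0 by simp
    fix h :: real and y :: "real^'n" assume h: "0 < h" and hh: "h < h0"
    interpret prob_space "gaussian h :: (real^'n) measure" by (rule gaussian_moments[OF h])
    define z where "z = y + h *\<^sub>R b y"
    define I where "I = integral\<^sup>L (gaussian h) (\<lambda>v. g (z + \<epsilon> *\<^sub>R v))"
    define T where "T v = g z + \<epsilon> * (Dg z \<bullet> v) + (\<epsilon>\<^sup>2 * (v \<bullet> (A z *v v))) / 2" for v
    have hbT: "has_bochner_integral (gaussian h) T (g z + \<epsilon> * 0 + (\<epsilon>\<^sup>2 * (h * trace (A z))) / 2)"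
      unfolding T_def
      by (intro has_bochner_integral_add has_bochner_integral_divide_zero has_bochner_integral_mult_right
           gaussian_linear gaussian_quadratic h)
         (simp add: has_bochner_integral_iff prob_space[simplified])
    have ig: "integrable (gaussian h) (\<lambda>v. g (z + \<epsilon> *\<^sub>R v))"
      by (rule integrable_const_bound[of _ G]) (use G in auto)
    have R: "\<bar>g (z + \<epsilon> *\<^sub>R v) - T v\<bar> \<le> e1 * \<epsilon>\<^sup>2 * (norm v)^2 + C * \<epsilon>^4 * (norm v)^4" for v
      using C(2)[of z "\<epsilon> *\<^sub>R v"] unfolding T_def
      by (simp add: matrix_vector_mult_scaleR power_mult_distrib algebra_simps power2_eq_square[of \<epsilon>])
    have "\<bar>I - (g z + (\<epsilon>\<^sup>2 * (h * trace (A z))) / 2)\<bar> = \<bar>integral\<^sup>L (gaussian h) (\<lambda>v. g (z + \<epsilon> *\<^sub>R v) - T v)\<bar>"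
      using hbT ig by (simp add: I_def has_bochner_integral_iff)
    also have "\<dots> \<le> integral\<^sup>L (gaussian h) (\<lambda>v. \<bar>g (z + \<epsilon> *\<^sub>R v) - T v\<bar>)"
      by (rule integral_abs_bound)
    also have "\<dots> \<le> integral\<^sup>L (gaussian h) (\<lambda>v. e1 * \<epsilon>\<^sup>2 * (norm (v::real^'n))^2 + C * \<epsilon>^4 * (norm v)^4)"
      using hbT ig gaussian_norm_moments[OF h] R
      by (intro integral_mono) (auto simp: has_bochner_integral_iff)
    also have "\<dots> = e1 * \<epsilon>\<^sup>2 * (?n * h) + C * \<epsilon>^4 * integral\<^sup>L (gaussian h) (\<lambda>v. (norm (v::real^'n))^4)"
      using gaussian_norm_moments[OF h, where 'n='n] by simp
    also have "\<dots> \<le> e1 * \<epsilon>\<^sup>2 * (?n * h) + C * \<epsilon>^4 * (3 * ?n^2 * h^2)"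
      using gaussian_norm_moments(4)[OF h, where 'n='n] C(1) by (intro add_left_mono mult_left_mono) auto
    finally have 1: "\<bar>I - (g z + (\<epsilon>\<^sup>2 * (h * trace (A z))) / 2)\<bar> \<le> e1 * \<epsilon>\<^sup>2 * ?n * h + 3 * C * \<epsilon>^4 * ?n^2 * h^2"
      by (simp add: algebra_simps)
    have hb: "norm (h *\<^sub>R b y) \<le> h * B" using h b by simp
    obtain t where t: "0 \<le> t" "t \<le> 1" "g z = g y + Dg y \<bullet> (h *\<^sub>R b y) + ((h *\<^sub>R b y) \<bullet> (A (y + t *\<^sub>R h *\<^sub>R b y) *v (h *\<^sub>R b y))) / 2"
      using taylor2[OF g Dg] unfolding z_def by blast
    have "\<bar>(h *\<^sub>R b y) \<bullet> (A (y + t *\<^sub>R h *\<^sub>R b y) *v (h *\<^sub>R b y))\<bar> \<le> ?n^2 * norm (A (y + t *\<^sub>R h *\<^sub>R b y)) * (norm (h *\<^sub>R b y))^2"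
      by (rule quadratic_form_bound)
    also have "\<dots> \<le> ?n^2 * K * (h * B)^2"
      using K hb K0 by (intro mult_mono power_mono) auto
    finally have 2: "\<bar>g z - g y - h * (b y \<bullet> Dg y)\<bar> \<le> ?n^2 * K * B^2 * h^2"
      using t(3) K0 by (simp add: inner_commute power_mult_distrib algebra_simps)
    have "h * (B + 1) < d" using hh B0 unfolding h0_def by (simp add: field_simps)
    then have "dist z y < d" using hb h unfolding z_def dist_norm by (simp only: add_diff_cancel_left' distrib_left mult_1_right)
    then have "norm (A z - A y) < e1" using d(2) by (simp add: dist_norm)
    then have "?n * norm (A z - A y) \<le> ?n * e1" by simp
    then have "\<bar>trace (A z) - trace (A y)\<bar> \<le> ?n * e1"
      using trace_bound[of "A z - A y"] unfolding trace_sub by linarith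
    then have "\<bar>\<epsilon>\<^sup>2 / 2 * h * (trace (A z) - trace (A y))\<bar> \<le> \<epsilon>\<^sup>2 / 2 * h * (?n * e1)"
      using h by (subst abs_mult) (intro mult_mono, auto)
    then have 3: "\<bar>\<epsilon>\<^sup>2 / 2 * h * trace (A z) - \<epsilon>\<^sup>2 / 2 * h * trace (A y)\<bar> \<le> e1 * \<epsilon>\<^sup>2 * ?n * h"
      using h e1 mult_nonneg_nonneg[of "e1 * \<epsilon>\<^sup>2 * ?n" h] by (simp add: algebra_simps)
    have "\<bar>I - g y - h * generator b \<epsilon> Dg A y\<bar> \<le> 2 * (e1 * \<epsilon>\<^sup>2 * ?n) * h + Q * h^2"
      using 1 2 3 unfolding generator_def Q_def by (simp add: algebra_simps abs_le_iff)
    also have "\<dots> \<le> e / 2 * h + e / 4 * h"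
    proof -
      have "(Q + 1) * h \<le> e / 4" using hh Q0 unfolding h0_def by (simp add: field_simps)
      then have "Q * h \<le> e / 4" using h by (simp add: algebra_simps)
      then have "Q * h * h \<le> e / 4 * h" using h by (intro mult_right_mono) auto
      moreover have "2 * (e1 * \<epsilon>\<^sup>2 * ?n) * h \<le> e / 2 * h" using e1' h by (intro mult_right_mono) auto
      ultimately show ?thesis by (simp add: power2_eq_square mult_ac)
    qed
    also have "\<dots> \<le> e * h" using e h by simp
    finally show "\<bar>integral\<^sup>L (gaussian h) (\<lambda>v. g (y + h *\<^sub>R b y + \<epsilon> *\<^sub>R v)) - g y - h * generator b \<epsilon> Dg A y\<bar> \<le> e * h"
      unfolding I_def z_def .
  qed
qed

section \<open>The Euler scheme with independent Gaussian increments\<close>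

primrec euler :: "(real^'n \<Rightarrow> real^'n) \<Rightarrow> real \<Rightarrow> real \<Rightarrow> real^'n \<Rightarrow> (nat \<Rightarrow> real^'n) \<Rightarrow> nat \<Rightarrow> real^'n" where
  "euler b \<epsilon> h x0 d 0 = x0"
| "euler b \<epsilon> h x0 d (Suc k) = euler b \<epsilon> h x0 d k + h *\<^sub>R b (euler b \<epsilon> h x0 d k) + \<epsilon> *\<^sub>R d k"

lemma euler_cong:
  assumes "\<And>i. i < k \<Longrightarrow> d i = d' i"
  shows "euler b \<epsilon> h x0 d k = euler b \<epsilon> h x0 d' k"
  using assms by (induction k) auto

lemma euler_measurable:
  assumes b: "continuous_on UNIV b"
  shows "k \<le> N \<Longrightarrow> (\<lambda>d. euler b \<epsilon> h x0 d k) \<in> measurable (Pi\<^sub>M {..<N} (\<lambda>_. borel)) borel"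
proof (induction k)
  case (Suc k)
  have [measurable]: "b \<in> borel_measurable borel" using b by (rule borel_measurable_continuous_onI)
  have [measurable]: "(\<lambda>d. euler b \<epsilon> h x0 d k) \<in> measurable (Pi\<^sub>M {..<N} (\<lambda>_. borel)) borel"
    using Suc by simp
  have [measurable]: "(\<lambda>d. d k) \<in> measurable (Pi\<^sub>M {..<N} (\<lambda>_. borel :: (real^'n) measure)) borel"
    using Suc.prems by (intro measurable_component_singleton) auto
  show ?case by simp
qed simp

text \<open>The expectations of \<open>g\<close> telescope along the scheme. Only the two end
  values, each at most \<open>G\<close>, and the accumulated one-step errors remain.\<close>

lemma (in prob_space) euler_generator_sum:
  fixes g :: "real^'n \<Rightarrow> real"
  assumes cont: "continuous_on UNIV b" "continuous_on UNIV g" "continuous_on UNIV L"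
    and G: "\<And>x. \<bar>g x\<bar> \<le> G" and L: "\<And>x. \<bar>L x\<bar> \<le> LB"
    and step: "\<And>y. \<bar>integral\<^sup>L (gaussian h) (\<lambda>v. g (y + h *\<^sub>R b y + \<epsilon> *\<^sub>R v)) - g y - h * L y\<bar> \<le> e * h"
    and ind: "indep_vars (\<lambda>_. borel) D {..<N}"
    and D: "\<And>k. k < N \<Longrightarrow> distr M borel (D k) = gaussian h"
  shows "\<bar>expectation (\<lambda>\<omega>. h * (\<Sum>k<N. L (euler b \<epsilon> h x0 (\<lambda>i. D i \<omega>) k)))\<bar> \<le> 2 * G + real N * (e * h)"
proof -
  define Y where "Y k \<omega> = euler b \<epsilon> h x0 (\<lambda>i. D i \<omega>) k" for k \<omega>
  have [measurable]: "b \<in> borel_measurable borel" "g \<in> borel_measurable borel" "L \<in> borel_measurable borel"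
    using cont by (auto intro: borel_measurable_continuous_onI)
  have DM: "D k \<in> borel_measurable M" if "k < N" for k
    using ind that unfolding indep_vars_def by auto
  \<comment> \<open>Makes the \<open>k\<close>-th iterate a function of the increments with index
    below \<open>k\<close>; independence of the next increment is then independence over disjoint
    index sets.\<close>
  have Yr: "Y k \<omega> = euler b \<epsilon> h x0 (restrict (\<lambda>i. D i \<omega>) {..<k}) k" for k \<omega>
    unfolding Y_def by (rule euler_cong) simp
  have YM: "Y k \<in> borel_measurable M" if "k \<le> N" for k
  proof -
    have "(\<lambda>\<omega>. restrict (\<lambda>i. D i \<omega>) {..<k}) \<in> measurable M (Pi\<^sub>M {..<k} (\<lambda>_. borel))"
      using that DM by (intro measurable_restrict) auto
    then have "(\<lambda>\<omega>. euler b \<epsilon> h x0 (restrict (\<lambda>i. D i \<omega>) {..<k}) k) \<in> borel_measurable M"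
      using euler_measurable[OF cont(1) order_refl] by (rule measurable_compose)
    then show ?thesis unfolding Yr[symmetric] by simp
  qed
  have step': "\<bar>expectation (\<lambda>\<omega>. g (Y (Suc k) \<omega>)) - expectation (\<lambda>\<omega>. g (Y k \<omega>)) - h * expectation (\<lambda>\<omega>. L (Y k \<omega>))\<bar> \<le> e * h"
    if k: "k < N" for k
  proof -
    \<comment> \<open>The conditional expectation of \<open>g\<close> after one more step, as a
      function of the current position; Fubini on the product law justifies this reading.\<close>
    define \<Phi> where "\<Phi> y = integral\<^sup>L (gaussian h) (\<lambda>v. g (y + h *\<^sub>R b y + \<epsilon> *\<^sub>R v))" for y
    have [measurable]: "Y k \<in> borel_measurable M" "D k \<in> borel_measurable M" using YM DM k by auto
    have "indep_var (Pi\<^sub>M {..<k} (\<lambda>_. borel)) (\<lambda>\<omega>. restrict (\<lambda>i. D i \<omega>) {..<k})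
        (Pi\<^sub>M {k} (\<lambda>_. borel)) (\<lambda>\<omega>. restrict (\<lambda>i. D i \<omega>) {k})"
      using k by (intro indep_var_restrict[OF ind]) auto
    then have "indep_var borel ((\<lambda>d. euler b \<epsilon> h x0 d k) \<circ> (\<lambda>\<omega>. restrict (\<lambda>i. D i \<omega>) {..<k}))
       borel ((\<lambda>d. d k) \<circ> (\<lambda>\<omega>. restrict (\<lambda>i. D i \<omega>) {k}))"
      by (rule indep_var_compose)
         (auto intro!: euler_measurable cont measurable_component_singleton)
    moreover have "(\<lambda>d. euler b \<epsilon> h x0 d k) \<circ> (\<lambda>\<omega>. restrict (\<lambda>i. D i \<omega>) {..<k}) = Y k"
      "(\<lambda>d. d k) \<circ> (\<lambda>\<omega>. restrict (\<lambda>i. D i \<omega>) {k}) = D k"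
      using Yr by (auto simp: fun_eq_iff)
    ultimately have iv: "indep_var borel (Y k) borel (D k)" by simp
    then have pd: "distr M borel (Y k) \<Otimes>\<^sub>M gaussian h = distr M (borel \<Otimes>\<^sub>M borel) (\<lambda>x. (Y k x, D k x))"
      unfolding indep_var_distribution_eq using D[OF k] by simp
    interpret dY: prob_space "distr M borel (Y k)" by (rule prob_space_distr) simp
    interpret dG: prob_space "gaussian h :: (real^'n) measure"
      using D[OF k, symmetric] by (simp add: prob_space_distr)
    interpret PP: pair_prob_space "distr M borel (Y k)" "gaussian h :: (real^'n) measure" ..
    define F where "F = (\<lambda>p. g (fst p + h *\<^sub>R b (fst p) + \<epsilon> *\<^sub>R snd p))"
    have Fm: "F \<in> borel_measurable (borel \<Otimes>\<^sub>M borel)" unfolding F_def by measurable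
    have Fi: "integrable (distr M borel (Y k) \<Otimes>\<^sub>M gaussian h) F"
      by (rule PP.P.integrable_const_bound[of _ G]) (use G Fm in \<open>auto simp: F_def cong: measurable_cong_sets\<close>)
    have "expectation (\<lambda>\<omega>. g (Y (Suc k) \<omega>)) = expectation (\<lambda>\<omega>. F (Y k \<omega>, D k \<omega>))"
      by (simp add: F_def Y_def)
    also have "\<dots> = integral\<^sup>L (distr M borel (Y k) \<Otimes>\<^sub>M gaussian h) F"
      unfolding pd by (subst integral_distr) (use Fm in auto)
    also have "\<dots> = integral\<^sup>L (distr M borel (Y k)) (\<lambda>y. integral\<^sup>L (gaussian h) (\<lambda>v. F (y, v)))"
      using PP.integral_fst'[OF Fi] by simp
    also have "\<dots> = integral\<^sup>L (distr M borel (Y k)) \<Phi>"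
      by (simp add: F_def \<Phi>_def[abs_def])
    also have "\<dots> = expectation (\<lambda>\<omega>. \<Phi> (Y k \<omega>))"
    proof (rule integral_distr)
      show "\<Phi> \<in> borel_measurable borel" unfolding \<Phi>_def by measurable
    qed simp
    finally have e1: "expectation (\<lambda>\<omega>. g (Y (Suc k) \<omega>)) = expectation (\<lambda>\<omega>. \<Phi> (Y k \<omega>))" .
    have \<Phi>m[measurable]: "\<Phi> \<in> borel_measurable borel" unfolding \<Phi>_def by measurable
    have \<Phi>G: "\<bar>\<Phi> y\<bar> \<le> G" for y
      unfolding \<Phi>_def
      by (rule order_trans[OF integral_abs_bound], rule dG.integral_le_const)
         (auto intro!: dG.integrable_const_bound[of _ G] simp: G)
    have i1: "integrable M (\<lambda>\<omega>. \<Phi> (Y k \<omega>))" by (rule integrable_const_bound[of _ G]) (auto simp: \<Phi>G)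
    have i2: "integrable M (\<lambda>\<omega>. g (Y k \<omega>))" by (rule integrable_const_bound[of _ G]) (auto simp: G)
    have i3: "integrable M (\<lambda>\<omega>. L (Y k \<omega>))" by (rule integrable_const_bound[of _ LB]) (auto simp: L)
    have "expectation (\<lambda>\<omega>. g (Y (Suc k) \<omega>)) - expectation (\<lambda>\<omega>. g (Y k \<omega>)) - h * expectation (\<lambda>\<omega>. L (Y k \<omega>))
      = expectation (\<lambda>\<omega>. \<Phi> (Y k \<omega>) - g (Y k \<omega>) - h * L (Y k \<omega>))"
      unfolding e1 using i1 i2 i3 by simp
    also have "\<bar>\<dots>\<bar> \<le> expectation (\<lambda>\<omega>. \<bar>\<Phi> (Y k \<omega>) - g (Y k \<omega>) - h * L (Y k \<omega>)\<bar>)"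
      by (rule integral_abs_bound)
    also have "\<dots> \<le> e * h"
      using i1 i2 i3 step unfolding \<Phi>_def[symmetric] by (intro integral_le_const) auto
    finally show ?thesis .
  qed
  have EG: "\<bar>expectation (\<lambda>\<omega>. g (Y k \<omega>))\<bar> \<le> G" if k: "k \<le> N" for k
  proof -
    have [measurable]: "Y k \<in> borel_measurable M" using YM k by auto
    show ?thesis
      by (rule order_trans[OF integral_abs_bound], rule integral_le_const)
         (auto intro!: integrable_const_bound[of _ G] simp: G)
  qed
  have sum: "k \<le> N \<Longrightarrow> \<bar>expectation (\<lambda>\<omega>. g (Y k \<omega>)) - expectation (\<lambda>\<omega>. g (Y 0 \<omega>)) - h * (\<Sum>i<k. expectation (\<lambda>\<omega>. L (Y i \<omega>)))\<bar> \<le> real k * (e * h)" for k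
  proof (induction k)
    case (Suc k)
    then show ?case using step'[of k] by (auto simp: algebra_simps abs_le_iff)
  qed simp
  have "expectation (\<lambda>\<omega>. h * (\<Sum>k<N. L (Y k \<omega>))) = h * (\<Sum>k<N. expectation (\<lambda>\<omega>. L (Y k \<omega>)))"
  proof -
    have "integrable M (\<lambda>\<omega>. L (Y k \<omega>))" if "k \<in> {..<N}" for k
      using YM[of k] that by (intro integrable_const_bound[of _ LB]) (auto simp: L)
    then show ?thesis by (simp add: Bochner_Integration.integral_sum)
  qed
  then show "\<bar>expectation (\<lambda>\<omega>. h * (\<Sum>k<N. L (euler b \<epsilon> h x0 (\<lambda>i. D i \<omega>) k)))\<bar> \<le> 2 * G + real N * (e * h)"
    using sum[of N] EG[of N] EG[of 0] unfolding Y_def[symmetric] by linarith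
qed

text \<open>A Riemann sum with arbitrary weights \<open>c k\<close> that stay within
  \<open>e\<close> of \<open>f\<close> on the whole cell, so that values at the Euler iterates may
  stand in for values along the path.\<close>

lemma sum_integral_split:
  fixes f :: "real \<Rightarrow> real"
  assumes f: "continuous_on {0..real m * h} f" and h: "0 \<le> h"
    and c: "\<And>k s. k < m \<Longrightarrow> real k * h \<le> s \<Longrightarrow> s \<le> real (Suc k) * h \<Longrightarrow> \<bar>c k - f s\<bar> \<le> e"
  shows "\<bar>h * (\<Sum>k<m. c k) - integral {0..real m * h} f\<bar> \<le> real m * h * e"
  using f c
proof (induction m)
  case (Suc m)
  have sub: "{0..real m * h} \<subseteq> {0..real (Suc m) * h}" using h by (auto simp: algebra_simps)
  have IH: "\<bar>h * (\<Sum>k<m. c k) - integral {0..real m * h} f\<bar> \<le> real m * h * e"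
    using Suc.IH[OF continuous_on_subset[OF Suc.prems(1) sub]] Suc.prems(2) by simp
  have i: "f integrable_on {0..real (Suc m) * h}" using Suc.prems(1) by (rule integrable_continuous_interval)
  have mh: "real m * h \<le> real (Suc m) * h" "0 \<le> real m * h" using h by (auto simp: algebra_simps)
  have ii: "f integrable_on {real m * h..real (Suc m) * h}"
    by (rule integrable_on_subinterval[OF i]) (use mh in auto)
  have comb: "integral {0..real m * h} f + integral {real m * h..real (Suc m) * h} f = integral {0..real (Suc m) * h} f"
    by (rule Henstock_Kurzweil_Integration.integral_combine) (use mh i in auto)
  have "norm (integral {real m * h..real (Suc m) * h} (\<lambda>s. c m - f s)) \<le> e * (real (Suc m) * h - real m * h)"
    by (rule integral_bound) (use Suc.prems mh in \<open>auto intro!: continuous_intros continuous_on_subset[OF Suc.prems(1)]\<close>)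
  also have "integral {real m * h..real (Suc m) * h} (\<lambda>s. c m - f s) = h * c m - integral {real m * h..real (Suc m) * h} f"
    using ii mh by (subst integral_diff) (auto simp: algebra_simps)
  finally have "\<bar>h * c m - integral {real m * h..real (Suc m) * h} f\<bar> \<le> h * e"
    by (simp add: algebra_simps)
  with IH show ?case unfolding comb[symmetric] by (simp add: algebra_simps abs_le_iff)
qed simp

text \<open>The scheme uses the increments of the same path \<open>w\<close>, so the noise cancels
  exactly in the error. What remains is the drift discrepancy, at most h Lb times the oscillation of
  the path over one cell, and the discrete Gronwall inequality sums it up.\<close>

lemma euler_error:
  fixes x :: "real \<Rightarrow> real^'n"
  assumes x: "continuous_on {0..} x"
    and sde: "\<And>t. t \<ge> 0 \<Longrightarrow> x t = x0 + integral {0..t} (\<lambda>s. b (x s)) + \<epsilon> *\<^sub>R w t"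
    and w0: "w 0 = 0"
    and lip: "\<And>y z. norm (b y - b z) \<le> Lb * norm (y - z)" and Lb: "0 \<le> Lb" and h: "0 < h" and \<eta>: "0 \<le> \<eta>"
    and osc: "\<And>k s. k < N \<Longrightarrow> real k * h \<le> s \<Longrightarrow> s \<le> real (Suc k) * h \<Longrightarrow> norm (x s - x (real k * h)) \<le> \<eta>"
  shows "k \<le> N \<Longrightarrow> norm (euler b \<epsilon> h x0 (\<lambda>i. w (real (Suc i) * h) - w (real i * h)) k - x (real k * h))
     \<le> (1 + Lb * h) ^ k * (real k * (h * Lb * \<eta>))"
proof (induction k)
  case 0
  then show ?case using sde[of 0] w0 by simp
next
  case (Suc k)
  let ?Y = "euler b \<epsilon> h x0 (\<lambda>i. w (real (Suc i) * h) - w (real i * h))"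
  have bc: "continuous_on UNIV b"
  proof -
    have "Lb-lipschitz_on UNIV b" using lip Lb by (auto intro!: lipschitz_onI simp: dist_norm)
    then show ?thesis by (rule lipschitz_on_continuous_on)
  qed
  have kh: "0 \<le> real k * h" "real k * h \<le> real (Suc k) * h" using h by (auto simp: algebra_simps)
  have cbx: "continuous_on {0..real (Suc k) * h} (\<lambda>s. b (x s))"
    by (rule continuous_on_compose2[OF bc continuous_on_subset[OF x]]) auto
  have i: "(\<lambda>s. b (x s)) integrable_on {0..real (Suc k) * h}" using cbx by (rule integrable_continuous_interval)
  have ii: "(\<lambda>s. b (x s)) integrable_on {real k * h..real (Suc k) * h}"
    by (rule integrable_on_subinterval[OF i]) (use kh in auto)
  have comb: "integral {0..real k * h} (\<lambda>s. b (x s)) + integral {real k * h..real (Suc k) * h} (\<lambda>s. b (x s)) = integral {0..real (Suc k) * h} (\<lambda>s. b (x s))"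
    by (rule Henstock_Kurzweil_Integration.integral_combine) (use kh i in auto)
  have xs: "x (real (Suc k) * h) = x (real k * h) + integral {real k * h..real (Suc k) * h} (\<lambda>s. b (x s)) + \<epsilon> *\<^sub>R (w (real (Suc k) * h) - w (real k * h))"
    using sde[of "real (Suc k) * h"] sde[of "real k * h"] kh comb[symmetric] by (simp add: algebra_simps)
  let ?xk = "x (real k * h)"
  have "norm (integral {real k * h..real (Suc k) * h} (\<lambda>s. b ?xk - b (x s))) \<le> (Lb * \<eta>) * (real (Suc k) * h - real k * h)"
  proof (rule integral_bound)
    show "continuous_on {real k * h..real (Suc k) * h} (\<lambda>s. b ?xk - b (x s))"
      by (intro continuous_intros continuous_on_subset[OF cbx]) (use kh in auto)
    fix s assume s: "s \<in> {real k * h..real (Suc k) * h}"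
    have "norm (b ?xk - b (x s)) \<le> Lb * norm (?xk - x s)" by (rule lip)
    also have "\<dots> \<le> Lb * \<eta>" using osc[of k s] Suc.prems s Lb by (intro mult_left_mono) (auto simp: norm_minus_commute)
    finally show "norm (b ?xk - b (x s)) \<le> Lb * \<eta>" .
  qed (use kh in auto)
  also have "integral {real k * h..real (Suc k) * h} (\<lambda>s. b ?xk - b (x s)) = h *\<^sub>R b ?xk - integral {real k * h..real (Suc k) * h} (\<lambda>s. b (x s))"
    using ii kh by (subst integral_diff) (auto simp: algebra_simps)
  finally have e1: "norm (h *\<^sub>R b ?xk - integral {real k * h..real (Suc k) * h} (\<lambda>s. b (x s))) \<le> h * Lb * \<eta>"
    by (simp add: algebra_simps)
  have e2: "norm (h *\<^sub>R (b (?Y k) - b ?xk)) \<le> h * (Lb * norm (?Y k - ?xk))"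
    using lip[of "?Y k" ?xk] h by simp
  have "?Y (Suc k) - x (real (Suc k) * h) = (?Y k - ?xk) + h *\<^sub>R (b (?Y k) - b ?xk) + (h *\<^sub>R b ?xk - integral {real k * h..real (Suc k) * h} (\<lambda>s. b (x s)))"
    unfolding xs by (simp add: algebra_simps)
  then have "norm (?Y (Suc k) - x (real (Suc k) * h)) \<le> norm (?Y k - ?xk) + h * (Lb * norm (?Y k - ?xk)) + h * Lb * \<eta>"
    using e1 e2 by (smt (verit) norm_triangle_ineq)
  also have "\<dots> = (1 + Lb * h) * norm (?Y k - ?xk) + h * Lb * \<eta>" by (simp add: algebra_simps)
  also have "\<dots> \<le> (1 + Lb * h) * ((1 + Lb * h) ^ k * (real k * (h * Lb * \<eta>))) + (1 + Lb * h) ^ Suc k * (h * Lb * \<eta>)"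
  proof (intro add_mono mult_left_mono)
    have "1 * (h * Lb * \<eta>) \<le> (1 + Lb * h) ^ Suc k * (h * Lb * \<eta>)"
      using Lb h \<eta> by (intro mult_right_mono one_le_power) auto
    then show "h * Lb * \<eta> \<le> (1 + Lb * h) ^ Suc k * (h * Lb * \<eta>)" by simp
  qed (use Suc Lb h in auto)
  also have "\<dots> = (1 + Lb * h) ^ Suc k * (real (Suc k) * (h * Lb * \<eta>))" by (simp add: algebra_simps)
  finally show ?case .
qed

text \<open>A statement about one fixed path, without probability: refinement makes the oscillation
  per cell small, while the Gronwall factor stays below exp (Lb T).\<close>

lemma euler_riemann_sum_tendsto:
  fixes x :: "real \<Rightarrow> real^'n"
  assumes x: "continuous_on {0..} x"
    and sde: "\<And>t. t \<ge> 0 \<Longrightarrow> x t = x0 + integral {0..t} (\<lambda>s. b (x s)) + \<epsilon> *\<^sub>R w t"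
    and w0: "w 0 = 0"
    and lip: "\<And>y z. norm (b y - b z) \<le> Lb * norm (y - z)" and Lb: "0 \<le> Lb" and T: "0 < T"
    and f: "uniformly_continuous_on UNIV f"
  shows "(\<lambda>N. T / real (Suc N) * (\<Sum>k<Suc N. f (euler b \<epsilon> (T / real (Suc N)) x0
      (\<lambda>i. w (real (Suc i) * (T / real (Suc N))) - w (real i * (T / real (Suc N)))) k)))
     \<longlonglongrightarrow> integral {0..T} (\<lambda>s. f (x s) :: real)"
proof (rule LIMSEQ_I)
  fix r :: real assume r: "0 < r"
  define e where "e = r / (2 * T)"
  have e: "e > 0" using r T by (simp add: e_def)
  obtain d where d: "d > 0" "\<And>y z. dist y z < d \<Longrightarrow> dist (f y) (f z) < e"
    using f e unfolding uniformly_continuous_on_def by (metis UNIV_I)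
  \<comment> \<open>The distance from the scheme to the path is at most q \<eta>: one \<eta> for the
    oscillation within the cell, the rest for the accumulated Euler error. Hence \<eta> = d / (2 q)
    keeps it below \<open>d\<close>.\<close>
  define q where "q = 1 + exp (Lb * T) * (T * Lb)"
  have q: "q > 0" using T Lb unfolding q_def by (intro add_pos_nonneg) auto
  define \<eta> where "\<eta> = d / (2 * q)"
  have \<eta>: "\<eta> > 0" using d q by (simp add: \<eta>_def)
  have "uniformly_continuous_on {0..T} x"
    by (rule compact_uniformly_continuous[OF continuous_on_subset[OF x]]) auto
  then obtain \<delta> where \<delta>: "\<delta> > 0" "\<And>s t. s \<in> {0..T} \<Longrightarrow> t \<in> {0..T} \<Longrightarrow> dist s t < \<delta> \<Longrightarrow> dist (x s) (x t) < \<eta>"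
    using \<eta> unfolding uniformly_continuous_on_def by metis
  obtain N0 where N0: "T / \<delta> < real N0" using reals_Archimedean2 by blast
  show "\<exists>no. \<forall>N\<ge>no. norm (T / real (Suc N) * (\<Sum>k<Suc N. f (euler b \<epsilon> (T / real (Suc N)) x0
      (\<lambda>i. w (real (Suc i) * (T / real (Suc N))) - w (real i * (T / real (Suc N)))) k)) - integral {0..T} (\<lambda>s. f (x s))) < r"
  proof (intro exI allI impI)
    fix N assume N: "N0 \<le> N"
    define h where "h = T / real (Suc N)"
    have h: "h > 0" using T by (simp add: h_def)
    have Nh: "real (Suc N) * h = T" by (simp add: h_def)
    have "T / \<delta> < real (Suc N)" using N N0 by linarith
    then have h\<delta>: "h < \<delta>" using \<delta>(1) by (simp add: h_def field_simps)
    have kT: "real k * h \<le> T" if "k \<le> Suc N" for k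
      using that h mult_right_mono[of "real k" "real (Suc N)" h] unfolding Nh by simp
    have osc: "norm (x s - x (real k * h)) \<le> \<eta>" if "k < Suc N" "real k * h \<le> s" "s \<le> real (Suc k) * h" for k s
    proof -
      have "0 \<le> real k * h" "real (Suc k) * h \<le> T" using h kT[of "Suc k"] that by auto
      moreover from this have "0 \<le> s" using that by linarith
      ultimately have "dist (x s) (x (real k * h)) < \<eta>"
        using that h\<delta> by (intro \<delta>(2)) (auto simp: dist_real_def algebra_simps)
      then show ?thesis by (simp add: dist_norm)
    qed
    let ?Y = "euler b \<epsilon> h x0 (\<lambda>i. w (real (Suc i) * h) - w (real i * h))"
    have Yx: "norm (?Y k - x s) < d" if "k < Suc N" "real k * h \<le> s" "s \<le> real (Suc k) * h" for k s
    proof -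
      have "norm (?Y k - x (real k * h)) \<le> (1 + Lb * h) ^ k * (real k * (h * Lb * \<eta>))"
        by (rule euler_error[where N="Suc N", OF x sde w0 lip Lb h less_imp_le[OF \<eta>] osc]) (use that in auto)
      also have "\<dots> \<le> exp (Lb * T) * (T * Lb * \<eta>)"
      proof (rule mult_mono)
        have "(1 + Lb * h) ^ k \<le> exp (Lb * h) ^ k"
          using Lb h exp_ge_add_one_self[of "Lb * h"] by (intro power_mono) auto
        also have "\<dots> = exp (Lb * (real k * h))" by (simp add: exp_of_nat_mult[symmetric] algebra_simps)
        also have "\<dots> \<le> exp (Lb * T)" using kT[of k] that Lb by (simp add: mult_left_mono)
        finally show "(1 + Lb * h) ^ k \<le> exp (Lb * T)" .
        have "real k * (h * Lb * \<eta>) = (real k * h) * (Lb * \<eta>)" by simp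
        also have "\<dots> \<le> T * (Lb * \<eta>)" using kT[of k] that Lb \<eta> by (intro mult_right_mono) auto
        finally show "real k * (h * Lb * \<eta>) \<le> T * Lb * \<eta>" by simp
      qed (use Lb h \<eta> in auto)
      finally have "norm (?Y k - x (real k * h)) \<le> exp (Lb * T) * (T * Lb * \<eta>)" .
      moreover have "norm (x s - x (real k * h)) \<le> \<eta>" using osc that by auto
      ultimately have "norm (?Y k - x s) \<le> \<eta> + exp (Lb * T) * (T * Lb * \<eta>)"
        using norm_triangle_ineq4[of "?Y k - x (real k * h)" "x s - x (real k * h)"] by simp
      also have "\<dots> = q * \<eta>" by (simp add: q_def algebra_simps)
      also have "\<dots> < d" using q d unfolding \<eta>_def by simp
      finally show ?thesis .
    qed
    have fc: "continuous_on UNIV f" using f by (rule uniformly_continuous_imp_continuous)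
    have "\<bar>h * (\<Sum>k<Suc N. f (?Y k)) - integral {0..real (Suc N) * h} (\<lambda>s. f (x s))\<bar> \<le> real (Suc N) * h * e"
    proof (rule sum_integral_split)
      show "continuous_on {0..real (Suc N) * h} (\<lambda>s. f (x s))"
        by (rule continuous_on_compose2[OF fc continuous_on_subset[OF x]]) auto
      fix k s assume "k < Suc N" "real k * h \<le> s" "s \<le> real (Suc k) * h"
      then show "\<bar>f (?Y k) - f (x s)\<bar> \<le> e" using d(2)[of "?Y k" "x s"] Yx[of k s] by (simp add: dist_norm)
    qed (use h in auto)
    also have "\<dots> < r" unfolding Nh e_def using r T by simp
    finally show "norm (T / real (Suc N) * (\<Sum>k<Suc N. f (euler b \<epsilon> (T / real (Suc N)) x0
      (\<lambda>i. w (real (Suc i) * (T / real (Suc N))) - w (real i * (T / real (Suc N)))) k)) - integral {0..T} (\<lambda>s. f (x s))) < r"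
      unfolding Nh h_def[symmetric] by simp
  qed
qed

text \<open>Working with the Euler scheme avoids the stochastic integral: its iterates are explicit
  functions of the past increments, hence independent of the next one, and they converge to the
  solution path by path because the noise is additive.\<close>

lemma dynkin_bound:
  fixes g :: "real^'n \<Rightarrow> real" and X :: "real \<Rightarrow> 'w \<Rightarrow> real^'n"
  assumes BM: "brownian_motion M w"
    and X: "\<And>\<omega>. \<omega> \<in> space M \<Longrightarrow> continuous_on {0..} (\<lambda>t. X t \<omega>)"
    and sde: "\<And>\<omega> t. \<omega> \<in> space M \<Longrightarrow> t \<ge> 0 \<Longrightarrow> X t \<omega> = x0 + integral {0..t} (\<lambda>s. b (X s \<omega>)) + \<epsilon> *\<^sub>R w t \<omega>"
    and lip: "\<And>y z. norm (b y - b z) \<le> Lb * norm (y - z)" and Lb: "0 \<le> Lb" and B: "\<And>y. norm (b y) \<le> B"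
    and g: "\<And>x. (g has_derivative (\<lambda>v. Dg x \<bullet> v)) (at x)"
    and Dg: "\<And>x. (Dg has_derivative (\<lambda>v. A x *v v)) (at x)"
    and A: "uniformly_continuous_on UNIV A" and K: "\<And>x. norm (A x) \<le> K"
    and G: "\<And>x. \<bar>g x\<bar> \<le> G"
    and Lu: "uniformly_continuous_on UNIV (generator b \<epsilon> Dg A)" and LB: "\<And>x. \<bar>generator b \<epsilon> Dg A x\<bar> \<le> LB"
    and T: "0 < T"
  shows "\<bar>\<integral>\<omega>. integral {0..T} (\<lambda>t. generator b \<epsilon> Dg A (X t \<omega>)) \<partial>M\<bar> \<le> 2 * G"
proof -
  interpret prob_space M using BM by (simp add: brownian_motion_def)
  let ?L = "generator b \<epsilon> Dg A"
  define h where "h N = T / real (Suc N)" for N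
  define D where "D N i \<omega> = w (real (Suc i) * h N) \<omega> - w (real i * h N) \<omega>" for N i \<omega>
  define s where "s N \<omega> = h N * (\<Sum>k<Suc N. ?L (euler b \<epsilon> (h N) x0 (\<lambda>i. D N i \<omega>) k))" for N \<omega>
  have h: "h N > 0" for N using T by (simp add: h_def)
  have Nh: "real (Suc N) * h N = T" for N by (simp add: h_def)
  have ind: "indep_vars (\<lambda>_. borel) (D N) {..<Suc N}" for N
  proof -
    have "indep_vars (\<lambda>_. borel) (\<lambda>i \<omega>. w ((\<lambda>i. real i * h N) (Suc i)) \<omega> - w ((\<lambda>i. real i * h N) i) \<omega>) {..<Suc N}"
      using BM h[of N] unfolding brownian_motion_def by (elim conjE allE[of _ "\<lambda>i. real i * h N"] allE[of _ "Suc N"]) simp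
    then show ?thesis by (simp add: D_def[abs_def])
  qed
  have dD: "distr M borel (D N k) = gaussian (h N)" for N k
  proof -
    have "\<forall>s t. 0 \<le> s \<and> s < t \<longrightarrow> distributed M lborel (\<lambda>\<omega>. w t \<omega> - w s \<omega>) (\<lambda>x. ennreal (gauss (t - s) x))"
      using BM unfolding brownian_motion_def gauss_def by blast
    from this[rule_format, of "real k * h N" "real (Suc k) * h N"] h[of N]
    have "distributed M lborel (D N k) (\<lambda>x. ennreal (gauss (h N) x))"
      by (simp add: D_def[abs_def] algebra_simps)
    then show ?thesis by (simp add: distributed_def gaussian_def cong: distr_cong)
  qed
  have gc: "continuous_on UNIV g"
    by (intro continuous_at_imp_continuous_on ballI has_derivative_continuous[OF g])
  have bc: "continuous_on UNIV b"
  proof -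
    have "Lb-lipschitz_on UNIV b" using lip Lb by (auto intro!: lipschitz_onI simp: dist_norm)
    then show ?thesis by (rule lipschitz_on_continuous_on)
  qed
  have Lc: "continuous_on UNIV ?L" using Lu by (rule uniformly_continuous_imp_continuous)
  have [measurable]: "?L \<in> borel_measurable borel" using Lc by (rule borel_measurable_continuous_onI)
  have DM: "D N k \<in> borel_measurable M" if "k < Suc N" for N k
    using ind that unfolding indep_vars_def by auto
  have sM: "s N \<in> borel_measurable M" for N
  proof -
    have "(\<lambda>\<omega>. euler b \<epsilon> (h N) x0 (\<lambda>i. D N i \<omega>) k) \<in> borel_measurable M" if "k < Suc N" for k
    proof -
      have "(\<lambda>\<omega>. restrict (\<lambda>i. D N i \<omega>) {..<k}) \<in> measurable M (Pi\<^sub>M {..<k} (\<lambda>_. borel))"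
        using that DM by (intro measurable_restrict) auto
      then have "(\<lambda>\<omega>. euler b \<epsilon> (h N) x0 (restrict (\<lambda>i. D N i \<omega>) {..<k}) k) \<in> borel_measurable M"
        using euler_measurable[OF bc order_refl] by (rule measurable_compose)
      moreover have "euler b \<epsilon> (h N) x0 (restrict (\<lambda>i. D N i \<omega>) {..<k}) k = euler b \<epsilon> (h N) x0 (\<lambda>i. D N i \<omega>) k" for \<omega>
        by (rule euler_cong) simp
      ultimately show ?thesis by simp
    qed
    then show ?thesis unfolding s_def[abs_def] by (intro borel_measurable_times borel_measurable_sum) auto
  qed
  have sb: "\<bar>s N \<omega>\<bar> \<le> T * LB" for N \<omega>
  proof -
    have "\<bar>\<Sum>k<Suc N. ?L (euler b \<epsilon> (h N) x0 (\<lambda>i. D N i \<omega>) k)\<bar> \<le> (\<Sum>k<Suc N. LB)"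
      by (rule order_trans[OF sum_abs sum_mono]) (rule LB)
    then have "h N * \<bar>\<Sum>k<Suc N. ?L (euler b \<epsilon> (h N) x0 (\<lambda>i. D N i \<omega>) k)\<bar> \<le> h N * (real (Suc N) * LB)"
      using h[of N] by (intro mult_left_mono) auto
    also have "\<dots> = T * LB" by (simp add: Nh[of N, symmetric])
    finally show ?thesis using h[of N] by (simp add: s_def abs_mult)
  qed
  have lim: "(\<lambda>N. s N \<omega>) \<longlonglongrightarrow> integral {0..T} (\<lambda>t. ?L (X t \<omega>))" if \<omega>: "\<omega> \<in> space M" for \<omega>
  proof -
    have w0: "w 0 \<omega> = 0" using BM \<omega> by (simp add: brownian_motion_def)
    show ?thesis
      unfolding s_def D_def h_def
      by (rule euler_riemann_sum_tendsto[where w="\<lambda>t. w t \<omega>" and x="\<lambda>t. X t \<omega>", OF X[OF \<omega>] sde[OF \<omega>] w0 lip Lb T Lu])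
  qed
  have lim': "(\<lambda>N. expectation (s N)) \<longlonglongrightarrow> expectation (\<lambda>\<omega>. integral {0..T} (\<lambda>t. ?L (X t \<omega>)))"
  proof (rule integral_dominated_convergence[where w="\<lambda>_. T * LB"])
    \<comment> \<open>Measurability in \<omega> is inherited from the Euler sums through the
      pointwise limit; measurability of \<open>X\<close> is not among the hypotheses.\<close>
    show "(\<lambda>\<omega>. integral {0..T} (\<lambda>t. ?L (X t \<omega>))) \<in> borel_measurable M"
      by (rule borel_measurable_LIMSEQ_real[OF lim sM])
  qed (use sM sb lim in auto)
  show ?thesis
  proof (rule field_le_epsilon)
    fix e :: real assume e: "e > 0"
    \<comment> \<open>The one-step error is chosen as (e / T) h, so that the steps of total length
      \<open>T\<close> contribute exactly \<open>e\<close>.\<close>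
    have eT: "e / T > 0" using e T by simp
    obtain h0 where h0: "h0 > 0"
      "\<And>h y. 0 < h \<Longrightarrow> h < h0 \<Longrightarrow> \<bar>integral\<^sup>L (gaussian h) (\<lambda>v. g (y + h *\<^sub>R b y + \<epsilon> *\<^sub>R v)) - g y - h * ?L y\<bar> \<le> e / T * h"
      by (rule one_step_expansion[OF g Dg A K G, where b=b, OF B eT, where \<epsilon>=\<epsilon>]) blast
    obtain N0 where N0: "T / h0 < real N0" using reals_Archimedean2 by blast
    have "\<bar>expectation (s N)\<bar> \<le> 2 * G + e" if "N0 \<le> N" for N
    proof -
      have "T / h0 < real (Suc N)" using N0 that by linarith
      then have hh: "h N < h0" using h0(1) by (simp add: h_def field_simps)
      have "\<bar>expectation (\<lambda>\<omega>. h N * (\<Sum>k<Suc N. ?L (euler b \<epsilon> (h N) x0 (\<lambda>i. D N i \<omega>) k)))\<bar> \<le> 2 * G + real (Suc N) * (e / T * h N)"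
        by (rule euler_generator_sum[OF bc gc Lc G LB h0(2)[OF h hh] ind dD])
      also have "real (Suc N) * (e / T * h N) = e" using T by (simp add: h_def del: of_nat_Suc)
      finally show ?thesis by (simp add: s_def[abs_def])
    qed
    then have "\<forall>\<^sub>F N in sequentially. \<bar>expectation (s N)\<bar> \<le> 2 * G + e"
      by (auto simp: eventually_sequentially)
    then show "\<bar>\<integral>\<omega>. integral {0..T} (\<lambda>t. ?L (X t \<omega>)) \<partial>M\<bar> \<le> 2 * G + e"
      by (rule tendsto_upperbound[OF tendsto_rabs[OF lim']]) simp
  qed
qed

section \<open>Continuously differentiable and periodic functions\<close>

lemma Ck_has_derivative:
  assumes "Ck (Suc k) f"
  shows "(f has_derivative (\<lambda>v. dderiv f v x)) (at x)"
  using assms frechet_derivative_works by (fastforce simp: dderiv_def)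

lemma dderiv_eq:
  assumes "(f has_derivative f') (at x)"
  shows "dderiv f v x = f' v"
  using frechet_derivative_at[OF assms] by (simp add: dderiv_def)

lemma Ck_dderiv: "Ck (Suc k) f \<Longrightarrow> Ck k (\<lambda>z. dderiv f v z)"
  by simp

lemma Ck_Suc_imp: "Ck (Suc k) f \<Longrightarrow> Ck k f"
proof (induction k arbitrary: f)
  case 0
  then have "\<And>x. f differentiable (at x)" by simp
  then have "continuous_on UNIV f"
    by (intro differentiable_imp_continuous_on differentiable_at_imp_differentiable_on) auto
  then show ?case by simp
next
  case (Suc k)
  then show ?case by (metis Ck.simps(2))
qed

lemma Ck_mono: "Ck m f \<Longrightarrow> k \<le> m \<Longrightarrow> Ck k f"
proof (induction m)
  case (Suc m)
  then show ?case using Ck_Suc_imp by (metis le_Suc_eq)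
qed simp

lemma Ck_continuous: "Ck k f \<Longrightarrow> continuous_on UNIV f"
  using Ck_mono[of k f 0] by simp

lemma Ck_SucI:
  assumes "\<And>x. (f has_derivative (\<lambda>v. f' v x)) (at x)" "\<And>v. Ck k (f' v)"
  shows "Ck (Suc k) f"
proof -
  have "dderiv f v = f' v" for v using dderiv_eq[OF assms(1)] by auto
  then show ?thesis using assms by (auto simp: differentiable_def)
qed

lemma Ck_const: "Ck k (\<lambda>_. c)"
proof (induction k arbitrary: c)
  case (Suc k)
  show ?case by (rule Ck_SucI[where f'="\<lambda>_ _. 0"]) (use Suc in auto)
qed simp

lemma Ck_linear: "bounded_linear f \<Longrightarrow> Ck k f"
proof (cases k)
  case 0
  then show "bounded_linear f \<Longrightarrow> Ck k f" by (simp add: linear_continuous_on)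
next
  case (Suc m)
  then show "bounded_linear f \<Longrightarrow> Ck k f"
    using Ck_SucI[where f'="\<lambda>v _. f v" and f=f and k=m] by (auto intro: bounded_linear_imp_has_derivative Ck_const)
qed

lemma Ck_add: "Ck k f \<Longrightarrow> Ck k g \<Longrightarrow> Ck k (\<lambda>x. f x + g x)"
proof (induction k arbitrary: f g)
  case 0 then show ?case by (simp add: continuous_on_add)
next
  case (Suc k)
  show ?case
  proof (rule Ck_SucI[where f'="\<lambda>v x. dderiv f v x + dderiv g v x"])
    show "((\<lambda>x. f x + g x) has_derivative (\<lambda>v. dderiv f v x + dderiv g v x)) (at x)" for x
      using Suc.prems by (intro has_derivative_add Ck_has_derivative)
    show "Ck k (\<lambda>x. dderiv f v x + dderiv g v x)" for v
      using Suc.prems by (intro Suc.IH Ck_dderiv)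
  qed
qed

lemma Ck_mult: "Ck k f \<Longrightarrow> Ck k g \<Longrightarrow> Ck k (\<lambda>x. f x * g x)"
proof (induction k arbitrary: f g)
  case 0 then show ?case by (simp add: continuous_on_mult)
next
  case (Suc k)
  show ?case
  proof (rule Ck_SucI[where f'="\<lambda>v x. f x * dderiv g v x + dderiv f v x * g x"])
    show "((\<lambda>x. f x * g x) has_derivative (\<lambda>v. f x * dderiv g v x + dderiv f v x * g x)) (at x)" for x
      using Suc.prems by (intro has_derivative_mult Ck_has_derivative)
    show "Ck k (\<lambda>x. f x * dderiv g v x + dderiv f v x * g x)" for v
      using Suc.prems[THEN Ck_Suc_imp] Suc.prems[THEN Ck_dderiv] by (intro Ck_add Suc.IH)
  qed
qed

lemma Ck_sum: "(\<And>i. i \<in> I \<Longrightarrow> Ck k (f i)) \<Longrightarrow> Ck k (\<lambda>x. \<Sum>i\<in>I. f i x)"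
  by (induction I rule: infinite_finite_induct) (auto intro: Ck_const Ck_add)

section \<open>Symmetry of second derivatives\<close>

lemma dderiv_linear:
  assumes "Ck (Suc k) f"
  shows "linear (\<lambda>v. dderiv f v x)"
  using has_derivative_linear[OF Ck_has_derivative[OF assms]] .

text \<open>The mean value theorem twice, first along \<open>v\<close>, then along \<open>w\<close>.
  The left side is symmetric in \<open>v\<close> and \<open>w\<close>, whereas the derivative on the
  right is taken in a definite order.\<close>

lemma dderiv_second_difference:
  assumes f: "Ck 2 f" and t: "t > 0"
  obtains s r where "0 < s" "s < t" "0 < r" "r < t"
    "f (x + t *\<^sub>R v + t *\<^sub>R w) - f (x + t *\<^sub>R v) - f (x + t *\<^sub>R w) + f x
      = t * (t * dderiv (\<lambda>z. dderiv f v z) w (x + s *\<^sub>R v + r *\<^sub>R w))"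
proof -
  have f1: "Ck (Suc (Suc 0)) f" using f by (simp add: numeral_2_eq_2)
  have d: "((\<lambda>s. h (c + s *\<^sub>R v)) has_real_derivative dderiv h v (c + s *\<^sub>R v)) (at s)"
    if "Ck (Suc k) h" for h c s v k
  proof -
    have "((\<lambda>s. c + s *\<^sub>R v) has_derivative (\<lambda>s. s *\<^sub>R v)) (at s)" by (auto intro!: derivative_eq_intros)
    from has_derivative_compose[OF this Ck_has_derivative[OF that]]
    have "((\<lambda>s. h (c + s *\<^sub>R v)) has_derivative (\<lambda>r. dderiv h (r *\<^sub>R v) (c + s *\<^sub>R v))) (at s)" .
    moreover have "dderiv h (r *\<^sub>R v) z = dderiv h v z * r" for r z
      using linear_cmul[OF dderiv_linear[OF that], of r v z] by simp
    ultimately show ?thesis by (simp add: has_field_derivative_def)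
  qed
  have "((\<lambda>s. f (x + t *\<^sub>R w + s *\<^sub>R v) - f (x + s *\<^sub>R v)) has_real_derivative
      dderiv f v (x + t *\<^sub>R w + s *\<^sub>R v) - dderiv f v (x + s *\<^sub>R v)) (at s)" for s
    by (intro DERIV_diff d[OF f1])
  from MVT2[OF t this] obtain s where s: "0 < s" "s < t"
    "f (x + t *\<^sub>R w + t *\<^sub>R v) - f (x + t *\<^sub>R v) - (f (x + t *\<^sub>R w) - f x) = t * (dderiv f v (x + t *\<^sub>R w + s *\<^sub>R v) - dderiv f v (x + s *\<^sub>R v))"
    by auto
  have f2: "Ck (Suc 0) (\<lambda>z. dderiv f v z)" using f1 by (rule Ck_dderiv)
  from MVT2[OF t d[OF f2, of "x + s *\<^sub>R v" w]] obtain r where r: "0 < r" "r < t"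
    "dderiv f v (x + s *\<^sub>R v + t *\<^sub>R w) - dderiv f v (x + s *\<^sub>R v) = t * dderiv (\<lambda>z. dderiv f v z) w (x + s *\<^sub>R v + r *\<^sub>R w)"
    by auto
  have c: "x + s *\<^sub>R v + t *\<^sub>R w = x + t *\<^sub>R w + s *\<^sub>R v" "x + t *\<^sub>R v + t *\<^sub>R w = x + t *\<^sub>R w + t *\<^sub>R v" by simp_all
  show ?thesis
    by (rule that[OF s(1,2) r(1,2)]) (use s(3) r(3) in \<open>simp add: c\<close>)
qed

text \<open>The symmetric second difference forces the two mixed derivatives to agree at two points
  near \<open>x\<close>; were they different at \<open>x\<close>, continuity would keep them apart
  there.\<close>

lemma dderiv_commute:
  assumes f: "Ck 2 f"
  shows "dderiv (\<lambda>z. dderiv f v z) w x = dderiv (\<lambda>z. dderiv f w z) v x"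
proof (rule ccontr)
  let ?F = "\<lambda>v w z. dderiv (\<lambda>z. dderiv f v z) w z"
  have c: "continuous_on UNIV (?F v w)" for v w
    using f by (simp add: numeral_2_eq_2)
  assume "\<not> ?thesis"
  then have e: "\<bar>?F v w x - ?F w v x\<bar> / 2 > 0" (is "?e > 0") by simp
  have near: "\<exists>d>0. \<forall>z. dist z x < d \<longrightarrow> dist (?F v w z) (?F v w x) < ?e" for v w
    using c[of v w] e unfolding continuous_on_iff by (metis UNIV_I)
  obtain d1 where d1: "d1 > 0" "\<And>z. dist z x < d1 \<Longrightarrow> dist (?F v w z) (?F v w x) < ?e" using near by blast
  obtain d2 where d2: "d2 > 0" "\<And>z. dist z x < d2 \<Longrightarrow> dist (?F w v z) (?F w v x) < ?e" using near by blast
  \<comment> \<open>With this step both intermediate points lie within min d1 d2 of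
    \<open>x\<close>; the summand 1 covers vanishing directions.\<close>
  define t where "t = min d1 d2 / (norm v + norm w + 1)"
  have nn: "norm v + norm w + 1 > 0" by (simp add: add_nonneg_pos)
  have t: "t > 0" using d1(1) d2(1) nn by (simp add: t_def)
  have close: "dist (x + s *\<^sub>R a + r *\<^sub>R b) x < min d1 d2" if "0 < s" "s < t" "0 < r" "r < t" "norm a + norm b = norm v + norm w" for s r a b
  proof -
    have "dist (x + s *\<^sub>R a + r *\<^sub>R b) x \<le> s * norm a + r * norm b"
      using norm_triangle_ineq[of "s *\<^sub>R a" "r *\<^sub>R b"] that by (simp add: dist_norm algebra_simps)
    also have "\<dots> \<le> t * norm a + t * norm b" using that by (intro add_mono mult_right_mono) auto
    also have "\<dots> = t * (norm v + norm w)" using that(5) by (simp add: distrib_left[symmetric])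
    also have "\<dots> < t * (norm v + norm w + 1)" using t by (simp add: algebra_simps)
    also have "\<dots> = min d1 d2" using nn by (simp add: t_def)
    finally show ?thesis .
  qed
  obtain s r where sr: "0 < s" "s < t" "0 < r" "r < t"
    "f (x + t *\<^sub>R v + t *\<^sub>R w) - f (x + t *\<^sub>R v) - f (x + t *\<^sub>R w) + f x = t * (t * ?F v w (x + s *\<^sub>R v + r *\<^sub>R w))"
    by (rule dderiv_second_difference[OF f t])
  obtain s' r' where sr': "0 < s'" "s' < t" "0 < r'" "r' < t"
    "f (x + t *\<^sub>R w + t *\<^sub>R v) - f (x + t *\<^sub>R w) - f (x + t *\<^sub>R v) + f x = t * (t * ?F w v (x + s' *\<^sub>R w + r' *\<^sub>R v))"
    by (rule dderiv_second_difference[OF f t])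
  have "x + t *\<^sub>R v + t *\<^sub>R w = x + t *\<^sub>R w + t *\<^sub>R v" by simp
  then have "t * (t * ?F v w (x + s *\<^sub>R v + r *\<^sub>R w)) = t * (t * ?F w v (x + s' *\<^sub>R w + r' *\<^sub>R v))"
    using sr(5) sr'(5) by (simp only:)
  then have eq: "?F v w (x + s *\<^sub>R v + r *\<^sub>R w) = ?F w v (x + s' *\<^sub>R w + r' *\<^sub>R v)" using t by simp
  have A: "dist (?F v w (x + s *\<^sub>R v + r *\<^sub>R w)) (?F v w x) < ?e" using close[OF sr(1-4)] by (intro d1(2)) auto
  have B: "dist (?F w v (x + s' *\<^sub>R w + r' *\<^sub>R v)) (?F w v x) < ?e" using close[OF sr'(1-4)] by (intro d2(2)) auto
  have "dist (?F v w x) (?F w v x) < ?e + ?e"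
    using A B dist_triangle[of "?F v w x" "?F w v x" "?F w v (x + s' *\<^sub>R w + r' *\<^sub>R v)"]
    unfolding eq by (simp add: dist_commute)
  then show False by (simp add: dist_real_def)
qed

section \<open>Periodic functions\<close>

lemma periodic_dderiv:
  fixes f :: "real^'n \<Rightarrow> real"
  assumes p: "periodic f" and f: "\<And>x. f differentiable (at x)"
  shows "periodic (\<lambda>x. dderiv f v x)"
  unfolding periodic_def
proof (intro allI impI)
  fix x k :: "real^'n" assume k: "int_vec k"
  have "(f has_derivative frechet_derivative f (at (x + k))) (at (x + k))"
    using f frechet_derivative_works by blast
  moreover have "((\<lambda>y. y + k) has_derivative (\<lambda>y. y)) (at x)" by (auto intro!: derivative_eq_intros)
  ultimately have "((\<lambda>y. f (y + k)) has_derivative frechet_derivative f (at (x + k))) (at x)"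
    using has_derivative_compose[of "\<lambda>y. y + k" "\<lambda>y. y" x UNIV f] by blast
  moreover have "(\<lambda>y. f (y + k)) = f" using p k by (auto simp: periodic_def)
  ultimately have "(f has_derivative frechet_derivative f (at (x + k))) (at x)" by simp
  from dderiv_eq[OF this] show "dderiv f v (x + k) = dderiv f v x" by (simp add: dderiv_def)
qed

definition intpart :: "real^'n \<Rightarrow> real^'n" where "intpart x = (\<chi> i. of_int \<lfloor>x $ i\<rfloor>)"

lemma int_vec_intpart: "int_vec (- intpart x)" by (simp add: int_vec_def intpart_def)

lemma periodic_intpart: "periodic f \<Longrightarrow> f (x - intpart x) = f x"
  using int_vec_intpart[of x] unfolding periodic_def by (metis add_uminus_conv_diff)

lemma fracpart_mem: "x - intpart x \<in> fund_dom" "x - intpart x \<in> cbox 0 1"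
proof -
  have "0 \<le> (x - intpart x) $ i \<and> (x - intpart x) $ i < 1" for i
    using floor_correct[of "x $ i"] by (simp add: intpart_def) linarith
  then show "x - intpart x \<in> fund_dom" "x - intpart x \<in> cbox 0 1"
    unfolding fund_dom_def mem_box_cart by (auto intro: less_imp_le simp del: vector_minus_component)
qed

lemma periodic_bounded:
  fixes f :: "real^'n \<Rightarrow> 'b::real_normed_vector"
  assumes p: "periodic f" and c: "continuous_on UNIV f"
  obtains B where "B \<ge> 0" "\<And>x. norm (f x) \<le> B"
proof -
  have "bounded (f ` cbox 0 1)"
    by (intro compact_imp_bounded compact_continuous_image continuous_on_subset[OF c]) auto
  then obtain B where B: "\<And>x. x \<in> cbox 0 1 \<Longrightarrow> norm (f x) \<le> B" by (auto simp: bounded_iff)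
  have "norm (f x) \<le> B" for x using B[OF fracpart_mem(2)[of x]] periodic_intpart[OF p, of x] by simp
  moreover from this[of 0] have "B \<ge> 0" using norm_ge_zero by (rule order_trans[rotated])
  ultimately show ?thesis by (rule that[rotated])
qed

lemma periodic_uniformly_continuous:
  fixes f :: "real^'n \<Rightarrow> 'b::metric_space"
  assumes p: "periodic f" and c: "continuous_on UNIV f"
  shows "uniformly_continuous_on UNIV f"
  unfolding uniformly_continuous_on_def
proof (intro allI impI)
  fix e :: real assume e: "e > 0"
  \<comment> \<open>Both points are shifted by the integer part of the first, which preserves their
    distance. As the distance is below 1, the second point leaves the unit cube by at most 1 in each
    coordinate.\<close>
  define K where "K = cbox (vec (-1)) (vec 2 :: real^'n)"
  have "uniformly_continuous_on K f"
    unfolding K_def by (intro compact_uniformly_continuous continuous_on_subset[OF c]) auto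
  then obtain d where d: "d > 0" "\<And>x y. x \<in> K \<Longrightarrow> y \<in> K \<Longrightarrow> dist y x < d \<Longrightarrow> dist (f y) (f x) < e"
    using e unfolding uniformly_continuous_on_def by metis
  show "\<exists>d>0. \<forall>x\<in>UNIV. \<forall>x'\<in>UNIV. dist x' x < d \<longrightarrow> dist (f x') (f x) < e"
  proof (intro exI[of _ "min d 1"] conjI ballI impI)
    fix x y :: "real^'n" assume xy: "dist y x < min d 1"
    have 0: "0 \<le> (x - intpart x) $ i \<and> (x - intpart x) $ i \<le> 1" for i
      using fracpart_mem(2)[of x] unfolding mem_box_cart by simp
    have "\<bar>(y - x) $ i\<bar> \<le> 1" for i
      using component_le_norm_cart[of "y - x" i] xy by (simp add: dist_norm)
    then have 1: "-1 \<le> (y - intpart x) $ i \<and> (y - intpart x) $ i \<le> 2" for i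
      using 0[of i] by (simp add: abs_le_iff) (smt (verit))
    have "-1 \<le> (x - intpart x) $ i \<and> (x - intpart x) $ i \<le> 2" for i using 0[of i] by linarith
    then have "x - intpart x \<in> K" "y - intpart x \<in> K" using 1 unfolding K_def mem_box_cart by auto
    then have "dist (f (y - intpart x)) (f (x - intpart x)) < e"
      using xy by (intro d(2)) (auto simp: dist_norm)
    moreover have "f (y - intpart x) = f y"
      using p int_vec_intpart[of x] unfolding periodic_def by (metis add_uminus_conv_diff)
    ultimately show "dist (f y) (f x) < e" using periodic_intpart[OF p, of x] by simp
  qed (use d in auto)
qed

text \<open>Row \<open>k\<close> is the differential of the \<open>k\<close>-th component of
  \<open>grad f\<close>, so this is the Jacobian of the gradient even before symmetry is
  known.\<close>

definition hess :: "(real^'n \<Rightarrow> real) \<Rightarrow> real^'n \<Rightarrow> real^'n^'n" where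
  "hess f x = (\<chi> k i. dderiv (\<lambda>y. dderiv f (axis k 1) y) (axis i 1) x)"

lemma has_derivative_vecI:
  fixes f :: "'a::euclidean_space \<Rightarrow> real^'n"
  assumes "\<And>i. ((\<lambda>x. f x $ i) has_derivative (\<lambda>v. f' v $ i)) (at x)"
  shows "(f has_derivative f') (at x)"
  using assms by (subst has_derivative_componentwise_within) (auto simp: Basis_vec_def inner_axis)

lemma linear_vec_expand:
  fixes f :: "real^'n \<Rightarrow> real"
  assumes "linear f"
  shows "f v = (\<Sum>i\<in>UNIV. f (axis i 1) * v $ i)"
proof -
  have "f v = f (\<Sum>i\<in>UNIV. v $ i *\<^sub>R axis i 1)" using basis_expansion[of v] by (simp add: scalar_mult_eq_scaleR)
  also have "\<dots> = (\<Sum>i\<in>UNIV. f (axis i 1) * v $ i)"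
    using assms by (simp add: linear_sum linear_cmul mult.commute)
  finally show ?thesis .
qed

lemma dderiv_grad:
  assumes "Ck (Suc k) f" shows "dderiv f v x = grad f x \<bullet> v"
  using linear_vec_expand[OF dderiv_linear[OF assms, of x], of v] by (simp add: grad_def inner_vec_def)

lemma grad_has_derivative:
  assumes "Ck (Suc k) f" shows "(f has_derivative (\<lambda>v. grad f x \<bullet> v)) (at x)"
  using Ck_has_derivative[OF assms] unfolding dderiv_grad[OF assms] .

lemma hess_has_derivative:
  assumes f: "Ck 2 f" shows "(grad f has_derivative (\<lambda>v. hess f x *v v)) (at x)"
proof (rule has_derivative_vecI)
  fix i
  have 1: "Ck (Suc 0) (\<lambda>y. dderiv f (axis i 1) y)" using f by (simp add: numeral_2_eq_2)
  have "((\<lambda>y. dderiv f (axis i 1) y) has_derivative (\<lambda>v. \<Sum>j\<in>UNIV. dderiv (\<lambda>y. dderiv f (axis i 1) y) (axis j 1) x * v $ j)) (at x)"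
    by (rule has_derivative_eq_rhs[OF Ck_has_derivative[OF 1]]) (rule ext, rule linear_vec_expand[OF dderiv_linear[OF 1]])
  then show "((\<lambda>x. grad f x $ i) has_derivative (\<lambda>v. (hess f x *v v) $ i)) (at x)"
    by (simp add: grad_def hess_def matrix_vector_mult_def)
qed

lemma continuous_on_vec:
  "(\<And>i. continuous_on S (\<lambda>x. f x $ i)) \<Longrightarrow> continuous_on S f" for f :: "'a::topological_space \<Rightarrow> ('b::topological_space)^'n"
  using continuous_on_vec_lambda[of S "\<lambda>i x. f x $ i"] by simp

lemma grad_continuous: "Ck (Suc k) f \<Longrightarrow> continuous_on UNIV (grad f)"
  by (rule continuous_on_vec) (auto simp: grad_def intro: Ck_continuous)

lemma hess_continuous: "Ck 2 f \<Longrightarrow> continuous_on UNIV (hess f)"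
  by (rule continuous_on_vec, rule continuous_on_vec) (auto simp: hess_def numeral_2_eq_2)

lemma grad_periodic: "periodic f \<Longrightarrow> Ck (Suc k) f \<Longrightarrow> periodic (grad f)"
  using periodic_dderiv[of f] by (simp add: periodic_def grad_def)

lemma hess_periodic: "periodic f \<Longrightarrow> Ck 2 f \<Longrightarrow> periodic (hess f)"
  using periodic_dderiv[OF periodic_dderiv[of f]] by (simp add: periodic_def hess_def numeral_2_eq_2)

lemma trace_hess: "trace (hess f x) = laplacian f x"
  by (simp add: trace_def hess_def laplacian_def)

lemma hess_symmetric: "Ck 2 f \<Longrightarrow> hess f x $ k $ i = hess f x $ i $ k"
  by (simp add: hess_def dderiv_commute)

section \<open>Transport along the graph of the momentum\<close>

abbreviation ex :: "'n \<Rightarrow> (real^'n) \<times> (real^'n)" where "ex i \<equiv> (axis i 1, 0)"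
abbreviation ep :: "'n \<Rightarrow> (real^'n) \<times> (real^'n)" where "ep i \<equiv> (0, axis i 1)"

text \<open>The chain rule along x -> (x, P + Du(x)). The derivative formula involves directional
  derivatives of \<Psi> along the same graph, multiplied by second derivatives of \<open>u\<close>;
  since \<open>u\<close> has derivatives of every order, induction on \<open>k\<close>
  closes.\<close>

lemma Ck_graph:
  fixes \<Psi> :: "(real^'n) \<times> (real^'n) \<Rightarrow> real"
  assumes u: "smooth u"
  shows "Ck (Suc k) \<Psi> \<Longrightarrow> ((\<lambda>x. \<Psi> (x, P + grad u x)) has_derivative
      (\<lambda>v. dderiv \<Psi> (v, 0) (x, P + grad u x) + (\<Sum>l\<in>UNIV. dderiv (\<lambda>y. dderiv u (axis l 1) y) v x * dderiv \<Psi> (ep l) (x, P + grad u x)))) (at x)"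
    "Ck k \<Psi> \<Longrightarrow> Ck k (\<lambda>x. \<Psi> (x, P + grad u x))"
proof -
  let ?p = "\<lambda>x. P + grad u x"
  have u2: "Ck 2 u" and uk: "\<And>k. Ck k u" using u by (auto simp: smooth_def)
  have D: "((\<lambda>x. \<Psi> (x, ?p x)) has_derivative
      (\<lambda>v. dderiv \<Psi> (v, 0) (x, ?p x) + (\<Sum>l\<in>UNIV. dderiv (\<lambda>y. dderiv u (axis l 1) y) v x * dderiv \<Psi> (ep l) (x, ?p x)))) (at x)"
    if \<Psi>: "Ck (Suc k) \<Psi>" for k \<Psi> x
  proof -
    have 1: "((\<lambda>x. (x, ?p x)) has_derivative (\<lambda>v. (v, 0 + hess u x *v v))) (at x)"
      by (intro has_derivative_Pair has_derivative_ident has_derivative_add has_derivative_const hess_has_derivative u2)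
    have "((\<lambda>x. \<Psi> (x, ?p x)) has_derivative (\<lambda>v. dderiv \<Psi> (v, 0 + hess u x *v v) (x, ?p x))) (at x)"
      by (rule has_derivative_compose[OF 1 Ck_has_derivative[OF \<Psi>]])
    moreover have "dderiv \<Psi> (v, 0 + hess u x *v v) (x, ?p x) =
       dderiv \<Psi> (v, 0) (x, ?p x) + (\<Sum>l\<in>UNIV. dderiv (\<lambda>y. dderiv u (axis l 1) y) v x * dderiv \<Psi> (ep l) (x, ?p x))" for v
    proof -
      note lin = dderiv_linear[OF \<Psi>, of "(x, ?p x)"]
      have l2: "linear (\<lambda>q. dderiv \<Psi> (0, q) (x, ?p x))"
      proof (rule linearI)
        show "dderiv \<Psi> (0, a + b) (x, ?p x) = dderiv \<Psi> (0, a) (x, ?p x) + dderiv \<Psi> (0, b) (x, ?p x)" for a b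
          using linear_add[OF lin, of "(0,a)" "(0,b)"] by simp
        show "dderiv \<Psi> (0, r *\<^sub>R a) (x, ?p x) = r *\<^sub>R dderiv \<Psi> (0, a) (x, ?p x)" for r a
          using linear_cmul[OF lin, of r "(0,a)"] by simp
      qed
      have h: "(hess u x *v v) $ l = dderiv (\<lambda>y. dderiv u (axis l 1) y) v x" for l
      proof -
        have "Ck (Suc 0) (\<lambda>y. dderiv u (axis l 1) y)" using u2 by (simp add: numeral_2_eq_2)
        from linear_vec_expand[OF dderiv_linear[OF this, of x], of v] show ?thesis
          by (simp add: hess_def matrix_vector_mult_def)
      qed
      have "dderiv \<Psi> (v, 0 + hess u x *v v) (x, ?p x) = dderiv \<Psi> (v, 0) (x, ?p x) + dderiv \<Psi> (0, hess u x *v v) (x, ?p x)"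
        using linear_add[OF lin, of "(v,0)" "(0, hess u x *v v)"] by simp
      also have "dderiv \<Psi> (0, hess u x *v v) (x, ?p x) = (\<Sum>l\<in>UNIV. dderiv \<Psi> (ep l) (x, ?p x) * (hess u x *v v) $ l)"
        by (rule linear_vec_expand[OF l2])
      finally show ?thesis by (simp add: h mult.commute)
    qed
    ultimately show ?thesis by simp
  qed
  then show "Ck (Suc k) \<Psi> \<Longrightarrow> ((\<lambda>x. \<Psi> (x, P + grad u x)) has_derivative
      (\<lambda>v. dderiv \<Psi> (v, 0) (x, P + grad u x) + (\<Sum>l\<in>UNIV. dderiv (\<lambda>y. dderiv u (axis l 1) y) v x * dderiv \<Psi> (ep l) (x, P + grad u x)))) (at x)" .
  show "Ck k \<Psi> \<Longrightarrow> Ck k (\<lambda>x. \<Psi> (x, P + grad u x))"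
  proof (induction k arbitrary: \<Psi>)
    case 0
    have "continuous_on UNIV (\<lambda>x. (x, P + grad u x))"
      using grad_continuous[OF uk[of "Suc 0"]] by (intro continuous_intros)
    then have "continuous_on UNIV (\<lambda>x. \<Psi> (x, P + grad u x))"
      using continuous_on_compose2[OF Ck_continuous[OF 0]] by blast
    then show ?case by (simp only: Ck.simps)
  next
    case (Suc k)
    show ?case
    proof (rule Ck_SucI[OF D[OF Suc.prems]])
      fix v
      have "Ck (Suc (Suc k)) u" by (rule uk)
      then have "Ck k (\<lambda>x. dderiv (\<lambda>y. dderiv u (axis l 1) y) v x)" for l by simp
      moreover have "Ck k (\<lambda>x. dderiv \<Psi> w (x, ?p x))" for w by (rule Suc.IH[OF Ck_dderiv[OF Suc.prems]])
      ultimately show "Ck k (\<lambda>x. dderiv \<Psi> (v, 0) (x, ?p x) + (\<Sum>l\<in>UNIV. dderiv (\<lambda>y. dderiv u (axis l 1) y) v x * dderiv \<Psi> (ep l) (x, ?p x)))"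
        by (intro Ck_add Ck_sum Ck_mult)
    qed
  qed
qed

lemma dderiv_graph:
  assumes "smooth u" "Ck (Suc k) \<Psi>"
  shows "dderiv (\<lambda>x. \<Psi> (x, P + grad u x)) v x = dderiv \<Psi> (v, 0) (x, P + grad u x)
     + (\<Sum>l\<in>UNIV. dderiv (\<lambda>y. dderiv u (axis l 1) y) v x * dderiv \<Psi> (ep l) (x, P + grad u x))"
  by (rule dderiv_eq[OF Ck_graph(1)[OF assms]])

section \<open>Partial derivatives as directional derivatives in phase space\<close>

lemma gradp_eq:
  fixes F :: "real^'n \<Rightarrow> real^'n \<Rightarrow> real"
  assumes "Ck (Suc k) (\<lambda>z. F (fst z) (snd z))"
  shows "gradp F x p $ i = dderiv (\<lambda>z. F (fst z) (snd z)) (ep i) (x, p)"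
    "dderiv (\<lambda>q. F x q) v p = dderiv (\<lambda>z. F (fst z) (snd z)) (0, v) (x, p)"
    "gradx F x p $ i = dderiv (\<lambda>z. F (fst z) (snd z)) (ex i) (x, p)"
proof -
  have "((\<lambda>q. (x, q)) has_derivative (\<lambda>v. (0, v))) (at p)" by (auto intro!: derivative_eq_intros)
  from has_derivative_compose[OF this Ck_has_derivative[OF assms]]
  show v: "dderiv (\<lambda>q. F x q) v p = dderiv (\<lambda>z. F (fst z) (snd z)) (0, v) (x, p)" for v
    by (intro dderiv_eq) simp
  then show "gradp F x p $ i = dderiv (\<lambda>z. F (fst z) (snd z)) (ep i) (x, p)"
    by (simp add: gradp_def grad_def)
  have "((\<lambda>y. (y, p)) has_derivative (\<lambda>v. (v, 0))) (at x)" by (auto intro!: derivative_eq_intros)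
  from has_derivative_compose[OF this Ck_has_derivative[OF assms]]
  have "dderiv (\<lambda>y. F y p) v x = dderiv (\<lambda>z. F (fst z) (snd z)) (v, 0) (x, p)" for v
    by (intro dderiv_eq) simp
  then show "gradx F x p $ i = dderiv (\<lambda>z. F (fst z) (snd z)) (ex i) (x, p)"
    by (simp add: gradx_def grad_def)
qed

lemma dpp_eq:
  fixes F :: "real^'n \<Rightarrow> real^'n \<Rightarrow> real"
  assumes "Ck 2 (\<lambda>z. F (fst z) (snd z))"
  shows "dpp F k j x p = dderiv (\<lambda>z. dderiv (\<lambda>z. F (fst z) (snd z)) (ep j) z) (ep k) (x, p)"
proof -
  have c: "Ck (Suc (Suc 0)) (\<lambda>z. F (fst z) (snd z))" using assms by (simp add: numeral_2_eq_2)
  have "(\<lambda>q. dderiv (\<lambda>q'. F x q') (axis j 1) q) = (\<lambda>q. dderiv (\<lambda>z. F (fst z) (snd z)) (ep j) (x, q))"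
    using gradp_eq(2)[OF c] by auto
  moreover have "Ck (Suc 0) (\<lambda>z. dderiv (\<lambda>z. F (fst z) (snd z)) (ep j) (fst z, snd z))"
    using Ck_dderiv[OF c, of "ep j"] by (simp only: prod.collapse)
  from gradp_eq(2)[OF this] have "dderiv (\<lambda>q. dderiv (\<lambda>z. F (fst z) (snd z)) (ep j) (x, q)) (axis k 1) p
     = dderiv (\<lambda>z. dderiv (\<lambda>z. F (fst z) (snd z)) (ep j) z) (ep k) (x, p)"
    by (simp only: prod.collapse)
  ultimately show ?thesis unfolding dpp_def by simp
qed

text \<open>At p = P + Du(x) these are the terms of the Laplacian of x -> F(x, P + Du(x)) that are
  free of third derivatives of \<open>u\<close>: pure position, mixed, and pure momentum derivatives
  of \<open>F\<close>.\<close>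

definition diffusion_part :: "(real^'n \<Rightarrow> real) \<Rightarrow> (real^'n \<Rightarrow> real^'n \<Rightarrow> real) \<Rightarrow> real^'n \<Rightarrow> real^'n \<Rightarrow> real" where
  "diffusion_part u F x p = (let \<Phi> = (\<lambda>z. F (fst z) (snd z)) in
    (\<Sum>i\<in>UNIV. dderiv (\<lambda>z. dderiv \<Phi> (ex i) z) (ex i) (x, p))
  + (\<Sum>i\<in>UNIV. \<Sum>l\<in>UNIV. hess u x $ l $ i * (dderiv (\<lambda>z. dderiv \<Phi> (ex i) z) (ep l) (x, p) + dderiv (\<lambda>z. dderiv \<Phi> (ep l) z) (ex i) (x, p)))
  + (\<Sum>k\<in>UNIV. \<Sum>l\<in>UNIV. (\<Sum>i\<in>UNIV. hess u x $ k $ i * hess u x $ l $ i) * dpp F l k x p))"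

text \<open>The third derivatives of \<open>u\<close> produced by the chain rule are eliminated with the differentiated
  cell equation; what remains is the Poisson bracket.\<close>

lemma generator_graph:
  fixes H F :: "real^'n \<Rightarrow> real^'n \<Rightarrow> real"
  assumes H: "smooth (\<lambda>z. H (fst z) (snd z))" and u: "smooth u"
    and cell: "\<And>x. - (\<epsilon>\<^sup>2 / 2) * laplacian u x + H x (P + grad u x) = c"
    and F: "Ck 2 (\<lambda>z. F (fst z) (snd z))"
  defines "g \<equiv> \<lambda>x. F x (P + grad u x)"
  shows "generator (\<lambda>x. - gradp H x (P + grad u x)) \<epsilon> (grad g) (hess g) x
     = poisson F H x (P + grad u x) + \<epsilon>\<^sup>2 / 2 * diffusion_part u F x (P + grad u x)"
proof -
  define p where "p x = P + grad u x" for x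
  define \<Phi> where "\<Phi> = (\<lambda>z. F (fst z) (snd z))"
  define \<eta> where "\<eta> = (\<lambda>z. H (fst z) (snd z))"
  have uk: "\<And>k. Ck k u" and \<eta>k: "\<And>k. Ck k \<eta>" using u H by (auto simp: smooth_def \<eta>_def)
  have \<Phi>: "Ck (Suc (Suc 0)) \<Phi>" using F by (simp add: \<Phi>_def numeral_2_eq_2)
  have gg: "g = (\<lambda>x. \<Phi> (x, P + grad u x))" by (simp add: g_def \<Phi>_def)
  define U where "U k x = dderiv u (axis k 1) x" for k x
  define a where "a k i x = dderiv (\<lambda>y. U k y) (axis i 1) x" for k i x
  have a_hess: "hess u x $ k $ i = a k i x" for k i x by (simp add: hess_def a_def U_def)
  have a_sym: "a k i x = a i k x" for k i x using hess_symmetric[OF uk[of 2], of x k i] by (simp add: a_hess)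
  have Uk: "Ck k (\<lambda>y. U i y)" for k i using uk[of "Suc k"] by (simp add: U_def)
  have ak: "Ck k (\<lambda>y. a l i y)" for k l i using Uk[of "Suc k" l] by (simp add: a_def)
  have G: "grad g x $ i = dderiv \<Phi> (ex i) (x, p x) + (\<Sum>l\<in>UNIV. a l i x * dderiv \<Phi> (ep l) (x, p x))" for x i
  proof -
    have "grad g x $ i = dderiv g (axis i 1) x" by (simp add: grad_def)
    then show ?thesis unfolding gg p_def a_def U_def using dderiv_graph[OF u \<Phi>, of P "axis i 1" x] by metis
  qed
  have \<Phi>1: "Ck (Suc 0) (\<lambda>z. dderiv \<Phi> v z)" for v using \<Phi> by (rule Ck_dderiv)
  \<comment> \<open>The Laplacian of the \<open>k\<close>-th partial derivative of \<open>u\<close>: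
    the form in which third derivatives appear in the Laplacian of \<open>g\<close>.\<close>
  define q where "q k x = (\<Sum>i\<in>UNIV. dderiv (\<lambda>y. a k i y) (axis i 1) x)" for k x
  have lap: "laplacian g x = (\<Sum>i\<in>UNIV. dderiv (\<lambda>z. dderiv \<Phi> (ex i) z) (ex i) (x, p x)
       + (\<Sum>l\<in>UNIV. a l i x * dderiv (\<lambda>z. dderiv \<Phi> (ex i) z) (ep l) (x, p x))
       + (\<Sum>k\<in>UNIV. a k i x * (dderiv (\<lambda>z. dderiv \<Phi> (ep k) z) (ex i) (x, p x) + (\<Sum>l\<in>UNIV. a l i x * dderiv (\<lambda>z. dderiv \<Phi> (ep k) z) (ep l) (x, p x)))
            + dderiv (\<lambda>y. a k i y) (axis i 1) x * dderiv \<Phi> (ep k) (x, p x)))"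
  proof -
    have "dderiv (\<lambda>y. dderiv g (axis i 1) y) (axis i 1) x = dderiv (\<lambda>z. dderiv \<Phi> (ex i) z) (ex i) (x, p x)
       + (\<Sum>l\<in>UNIV. a l i x * dderiv (\<lambda>z. dderiv \<Phi> (ex i) z) (ep l) (x, p x))
       + (\<Sum>k\<in>UNIV. a k i x * (dderiv (\<lambda>z. dderiv \<Phi> (ep k) z) (ex i) (x, p x) + (\<Sum>l\<in>UNIV. a l i x * dderiv (\<lambda>z. dderiv \<Phi> (ep k) z) (ep l) (x, p x)))
            + dderiv (\<lambda>y. a k i y) (axis i 1) x * dderiv \<Phi> (ep k) (x, p x))" for i
    proof -
      have e: "(\<lambda>y. dderiv g (axis i 1) y) = (\<lambda>y. dderiv \<Phi> (ex i) (y, P + grad u y) + (\<Sum>k\<in>UNIV. a k i y * dderiv \<Phi> (ep k) (y, P + grad u y)))"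
        using G[of _ i] by (auto simp: grad_def p_def)
      have c: "((\<lambda>y. dderiv \<Phi> w (y, P + grad u y)) has_derivative
         (\<lambda>v. dderiv (\<lambda>z. dderiv \<Phi> w z) (v, 0) (x, P + grad u x) + (\<Sum>l\<in>UNIV. dderiv (\<lambda>y. dderiv u (axis l 1) y) v x * dderiv (\<lambda>z. dderiv \<Phi> w z) (ep l) (x, P + grad u x)))) (at x)" for w
        by (rule Ck_graph(1)[OF u \<Phi>1])
      have "((\<lambda>y. dderiv \<Phi> (ex i) (y, P + grad u y) + (\<Sum>k\<in>UNIV. a k i y * dderiv \<Phi> (ep k) (y, P + grad u y))) has_derivative
         (\<lambda>v. (dderiv (\<lambda>z. dderiv \<Phi> (ex i) z) (v, 0) (x, P + grad u x) + (\<Sum>l\<in>UNIV. dderiv (\<lambda>y. dderiv u (axis l 1) y) v x * dderiv (\<lambda>z. dderiv \<Phi> (ex i) z) (ep l) (x, P + grad u x)))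
          + (\<Sum>k\<in>UNIV. a k i x * (dderiv (\<lambda>z. dderiv \<Phi> (ep k) z) (v, 0) (x, P + grad u x) + (\<Sum>l\<in>UNIV. dderiv (\<lambda>y. dderiv u (axis l 1) y) v x * dderiv (\<lambda>z. dderiv \<Phi> (ep k) z) (ep l) (x, P + grad u x)))
            + dderiv (\<lambda>y. a k i y) v x * dderiv \<Phi> (ep k) (x, P + grad u x)))) (at x)"
        by (intro has_derivative_add has_derivative_sum has_derivative_mult c Ck_has_derivative[OF ak[of "Suc 0"]])
      from dderiv_eq[OF this, of "axis i 1"] show ?thesis unfolding e
        by (simp only: p_def a_def U_def)
    qed
    then show ?thesis by (simp add: laplacian_def)
  qed
  \<comment> \<open>Differentiation of the cell equation along \<open>axis k\<close> produces the
    \<open>k\<close>-th derivative of the Laplacian; commuting derivatives turns it into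
    \<open>q k\<close>.\<close>
  have celld: "\<epsilon>\<^sup>2 / 2 * q k x = dderiv \<eta> (ex k) (x, p x) + (\<Sum>l\<in>UNIV. a l k x * dderiv \<eta> (ep l) (x, p x))" for k x
  proof -
    have e1: "((\<lambda>x. - (\<epsilon>\<^sup>2 / 2) * (\<Sum>i\<in>UNIV. a i i x) + \<eta> (x, P + grad u x)) has_derivative
      (\<lambda>v. - (\<epsilon>\<^sup>2 / 2) * (\<Sum>i\<in>UNIV. dderiv (\<lambda>y. a i i y) v x) + (dderiv \<eta> (v, 0) (x, P + grad u x) + (\<Sum>l\<in>UNIV. dderiv (\<lambda>y. dderiv u (axis l 1) y) v x * dderiv \<eta> (ep l) (x, P + grad u x))))) (at x)"
      by (intro has_derivative_add has_derivative_mult_right has_derivative_sum Ck_has_derivative[OF ak[of "Suc 0"]] Ck_graph(1)[OF u \<eta>k[of "Suc 0"]])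
    have "(\<lambda>x. - (\<epsilon>\<^sup>2 / 2) * (\<Sum>i\<in>UNIV. a i i x) + \<eta> (x, P + grad u x)) = (\<lambda>_. c)"
      using cell by (simp add: laplacian_def a_def U_def \<eta>_def)
    with e1 have "((\<lambda>_. c) has_derivative (\<lambda>v. - (\<epsilon>\<^sup>2 / 2) * (\<Sum>i\<in>UNIV. dderiv (\<lambda>y. a i i y) v x) + (dderiv \<eta> (v, 0) (x, P + grad u x) + (\<Sum>l\<in>UNIV. dderiv (\<lambda>y. dderiv u (axis l 1) y) v x * dderiv \<eta> (ep l) (x, P + grad u x))))) (at x)" by simp
    from has_derivative_unique[OF this has_derivative_const]
    have z: "- (\<epsilon>\<^sup>2 / 2) * (\<Sum>i\<in>UNIV. dderiv (\<lambda>y. a i i y) (axis k 1) x) + (dderiv \<eta> (ex k) (x, p x) + (\<Sum>l\<in>UNIV. a l k x * dderiv \<eta> (ep l) (x, p x))) = 0"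
      by (auto simp: fun_eq_iff p_def a_def U_def)
    have "dderiv (\<lambda>y. a i i y) (axis k 1) x = dderiv (\<lambda>y. a k i y) (axis i 1) x" for i
    proof -
      have "dderiv (\<lambda>y. a i i y) (axis k 1) x = dderiv (\<lambda>y. a i k y) (axis i 1) x"
        unfolding a_def by (rule dderiv_commute[OF Uk])
      also have "(\<lambda>y. a i k y) = (\<lambda>y. a k i y)" using a_sym by auto
      finally show ?thesis .
    qed
    with z show ?thesis by (simp add: q_def)
  qed
  have gp: "gradp H x (p x) $ i = dderiv \<eta> (ep i) (x, p x)" "gradx H x (p x) $ i = dderiv \<eta> (ex i) (x, p x)" for i x
    unfolding \<eta>_def using gradp_eq[of 0 H] H by (auto simp: smooth_def simp del: Ck.simps)
  have fp: "gradp F x (p x) $ i = dderiv \<Phi> (ep i) (x, p x)" "gradx F x (p x) $ i = dderiv \<Phi> (ex i) (x, p x)" for i x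
    unfolding \<Phi>_def using gradp_eq[of "Suc 0" F] F by (auto simp: numeral_2_eq_2 simp del: Ck.simps)
  have dp: "dpp F l k x (p x) = dderiv (\<lambda>z. dderiv \<Phi> (ep k) z) (ep l) (x, p x)" for k l x
    unfolding \<Phi>_def by (rule dpp_eq[OF F])
  have "generator (\<lambda>x. - gradp H x (P + grad u x)) \<epsilon> (grad g) (hess g) x
    = - (\<Sum>i\<in>UNIV. dderiv \<eta> (ep i) (x, p x) * (dderiv \<Phi> (ex i) (x, p x) + (\<Sum>l\<in>UNIV. a l i x * dderiv \<Phi> (ep l) (x, p x)))) + \<epsilon>\<^sup>2 / 2 * laplacian g x"
    unfolding generator_def trace_hess p_def[symmetric] inner_vec_def
    by (simp add: gp G sum_negf)
  \<comment> \<open>Symmetry of the Hessian allows the drift term to be collected into the very sums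
    that \<open>celld\<close> evaluates.\<close>
  also have "(\<Sum>i\<in>UNIV. dderiv \<eta> (ep i) (x, p x) * (dderiv \<Phi> (ex i) (x, p x) + (\<Sum>l\<in>UNIV. a l i x * dderiv \<Phi> (ep l) (x, p x))))
     = (\<Sum>i\<in>UNIV. dderiv \<eta> (ep i) (x, p x) * dderiv \<Phi> (ex i) (x, p x)) + (\<Sum>l\<in>UNIV. dderiv \<Phi> (ep l) (x, p x) * (\<Sum>i\<in>UNIV. a i l x * dderiv \<eta> (ep i) (x, p x)))"
  proof -
    have "(\<Sum>i\<in>UNIV. dderiv \<eta> (ep i) (x, p x) * (\<Sum>l\<in>UNIV. a l i x * dderiv \<Phi> (ep l) (x, p x)))
       = (\<Sum>l\<in>UNIV. \<Sum>i\<in>UNIV. dderiv \<eta> (ep i) (x, p x) * (a l i x * dderiv \<Phi> (ep l) (x, p x)))"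
      unfolding sum_distrib_left by (rule sum.swap)
    also have "\<dots> = (\<Sum>l\<in>UNIV. dderiv \<Phi> (ep l) (x, p x) * (\<Sum>i\<in>UNIV. a i l x * dderiv \<eta> (ep i) (x, p x)))"
      unfolding sum_distrib_left by (intro sum.cong refl) (simp add: a_sym mult_ac)
    finally show ?thesis by (simp add: distrib_left sum.distrib)
  qed
  also have "laplacian g x = diffusion_part u F x (p x) + (\<Sum>k\<in>UNIV. q k x * dderiv \<Phi> (ep k) (x, p x))"
  proof -
    have s1: "(\<Sum>i\<in>UNIV. \<Sum>k\<in>UNIV. a k i x * (\<Sum>l\<in>UNIV. a l i x * dderiv (\<lambda>z. dderiv \<Phi> (ep k) z) (ep l) (x, p x)))
      = (\<Sum>k\<in>UNIV. \<Sum>l\<in>UNIV. (\<Sum>i\<in>UNIV. a k i x * a l i x) * dderiv (\<lambda>z. dderiv \<Phi> (ep k) z) (ep l) (x, p x))"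
    proof -
      have "(\<Sum>i\<in>UNIV. \<Sum>k\<in>UNIV. a k i x * (\<Sum>l\<in>UNIV. a l i x * dderiv (\<lambda>z. dderiv \<Phi> (ep k) z) (ep l) (x, p x)))
         = (\<Sum>k\<in>UNIV. \<Sum>i\<in>UNIV. \<Sum>l\<in>UNIV. a k i x * (a l i x * dderiv (\<lambda>z. dderiv \<Phi> (ep k) z) (ep l) (x, p x)))"
        unfolding sum_distrib_left by (rule sum.swap)
      also have "\<dots> = (\<Sum>k\<in>UNIV. \<Sum>l\<in>UNIV. \<Sum>i\<in>UNIV. a k i x * (a l i x * dderiv (\<lambda>z. dderiv \<Phi> (ep k) z) (ep l) (x, p x)))"
        by (rule sum.cong[OF refl], rule sum.swap)
      finally show ?thesis by (simp add: sum_distrib_right mult_ac)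
    qed
    have s2: "(\<Sum>i\<in>UNIV. \<Sum>k\<in>UNIV. dderiv (\<lambda>y. a k i y) (axis i 1) x * dderiv \<Phi> (ep k) (x, p x)) = (\<Sum>k\<in>UNIV. q k x * dderiv \<Phi> (ep k) (x, p x))"
      unfolding q_def sum_distrib_right by (rule sum.swap)
    show ?thesis
      unfolding lap diffusion_part_def Let_def \<Phi>_def[symmetric] a_hess dp
      by (simp add: sum.distrib distrib_left s1 s2)
  qed
  also have "\<epsilon>\<^sup>2 / 2 * (diffusion_part u F x (p x) + (\<Sum>k\<in>UNIV. q k x * dderiv \<Phi> (ep k) (x, p x)))
    = \<epsilon>\<^sup>2 / 2 * diffusion_part u F x (p x) + (\<Sum>k\<in>UNIV. dderiv \<Phi> (ep k) (x, p x) * (\<epsilon>\<^sup>2 / 2 * q k x))"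
    by (simp add: distrib_left sum_distrib_left mult_ac)
  finally show ?thesis
    unfolding celld poisson_def inner_vec_def p_def[symmetric] 
    by (simp add: gp fp sum.distrib distrib_left mult.commute)
qed

section \<open>Maximum principle and the gradient bound\<close>

lemma grad_hess_at_max:
  fixes g :: "real^'n \<Rightarrow> real"
  assumes g: "Ck 2 g" and max: "\<And>y. g y \<le> g x"
  shows "grad g x = 0" "laplacian g x \<le> 0"
proof -
  have g1: "Ck (Suc (Suc 0)) g" using g by (simp add: numeral_2_eq_2)
  have "(\<lambda>v. grad g x \<bullet> v) = (\<lambda>v. 0)"
    by (rule differential_zero_maxmin[of x UNIV g]) (use max grad_has_derivative[OF g1] in auto)
  then have "grad g x \<bullet> grad g x = 0" by metis
  then show G: "grad g x = 0" by simp
  \<comment> \<open>A positive diagonal entry stays positive near \<open>x\<close>; as the gradient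
    vanishes, Taylor's formula along axis \<open>i\<close> would then exceed the maximum.\<close>
  have "hess g x $ i $ i \<le> 0" for i
  proof (rule ccontr)
    assume "\<not> ?thesis"
    then have c: "hess g x $ i $ i > 0" by simp
    have "continuous_on UNIV (\<lambda>y. hess g y $ i $ i)"
      by (intro continuous_on_component hess_continuous g)
    then obtain d where d: "d > 0" "\<And>y. dist y x < d \<Longrightarrow> dist (hess g y $ i $ i) (hess g x $ i $ i) < hess g x $ i $ i"
      using c unfolding continuous_on_iff by (metis UNIV_I)
    define v where "v = (d / 2) *\<^sub>R axis i (1::real)"
    obtain t where t: "0 \<le> t" "t \<le> 1" "g (x + v) = g x + grad g x \<bullet> v + (v \<bullet> (hess g (x + t *\<^sub>R v) *v v)) / 2"
      using taylor2[OF grad_has_derivative[OF g1] hess_has_derivative[OF g]] by blast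
    have "norm (t *\<^sub>R v) \<le> norm v" using t(1,2) by (simp add: mult_left_le_one_le)
    also have "norm v < d" using d(1) by (simp add: v_def)
    finally have "dist (hess g (x + t *\<^sub>R v) $ i $ i) (hess g x $ i $ i) < hess g x $ i $ i"
      by (intro d(2)) (simp add: dist_norm)
    then have pos: "hess g (x + t *\<^sub>R v) $ i $ i > 0" by (simp add: dist_real_def abs_less_iff)
    have "v \<bullet> (hess g (x + t *\<^sub>R v) *v v) = (d/2)^2 * hess g (x + t *\<^sub>R v) $ i $ i"
      by (simp add: v_def matrix_vector_mult_scaleR matrix_vector_mult_basis column_def inner_axis' power2_eq_square)
    also have "\<dots> > 0" using pos d(1) by simp
    finally show False using t(3) max[of "x + v"] G by simp
  qed
  then show "laplacian g x \<le> 0" unfolding trace_hess[symmetric] trace_def by (intro sum_nonpos) simp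
qed

lemma periodic_attains_max:
  fixes g :: "real^'n \<Rightarrow> real"
  assumes "periodic g" "continuous_on UNIV g"
  obtains x where "\<And>y. g y \<le> g x"
proof -
  have "\<exists>x\<in>cbox 0 1. \<forall>y\<in>cbox (0::real^'n) 1. g y \<le> g x"
    by (rule continuous_attains_sup) (use assms fracpart_mem(2) in \<open>auto intro: continuous_on_subset\<close>)
  then obtain x where x: "\<And>y. y \<in> cbox 0 1 \<Longrightarrow> g y \<le> g x" by blast
  show ?thesis
    by (rule that[of x]) (metis x fracpart_mem(2) periodic_intpart[OF assms(1)])
qed

text \<open>Written as a function on phase space so that the graph identities apply to it. Its
  growth in \<open>p\<close> is harmless, since the graph lies in a bounded set.\<close>

definition kinetic :: "real^'n \<Rightarrow> real^'n \<Rightarrow> real" where "kinetic x p = (p \<bullet> p) / 2"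

lemma kinetic_derivatives:
  fixes z :: "(real^'n) \<times> (real^'n)"
  shows "dderiv (\<lambda>z. kinetic (fst z) (snd z)) v z = snd z \<bullet> snd v"
    "dderiv (\<lambda>z. dderiv (\<lambda>z. kinetic (fst z) (snd z)) v z) w z = snd w \<bullet> snd v"
    "Ck k (\<lambda>z::(real^'n) \<times> (real^'n). kinetic (fst z) (snd z))"
proof -
  have d: "((\<lambda>z. kinetic (fst z) (snd z)) has_derivative (\<lambda>v. snd z \<bullet> snd v)) (at z)" for z :: "(real^'n) \<times> (real^'n)"
    unfolding kinetic_def by (auto intro!: derivative_eq_intros simp: inner_commute)
  show v: "dderiv (\<lambda>z. kinetic (fst z) (snd z)) v z = snd z \<bullet> snd v" for v and z :: "(real^'n) \<times> (real^'n)"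
    by (rule dderiv_eq[OF d])
  show "dderiv (\<lambda>z. dderiv (\<lambda>z. kinetic (fst z) (snd z)) v z) w z = snd w \<bullet> snd v"
    unfolding v by (rule dderiv_eq) (auto intro!: derivative_eq_intros)
  show "Ck k (\<lambda>z::(real^'n) \<times> (real^'n). kinetic (fst z) (snd z))"
    unfolding kinetic_def inner_vec_def divide_inverse inner_real_def
    by (intro Ck_mult Ck_sum Ck_const Ck_linear bounded_linear_intros bounded_linear_vec_nth[THEN bounded_linear_compose])
qed

text \<open>This test function ties the two sides of the argument together: the bracket is the term
  D_xH . p of the coercivity hypothesis, the diffusion part is |D^2 u|^2.\<close>

lemma kinetic_parts:
  fixes H :: "real^'n \<Rightarrow> real^'n \<Rightarrow> real"
  shows "poisson kinetic H x p = gradx H x p \<bullet> p"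
    "diffusion_part u kinetic x p = (\<Sum>k\<in>UNIV. \<Sum>i\<in>UNIV. (hess u x $ k $ i)^2)"
proof -
  have "gradp kinetic x p = p"
    by (simp add: vec_eq_iff gradp_eq(1)[OF kinetic_derivatives(3)] kinetic_derivatives inner_axis)
  moreover have "gradx kinetic x p = 0"
    by (simp add: vec_eq_iff gradp_eq(3)[OF kinetic_derivatives(3)] kinetic_derivatives)
  ultimately show "poisson kinetic H x p = gradx H x p \<bullet> p" by (simp add: poisson_def inner_commute)
  have dpp: "dpp kinetic l k x p = (if k = l then 1 else 0)" for k l :: 'n
    unfolding dpp_eq[OF kinetic_derivatives(3)] kinetic_derivatives(2) by (simp add: inner_axis_axis)
  show "diffusion_part u kinetic x p = (\<Sum>k\<in>UNIV. \<Sum>i\<in>UNIV. (hess u x $ k $ i)^2)"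
    unfolding diffusion_part_def Let_def kinetic_derivatives(2) dpp
    by (simp add: if_distrib power2_eq_square cong: if_cong)
qed

text \<open>Cauchy-Schwarz on the diagonal entries; the off-diagonal squares are merely
  added.\<close>

lemma laplacian_sq_le:
  "(laplacian u x)\<^sup>2 \<le> real CARD('n) * (\<Sum>k\<in>UNIV. \<Sum>i\<in>UNIV. (hess u x $ k $ i)^2)" for u :: "real^'n \<Rightarrow> real"
proof -
  have "(laplacian u x)\<^sup>2 \<le> real CARD('n) * (\<Sum>i\<in>UNIV. (hess u x $ i $ i)\<^sup>2)"
    unfolding trace_hess[symmetric] trace_def
    using sum_squared_le_sum_of_squares[of "\<lambda>i. hess u x $ i $ i" UNIV] by (simp add: mult.commute)
  also have "\<dots> \<le> real CARD('n) * (\<Sum>k\<in>UNIV. \<Sum>i\<in>UNIV. (hess u x $ k $ i)^2)"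
    by (intro mult_left_mono sum_mono member_le_sum) auto
  finally show ?thesis .
qed

text \<open>Bernstein's method: at a maximum of \<open>|P + Du|\<^sup>2 / 2\<close> the generator is nonpositive, while
  \<open>|D\<^sup>2u|\<^sup>2 \<ge> (\<Delta>u)\<^sup>2 / n\<close> turns the cell equation into the coercive quantity.\<close>

lemma gradient_bound:
  fixes H :: "real^'n \<Rightarrow> real^'n \<Rightarrow> real"
  assumes H: "smooth (\<lambda>z. H (fst z) (snd z))" and u: "smooth u" and per: "periodic u"
    and cell: "\<And>x. - (\<epsilon>\<^sup>2 / 2) * laplacian u x + H x (P + grad u x) = c"
    and eps: "\<epsilon> > 0" "\<epsilon>\<^sup>2 * real CARD('n) \<le> 2" and C: "\<bar>c\<bar> \<le> C"
    and coercive: "\<And>x p. R \<le> norm p \<Longrightarrow> C\<^sup>2 + 1 \<le> (H x p)\<^sup>2 / 2 + gradx H x p \<bullet> p"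
  shows "norm (P + grad u x) \<le> R"
proof -
  define p where "p x = P + grad u x" for x
  define g where "g x = kinetic x (P + grad u x)" for x
  have uk: "Ck k u" for k using u by (simp add: smooth_def)
  have pg: "periodic g" using grad_periodic[OF per uk[of "Suc 0"]] by (simp add: g_def periodic_def kinetic_def)
  have g2: "Ck 2 g" unfolding g_def using Ck_graph(2)[OF u kinetic_derivatives(3)] by simp
  obtain y where y: "\<And>z. g z \<le> g y" using periodic_attains_max[OF pg Ck_continuous[OF g2]] by blast
  have "generator (\<lambda>x. - gradp H x (P + grad u x)) \<epsilon> (grad g) (hess g) y \<le> 0"
    using grad_hess_at_max[OF g2 y] by (simp add: generator_def trace_hess mult_nonneg_nonpos)
  then have le: "gradx H y (p y) \<bullet> p y + \<epsilon>\<^sup>2 / 2 * (\<Sum>k\<in>UNIV. \<Sum>i\<in>UNIV. (hess u y $ k $ i)^2) \<le> 0"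
    using generator_graph[OF H u cell kinetic_derivatives(3), of y]
    unfolding g_def kinetic_parts p_def by simp
  have L: "\<epsilon>\<^sup>2 / 2 * laplacian u y = H y (p y) - c" using cell[of y] by (simp add: p_def)
  \<comment> \<open>One factor \<epsilon>^2 / 2 together with the dimension is at most 1 by the
    smallness of \<epsilon>; what is left is exactly the Hessian term in \<open>le\<close>.\<close>
  have "(H y (p y) - c)\<^sup>2 = (\<epsilon>\<^sup>2 / 2)\<^sup>2 * (laplacian u y)\<^sup>2" unfolding L[symmetric] by (simp add: power_mult_distrib power_divide)
  also have "\<dots> \<le> (\<epsilon>\<^sup>2 / 2)\<^sup>2 * (real CARD('n) * (\<Sum>k\<in>UNIV. \<Sum>i\<in>UNIV. (hess u y $ k $ i)^2))"
    by (intro mult_left_mono laplacian_sq_le) simp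
  also have "\<dots> = (\<epsilon>\<^sup>2 * real CARD('n) / 2) * (\<epsilon>\<^sup>2 / 2 * (\<Sum>k\<in>UNIV. \<Sum>i\<in>UNIV. (hess u y $ k $ i)^2))"
    by (simp add: power2_eq_square)
  also have "\<dots> \<le> 1 * (\<epsilon>\<^sup>2 / 2 * (\<Sum>k\<in>UNIV. \<Sum>i\<in>UNIV. (hess u y $ k $ i)^2))"
    using eps by (intro mult_right_mono mult_nonneg_nonneg sum_nonneg) auto
  finally have "gradx H y (p y) \<bullet> p y + (H y (p y) - c)\<^sup>2 \<le> 0" using le by simp
  \<comment> \<open>Equivalent to (H - 2c)^2 \<ge> 0. It produces the H^2 / 2 of the coercivity
    hypothesis at the price of c^2, and the extra 1 in that hypothesis then gives the
    contradiction.\<close>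
  moreover have "(H y (p y))\<^sup>2 / 2 - c\<^sup>2 \<le> (H y (p y) - c)\<^sup>2"
    using zero_le_power2[of "H y (p y) - 2 * c"] by (simp add: power2_eq_square algebra_simps)
  moreover have "c\<^sup>2 \<le> C\<^sup>2" using C by (simp add: abs_le_square_iff[symmetric])
  ultimately have "\<not> R \<le> norm (p y)" using coercive[of "p y" y] by linarith
  then have "norm (p y) \<le> R" by linarith
  moreover have "norm (p x) \<le> norm (p y)"
  proof (rule power2_le_imp_le)
    show "(norm (p x))\<^sup>2 \<le> (norm (p y))\<^sup>2" using y[of x] by (simp add: g_def kinetic_def p_def power2_norm_eq_inner)
  qed simp
  ultimately show ?thesis unfolding p_def by linarith
qed

section \<open>Periodicity and regularity of the drift and the generator\<close>

lemma periodic_x_dderiv: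
  fixes F :: "real^'n \<Rightarrow> real^'n \<Rightarrow> real"
  assumes p: "periodic_x F" and F: "Ck (Suc m) (\<lambda>z. F (fst z) (snd z))" and k: "int_vec k"
  shows "dderiv (\<lambda>z. F (fst z) (snd z)) v (x + k, q) = dderiv (\<lambda>z. F (fst z) (snd z)) v (x, q)"
proof -
  let ?\<Phi> = "\<lambda>z. F (fst z) (snd z)"
  have "((\<lambda>z. z + (k, 0)) has_derivative (\<lambda>v. v)) (at (x, q))" by (auto intro!: derivative_eq_intros)
  from has_derivative_compose[OF this, of ?\<Phi> "\<lambda>v. dderiv ?\<Phi> v (x + k, q)"] Ck_has_derivative[OF F, of "(x + k, q)"]
  have "((\<lambda>z. ?\<Phi> (z + (k, 0))) has_derivative (\<lambda>v. dderiv ?\<Phi> v (x + k, q))) (at (x, q))" by simp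
  moreover have "(\<lambda>z. ?\<Phi> (z + (k, 0))) = ?\<Phi>" using p k by (auto simp: periodic_x_def)
  ultimately have "(?\<Phi> has_derivative (\<lambda>v. dderiv ?\<Phi> v (x + k, q))) (at (x, q))" by (simp only:)
  from dderiv_eq[OF this] show ?thesis by (rule sym)
qed

text \<open>A continuous periodic gradient is bounded, so the mean value inequality is global; the
  constants of the components are added up.\<close>

lemma periodic_field_lipschitz:
  fixes b :: "real^'n \<Rightarrow> real^'n"
  assumes C: "\<And>i. Ck (Suc 0) (\<lambda>x. b x $ i)" and p: "periodic b"
  obtains L where "L \<ge> 0" "\<And>y z. norm (b y - b z) \<le> L * norm (y - z)"
proof -
  have "\<exists>L\<ge>0. \<forall>y z. \<bar>b y $ i - b z $ i\<bar> \<le> L * norm (y - z)" for i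
  proof -
    let ?f = "\<lambda>x. b x $ i"
    have "periodic ?f" using p by (simp add: periodic_def)
    then obtain B where B: "B \<ge> 0" "\<And>x. norm (grad ?f x) \<le> B"
      using periodic_bounded[OF grad_periodic[OF _ C] grad_continuous[OF C]] by blast
    have "norm (?f y - ?f z) \<le> B * norm (y - z)" for y z
    proof (rule differentiable_bound[of UNIV ?f "\<lambda>x v. grad ?f x \<bullet> v"])
      show "onorm (\<lambda>v. grad ?f x \<bullet> v) \<le> B" for x
      proof (rule onorm_le)
        fix v
        have "norm (grad ?f x \<bullet> v) \<le> norm (grad ?f x) * norm v" by (simp add: Cauchy_Schwarz_ineq2)
        also have "\<dots> \<le> B * norm v" using B by (intro mult_right_mono) auto
        finally show "norm (grad ?f x \<bullet> v) \<le> B * norm v" .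
      qed
    qed (use grad_has_derivative[OF C] in auto)
    then show ?thesis using B(1) by auto
  qed
  then obtain L where L: "\<And>i. L i \<ge> 0" "\<And>i y z. \<bar>b y $ i - b z $ i\<bar> \<le> L i * norm (y - z)" by metis
  show ?thesis
  proof (rule that[of "\<Sum>i\<in>UNIV. L i"])
    fix y z
    have "norm (b y - b z) \<le> (\<Sum>i\<in>UNIV. \<bar>(b y - b z) $ i\<bar>)" by (rule norm_le_l1_cart)
    also have "\<dots> \<le> (\<Sum>i\<in>UNIV. L i * norm (y - z))" using L(2) by (intro sum_mono) simp
    finally show "norm (b y - b z) \<le> (\<Sum>i\<in>UNIV. L i) * norm (y - z)" by (simp add: sum_distrib_right)
  qed (use L in \<open>auto intro: sum_nonneg\<close>)
qed

lemma grad_translate: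
  assumes "smooth u" "periodic u" "int_vec k"
  shows "grad u (x + k) = grad u x"
  using grad_periodic[of u 0] assms by (simp add: periodic_def smooth_def del: Ck.simps)

lemma periodic_graph:
  assumes "smooth u" "periodic u" "periodic_x F"
  shows "periodic (\<lambda>x. F x (P + grad u x))"
  using assms(3) grad_translate[OF assms(1,2)] by (simp add: periodic_def periodic_x_def)

lemma gradp_periodic_x:
  fixes F :: "real^'n \<Rightarrow> real^'n \<Rightarrow> real"
  assumes F: "Ck (Suc k) (\<lambda>z. F (fst z) (snd z))" and p: "periodic_x F"
  shows "periodic_x (gradp F)" "periodic_x (gradx F)"
  unfolding periodic_x_def using periodic_x_dderiv[OF p F] gradp_eq[OF F]
  by (simp_all add: vec_eq_iff)

lemma gradp_continuous:
  fixes F :: "real^'n \<Rightarrow> real^'n \<Rightarrow> real"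
  assumes F: "Ck (Suc k) (\<lambda>z. F (fst z) (snd z))"
  shows "continuous_on UNIV (\<lambda>z. gradp F (fst z) (snd z))" "continuous_on UNIV (\<lambda>z. gradx F (fst z) (snd z))"
proof -
  have "continuous_on UNIV (\<lambda>z. dderiv (\<lambda>z. F (fst z) (snd z)) v z)" for v
    by (rule Ck_continuous[OF Ck_dderiv[OF F]])
  then show "continuous_on UNIV (\<lambda>z. gradp F (fst z) (snd z))" "continuous_on UNIV (\<lambda>z. gradx F (fst z) (snd z))"
    by (auto intro!: continuous_on_vec simp: gradp_eq[OF F])
qed

lemma drift_properties:
  fixes H :: "real^'n \<Rightarrow> real^'n \<Rightarrow> real" and P :: "real^'n"
  assumes H: "smooth (\<lambda>z. H (fst z) (snd z))" and Hp: "periodic_x H" and u: "smooth u" and up: "periodic u"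
  defines "b \<equiv> \<lambda>x. - gradp H x (P + grad u x)"
  obtains L B where "L \<ge> 0" "\<And>y z. norm (b y - b z) \<le> L * norm (y - z)" "\<And>x. norm (b x) \<le> B"
    "periodic b" "continuous_on UNIV b"
proof -
  have Hk: "Ck k (\<lambda>z. H (fst z) (snd z))" for k using H by (simp add: smooth_def)
  have C: "Ck (Suc 0) (\<lambda>x. b x $ i)" for i
  proof -
    have "Ck (Suc 0) (\<lambda>x. (-1) * dderiv (\<lambda>z. H (fst z) (snd z)) (ep i) (x, P + grad u x))"
      by (intro Ck_mult Ck_const Ck_graph(2)[OF u] Ck_dderiv Hk)
    then show ?thesis by (simp only: b_def vector_uminus_component gradp_eq(1)[OF Hk[of "Suc 0"]] mult_minus1)
  qed
  have per: "periodic b"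
    using periodic_graph[OF u up gradp_periodic_x(1)[OF Hk[of "Suc 0"] Hp], where P=P] by (simp add: b_def periodic_def)
  obtain L where L: "L \<ge> 0" "\<And>y z. norm (b y - b z) \<le> L * norm (y - z)"
    using periodic_field_lipschitz[OF C per] by blast
  have cont: "continuous_on UNIV b" by (rule continuous_on_vec) (rule Ck_continuous[OF C])
  obtain B where "\<And>x. norm (b x) \<le> B" using periodic_bounded[OF per cont] by blast
  then show ?thesis by (rule that[OF L _ per cont])
qed

lemma generator_periodic_continuous:
  fixes g :: "real^'n \<Rightarrow> real"
  assumes b: "periodic b" "continuous_on UNIV b" and g: "Ck 2 g" "periodic g"
  shows "periodic (generator b \<epsilon> (grad g) (hess g))" "continuous_on UNIV (generator b \<epsilon> (grad g) (hess g))"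
proof -
  have g1: "Ck (Suc (Suc 0)) g" using g by (simp add: numeral_2_eq_2)
  show "periodic (generator b \<epsilon> (grad g) (hess g))"
    using b(1) grad_periodic[OF g(2) g1] hess_periodic[OF g(2,1)] by (simp add: periodic_def generator_def)
  show "continuous_on UNIV (generator b \<epsilon> (grad g) (hess g))"
    unfolding generator_def[abs_def] trace_def
    by (intro continuous_on_add continuous_on_inner b grad_continuous[OF g1] continuous_on_mult continuous_on_const
       continuous_on_sum continuous_on_component hess_continuous g)
qed

section \<open>Stationarity of the ergodic averages\<close>

text \<open>One noise level: \<open>u\<close> solves the viscous cell problem, \<open>c\<close> is
  its effective Hamiltonian, and \<open>T\<close> is a sequence of horizons along which the time
  averages converge to \<mu>.\<close>

locale ergodic_measure =
  fixes H :: "real^'n \<Rightarrow> real^'n \<Rightarrow> real" and P x0 :: "real^'n" and u :: "real^'n \<Rightarrow> real" and \<epsilon> :: real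
    and M :: "'w measure" and w :: "real \<Rightarrow> 'w \<Rightarrow> real^'n" and X :: "real \<Rightarrow> 'w \<Rightarrow> real^'n"
    and \<mu> :: "((real^'n) \<times> (real^'n)) measure" and T :: "nat \<Rightarrow> real" and c :: real
  assumes H: "smooth (\<lambda>z. H (fst z) (snd z))" and Hp: "periodic_x H" and u: "smooth u" and up: "periodic u"
    and cell: "\<And>x. - (\<epsilon>\<^sup>2 / 2) * laplacian u x + H x (P + grad u x) = c"
    and BM: "brownian_motion M w"
    and X: "\<And>\<omega>. \<omega> \<in> space M \<Longrightarrow> continuous_on {0..} (\<lambda>t. X t \<omega>)"
    and sde: "\<And>\<omega> t. \<omega> \<in> space M \<Longrightarrow> t \<ge> 0 \<Longrightarrow> X t \<omega> = x0
        + integral {0..t} (\<lambda>s. - gradp H (X s \<omega>) (P + grad u (X s \<omega>))) + \<epsilon> *\<^sub>R w t \<omega>"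
    and \<mu>: "torus_measure \<mu>" "prob_space \<mu>"
    and T: "filterlim T at_top sequentially"
    and erg: "\<And>\<phi>. Cc_torus \<phi> \<Longrightarrow> (\<lambda>j. (1 / T j) * (\<integral>\<omega>. integral {0..T j} (\<lambda>t. \<phi> (X t \<omega>) (P + grad u (X t \<omega>))) \<partial>M))
        \<longlonglongrightarrow> (\<integral>z. \<phi> (fst z) (snd z) \<partial>\<mu>)"
begin

interpretation \<mu>: prob_space \<mu> by (rule \<mu>(2))

lemma sets_\<mu>: "sets \<mu> = sets borel" and space_\<mu>: "space \<mu> = UNIV"
  using \<mu>(1) sets_eq_imp_space_eq[of \<mu> borel] by (auto simp: torus_measure_def)

lemma continuous_measurable_\<mu>: "continuous_on UNIV f \<Longrightarrow> f \<in> borel_measurable \<mu>"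
  for f :: "_ \<Rightarrow> 'b::topological_space"
  using borel_measurable_continuous_onI[of f] sets_\<mu> by (simp cong: measurable_cong_sets)

lemma grad_u_continuous: "continuous_on UNIV (grad u)"
  using grad_continuous[of 0 u] u by (simp add: smooth_def del: Ck.simps)

text \<open>The ergodic limits are given for compactly supported functions only; this continuous
  cutoff equals 1 up to radius \<open>N\<close> and makes other functions admissible.\<close>

definition cutoff :: "real \<Rightarrow> real^'n \<Rightarrow> real" where
  "cutoff N p = max 0 (min 1 (N + 1 - norm p))"

lemma cutoff: "0 \<le> cutoff N p" "cutoff N p \<le> 1" "norm p \<le> N \<Longrightarrow> cutoff N p = 1" "norm p > N + 1 \<Longrightarrow> cutoff N p = 0"
  by (auto simp: cutoff_def)

text \<open>The trajectories never leave the graph, so the truncated distance to the graph has time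
  average 0. Its integral vanishes for each cutoff radius, and countably many radii exhaust phase
  space.\<close>

lemma \<mu>_graph: "AE z in \<mu>. snd z = P + grad u (fst z)"
proof -
  define \<phi> where "\<phi> N x p = min 1 (norm (p - P - grad u x)) * cutoff N p" for N x p
  have cont: "continuous_on UNIV (\<lambda>z. \<phi> N (fst z) (snd z))" for N
    unfolding \<phi>_def cutoff_def
    by (intro continuous_intros continuous_on_compose2[OF grad_u_continuous]) auto
  have "AE z in \<mu>. \<phi> (real N) (fst z) (snd z) = 0" for N
  proof -
    have "Cc_torus (\<phi> (real N))"
      unfolding Cc_torus_def using cont[of N] grad_translate[OF u up]
      by (auto simp: periodic_x_def \<phi>_def cutoff_def intro!: exI[of _ "real N + 1"])
    from erg[OF this] have "(\<lambda>j. 0) \<longlonglongrightarrow> (\<integral>z. \<phi> (real N) (fst z) (snd z) \<partial>\<mu>)"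
      by (simp add: \<phi>_def)
    then have 0: "(\<integral>z. \<phi> (real N) (fst z) (snd z) \<partial>\<mu>) = 0" by (simp add: LIMSEQ_const_iff)
    have "0 \<le> \<phi> (real N) x p \<and> \<phi> (real N) x p \<le> 1" for x p
      unfolding \<phi>_def using cutoff(1,2) by (intro conjI mult_le_one mult_nonneg_nonneg) auto
    then have "integrable \<mu> (\<lambda>z. \<phi> (real N) (fst z) (snd z))"
      by (intro \<mu>.integrable_const_bound[of _ 1] continuous_measurable_\<mu>[OF cont]) auto
    from integral_nonneg_eq_0_iff_AE[OF this] 0 show ?thesis using cutoff by (auto simp: \<phi>_def)
  qed
  then have "AE z in \<mu>. \<forall>N::nat. \<phi> (real N) (fst z) (snd z) = 0" by (simp add: AE_all_countable)
  then show ?thesis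
  proof (eventually_elim)
    case (elim z)
    obtain N :: nat where "norm (snd z) \<le> real N" using real_arch_simple by blast
    then have "cutoff (real N) (snd z) = 1" by (rule cutoff)
    then have "min 1 (norm (snd z - P - grad u (fst z))) = 0" using elim[rule_format, of N] by (simp add: \<phi>_def)
    then show ?case by (auto simp: min_def algebra_simps split: if_splits)
  qed
qed

lemma integral_graph:
  fixes F :: "_ \<Rightarrow> real"
  assumes "continuous_on UNIV F"
  shows "(\<integral>z. F z \<partial>\<mu>) = (\<integral>z. F (fst z, P + grad u (fst z)) \<partial>\<mu>)"
proof (rule integral_cong_AE)
  show "F \<in> borel_measurable \<mu>" by (rule continuous_measurable_\<mu>[OF assms])
  show "(\<lambda>z. F (fst z, P + grad u (fst z))) \<in> borel_measurable \<mu>"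
    by (intro continuous_measurable_\<mu> continuous_on_compose2[OF assms] continuous_intros
         continuous_on_compose2[OF grad_u_continuous]) auto
  show "AE z in \<mu>. F z = F (fst z, P + grad u (fst z))"
    using \<mu>_graph by eventually_elim (metis prod.collapse)
qed

text \<open>The Dynkin bound 2 G does not grow with the horizon, so the time averages of the
  generator are at most 2 G / T and tend to 0.\<close>

lemma \<mu>_stationary:
  assumes g: "Ck 2 g" and gp: "periodic g"
  shows "(\<integral>z. generator (\<lambda>x. - gradp H x (P + grad u x)) \<epsilon> (grad g) (hess g) (fst z) \<partial>\<mu>) = 0"
proof -
  define b where "b x = - gradp H x (P + grad u x)" for x
  let ?L = "generator b \<epsilon> (grad g) (hess g)"
  have g1: "Ck (Suc (Suc 0)) g" using g by (simp add: numeral_2_eq_2)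
  obtain Lb B where b: "Lb \<ge> 0" "\<And>y z. norm (b y - b z) \<le> Lb * norm (y - z)" "\<And>x. norm (b x) \<le> B"
    "periodic b" "continuous_on UNIV b"
    using drift_properties[OF H Hp u up, where P=P] unfolding b_def by blast
  note Lp = generator_periodic_continuous[OF b(4,5) g gp, of \<epsilon>]
  obtain LB where LB: "\<And>x. norm (?L x) \<le> LB" using periodic_bounded[OF Lp] by blast
  obtain G where G: "\<And>x. norm (g x) \<le> G" using periodic_bounded[OF gp Ck_continuous[OF g]] by blast
  obtain K where K: "\<And>x. norm (hess g x) \<le> K" using periodic_bounded[OF hess_periodic[OF gp g] hess_continuous[OF g]] by blast
  have bound: "\<bar>\<integral>\<omega>. integral {0..t} (\<lambda>s. ?L (X s \<omega>)) \<partial>M\<bar> \<le> 2 * G" if "t > 0" for t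
    by (rule dynkin_bound[OF BM X sde[folded b_def] b(2,1,3) grad_has_derivative[OF g1] hess_has_derivative[OF g]
         periodic_uniformly_continuous[OF hess_periodic[OF gp g] hess_continuous[OF g]] K _
         periodic_uniformly_continuous[OF Lp] _ that, of G LB])
       (use G LB in auto)
  have c0: "continuous_on UNIV (\<lambda>x. P + grad u x)" by (intro continuous_intros grad_u_continuous)
  have "periodic (\<lambda>x. P + grad u x)" using grad_translate[OF u up] by (simp add: periodic_def)
  then obtain R where R: "\<And>x. norm (P + grad u x) \<le> R" using periodic_bounded[OF _ c0] by blast
  \<comment> \<open>The graph stays within radius \<open>R\<close>, so on it the cutoff is 1 and the
    compactly supported \<phi> coincides with the generator.\<close>
  define \<phi> where "\<phi> x p = ?L x * cutoff R p" for x p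
  have \<phi>X: "\<phi> x (P + grad u x) = ?L x" for x by (simp add: \<phi>_def cutoff R)
  have "continuous_on UNIV (\<lambda>z. \<phi> (fst z) (snd z))"
    unfolding \<phi>_def cutoff_def by (intro continuous_intros continuous_on_compose2[OF Lp(2)]) auto
  then have cc: "Cc_torus \<phi>" and cont: "continuous_on UNIV (\<lambda>z. \<phi> (fst z) (snd z))"
    unfolding Cc_torus_def using Lp(1)
    by (auto simp: periodic_x_def periodic_def \<phi>_def cutoff_def intro!: exI[of _ "R + 1"])
  have l1: "(\<lambda>j. (1 / T j) * (\<integral>\<omega>. integral {0..T j} (\<lambda>t. ?L (X t \<omega>)) \<partial>M)) \<longlonglongrightarrow> (\<integral>z. \<phi> (fst z) (snd z) \<partial>\<mu>)"
    using erg[OF cc] unfolding \<phi>X .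
  have "(\<lambda>j. (1 / T j) * (\<integral>\<omega>. integral {0..T j} (\<lambda>t. ?L (X t \<omega>)) \<partial>M)) \<longlonglongrightarrow> 0"
  proof (rule tendsto_rabs_zero_cancel, rule tendsto_sandwich[of "\<lambda>_. 0" _ _ "\<lambda>j. 2 * G / T j"])
    have pos: "\<forall>\<^sub>F j in sequentially. T j > 0" using T by (simp add: filterlim_at_top_dense)
    then show "\<forall>\<^sub>F j in sequentially. \<bar>(1 / T j) * (\<integral>\<omega>. integral {0..T j} (\<lambda>t. ?L (X t \<omega>)) \<partial>M)\<bar> \<le> 2 * G / T j"
    proof eventually_elim
      case (elim j)
      then show ?case using bound[OF elim] by (simp add: abs_mult divide_right_mono)
    qed
    show "(\<lambda>j. 2 * G / T j) \<longlonglongrightarrow> 0"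
      by (rule tendsto_divide_0[OF tendsto_const filterlim_at_top_imp_at_infinity[OF T]])
  qed auto
  then have "(\<integral>z. \<phi> (fst z) (snd z) \<partial>\<mu>) = 0" using l1 LIMSEQ_unique by blast
  then show ?thesis
    using integral_graph[OF cont] by (simp add: \<phi>X b_def[abs_def])
qed

end

section \<open>Weak compactness of measures on compact convex sets\<close>

text \<open>For t in [0,1), digit number \<open>q\<close> after the binary point, counted from 0.
  The floor formula makes it a Borel function of \<open>t\<close>.\<close>

definition bdigit :: "nat \<Rightarrow> real \<Rightarrow> real" where
  "bdigit q t = of_int \<lfloor>2 ^ Suc q * t\<rfloor> - 2 * of_int \<lfloor>2 ^ q * t\<rfloor>"

lemma bdigit_cases: "bdigit q t = 0 \<or> bdigit q t = 1"
proof -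
  let ?k = "\<lfloor>2 ^ Suc q * t\<rfloor> - 2 * \<lfloor>2 ^ q * t\<rfloor>"
  have "2 ^ Suc q * t = 2 * (2 ^ q * t)" by simp
  then have "?k = 0 \<or> ?k = 1" by linarith
  moreover have "bdigit q t = of_int ?k" by (simp add: bdigit_def)
  ultimately show ?thesis by (metis of_int_0 of_int_1)
qed

text \<open>Equal digits put both numbers into the same dyadic interval. The converse fails near
  dyadic points, which is why the coding below is only Borel although its inverse is
  continuous.\<close>

lemma bdigit_agree:
  assumes "0 \<le> t" "t < 1" "0 \<le> t'" "t' < 1" and "\<And>q. q < Q \<Longrightarrow> bdigit q t = bdigit q t'"
  shows "\<bar>t - t'\<bar> \<le> 1 / 2 ^ Q"
proof -
  have "q \<le> Q \<Longrightarrow> \<lfloor>2 ^ q * t\<rfloor> = \<lfloor>2 ^ q * t'\<rfloor>" for q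
  proof (induction q)
    case 0
    have "\<lfloor>t\<rfloor> = 0" "\<lfloor>t'\<rfloor> = 0" using assms(1-4) by (simp_all add: floor_eq_iff)
    then show ?case by simp
  next
    case (Suc q)
    then have "bdigit q t = bdigit q t'" "\<lfloor>2 ^ q * t\<rfloor> = \<lfloor>2 ^ q * t'\<rfloor>" using assms(5) by auto
    then show ?case by (simp add: bdigit_def)
  qed
  then have "\<lfloor>2 ^ Q * t\<rfloor> = \<lfloor>2 ^ Q * t'\<rfloor>" by simp
  then have "\<bar>2 ^ Q * t - 2 ^ Q * t'\<bar> \<le> 1" by linarith
  then have "2 ^ Q * \<bar>t - t'\<bar> \<le> 1" by (simp add: right_diff_distrib[symmetric] abs_mult)
  then show ?thesis by (simp add: field_simps)
qed

lemma cantor_series: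
  fixes d :: "nat \<Rightarrow> real"
  assumes d: "\<And>n. d n = 0 \<or> d n = 1"
  shows "summable (\<lambda>n. d n * (1/3)^n)" "0 \<le> (\<Sum>n. d n * (1/3)^n)" "(\<Sum>n. d n * (1/3)^n) \<le> 3/2"
proof -
  have g: "summable (\<lambda>n. (1/3::real)^n)" by (rule summable_geometric) simp
  have b: "\<bar>d n\<bar> \<le> 1" "0 \<le> d n" for n using d[of n] by auto
  show s: "summable (\<lambda>n. d n * (1/3)^n)"
    by (rule summable_comparison_test'[OF g]) (use b in \<open>auto simp: abs_mult mult_left_le_one_le\<close>)
  show "0 \<le> (\<Sum>n. d n * (1/3)^n)" by (rule suminf_nonneg[OF s]) (use b in auto)
  have "(\<Sum>n. d n * (1/3)^n) \<le> (\<Sum>n. (1/3::real)^n)"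
    by (rule suminf_le[OF _ s g]) (use b in \<open>auto simp: mult_left_le_one_le abs_le_iff\<close>)
  also have "\<dots> = 3/2" by (subst suminf_geometric) auto
  finally show "(\<Sum>n. d n * (1/3)^n) \<le> 3/2" .
qed

text \<open>Base 3 with digits 0 and 1 leaves gaps: the first disagreement, at \<open>j\<close>,
  contributes 3^-j, while the later terms sum to at most half of that. In base 2 a carry could
  compensate the disagreement.\<close>

lemma cantor_series_close:
  fixes d d' :: "nat \<Rightarrow> real"
  assumes d: "\<And>n. d n = 0 \<or> d n = 1" and d': "\<And>n. d' n = 0 \<or> d' n = 1"
    and close: "\<bar>(\<Sum>n. d n * (1/3)^n) - (\<Sum>n. d' n * (1/3)^n)\<bar> < (1/3)^N / 2" and i: "i \<le> N"
  shows "d i = d' i"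
proof (rule ccontr)
  assume "d i \<noteq> d' i"
  define j where "j = (LEAST k. d k \<noteq> d' k)"
  have j: "d j \<noteq> d' j" unfolding j_def by (rule LeastI) fact
  have ji: "j \<le> i" unfolding j_def by (rule Least_le) fact
  have less: "d k = d' k" if "k < j" for k using not_less_Least[of k] that unfolding j_def by auto
  define f where "f n = (d n - d' n) * (1/3)^n" for n
  have sf: "summable f" unfolding f_def left_diff_distrib
    by (intro summable_diff cantor_series d d')
  have S: "(\<Sum>n. d n * (1/3)^n) - (\<Sum>n. d' n * (1/3)^n) = suminf f"
    unfolding f_def left_diff_distrib by (rule suminf_diff) (intro cantor_series d d')+
  have "suminf f = (\<Sum>n. f (n + Suc j)) + (\<Sum>n<Suc j. f n)"
    by (rule suminf_split_initial_segment[OF sf])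
  moreover have "(\<Sum>n<Suc j. f n) = f j" using less by (simp add: f_def)
  ultimately have e: "suminf f = f j + (\<Sum>n. f (n + Suc j))" by simp
  have fj: "\<bar>f j\<bar> = (1/3)^j" using j d[of j] d'[of j] by (auto simp: f_def)
  have "norm (\<Sum>n. f (n + Suc j)) \<le> (\<Sum>n. (1/3)^Suc j * (1/3)^n)"
  proof (rule norm_suminf_le)
    show "summable (\<lambda>n. (1/3)^Suc j * (1/3::real)^n)" by (intro summable_mult summable_geometric) simp
    fix n
    have "\<bar>d (n + Suc j) - d' (n + Suc j)\<bar> \<le> 1" using d[of "n + Suc j"] d'[of "n + Suc j"] by auto
    then have "\<bar>d (n + Suc j) - d' (n + Suc j)\<bar> * (1/3)^(n + Suc j) \<le> 1 * (1/3)^(n + Suc j)"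
      by (intro mult_right_mono) auto
    then show "norm (f (n + Suc j)) \<le> (1/3)^Suc j * (1/3)^n" by (simp add: f_def abs_mult power_add mult_ac)
  qed
  also have "\<dots> = (1/3)^Suc j * (\<Sum>n. (1/3::real)^n)" by (rule suminf_mult) (simp add: summable_geometric)
  also have "\<dots> = (1/3)^j / 2" by (subst suminf_geometric) auto
  finally have tl: "\<bar>\<Sum>n. f (n + Suc j)\<bar> \<le> (1/3)^j / 2" unfolding real_norm_def .
  have "\<bar>f j\<bar> \<le> \<bar>suminf f\<bar> + \<bar>\<Sum>n. f (n + Suc j)\<bar>" unfolding e by linarith
  with tl have "\<bar>suminf f\<bar> \<ge> (1/3)^j / 2" unfolding fj by linarith
  moreover have "(1/3::real)^N \<le> (1/3)^j" using ji i by (intro power_decreasing) auto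
  ultimately show False using close unfolding S by linarith
qed

text \<open>Interleaving the binary digits of the coordinates into one ternary expansion gives an injection
  into the line with uniformly continuous inverse. It reduces weak compactness to Helly's theorem
  on the real line.\<close>

lemma borel_coding:
  fixes C :: "'a::euclidean_space set"
  assumes C: "compact C" "convex C" "C \<noteq> {}"
  obtains s :: "'a \<Rightarrow> real" and g :: "real \<Rightarrow> 'a" where "s \<in> borel_measurable borel" "continuous_on UNIV g"
    "range g \<subseteq> C" "\<And>x. x \<in> C \<Longrightarrow> g (s x) = x" "\<And>x. 0 \<le> s x \<and> s x \<le> 3/2"
proof -
  define m where "m = DIM('a)"
  have m0: "m > 0" by (simp add: m_def)
  obtain e :: "nat \<Rightarrow> 'a" where e: "bij_betw e {0..<m} Basis"
    using ex_bij_betw_nat_finite[OF finite_Basis] unfolding m_def by blast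
  obtain R where R: "R > 0" "\<And>x. x \<in> C \<Longrightarrow> norm x \<le> R"
    using compact_imp_bounded[OF C(1)] by (auto simp: bounded_pos)
  \<comment> \<open>Rescales each coordinate of \<open>C\<close> into [0,1); the summand 1 in the
    denominator makes the upper bound strict.\<close>
  define t where "t b x = (x \<bullet> b + R) / (2 * R + 1)" for b x :: 'a
  have t: "0 \<le> t b x" "t b x < 1" if "x \<in> C" "b \<in> Basis" for b x
  proof -
    have "\<bar>x \<bullet> b\<bar> \<le> R" using Basis_le_norm[OF that(2), of x] R(2)[OF that(1)] by linarith
    then show "0 \<le> t b x" "t b x < 1" using R(1) by (auto simp: t_def field_simps)
  qed
  \<comment> \<open>Interleaving: position q m + i of the expansion carries binary digit
    \<open>q\<close> of coordinate \<open>i\<close>.\<close>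
  define d where "d x n = bdigit (n div m) (t (e (n mod m)) x)" for x n
  have d: "d x n = 0 \<or> d x n = 1" for x n by (simp add: d_def bdigit_cases)
  define s where "s x = (\<Sum>n. d x n * (1/3)^n)" for x
  have sm: "s \<in> borel_measurable borel"
  proof -
    have "(\<lambda>x. d x n) \<in> borel_measurable borel" for n
      unfolding d_def bdigit_def t_def by measurable
    then show ?thesis unfolding s_def[abs_def] by (intro borel_measurable_suminf) auto
  qed
  \<comment> \<open>Close codes share their first m Q digits, hence Q binary digits of every
    coordinate. This gives injectivity and the uniform continuity of the inverse at once.\<close>
  have sep: "\<exists>\<delta>>0. \<forall>x\<in>C. \<forall>y\<in>C. \<bar>s x - s y\<bar> < \<delta> \<longrightarrow> dist x y < r" if r: "r > 0" for r
  proof -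
    have "r / (real m * (2 * R + 1)) > 0" using r R m0 by simp
    from real_arch_pow_inv[OF this, of "1/2"] obtain Q where Q: "(1/2)^Q < r / (real m * (2 * R + 1))" by auto
    show ?thesis
    proof (intro exI[of _ "(1/3)^(m * Q) / 2"] conjI ballI impI)
      fix x y assume xy: "x \<in> C" "y \<in> C" and "\<bar>s x - s y\<bar> < (1/3)^(m * Q) / 2"
      then have agree: "d x n = d y n" if "n \<le> m * Q" for n
        using cantor_series_close[of "d x" "d y" "m * Q" n] d that unfolding s_def by blast
      have tb: "\<bar>t b x - t b y\<bar> \<le> 1 / 2^Q" if b: "b \<in> Basis" for b
      proof (rule bdigit_agree)
        fix q assume q: "q < Q"
        obtain i where i: "i < m" "b = e i" using e b by (metis atLeastLessThan_iff bij_betw_imp_surj_on imageE)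
        have "q * m + i \<le> Suc q * m" using i by simp
        also have "\<dots> \<le> Q * m" using q by (intro mult_right_mono) auto
        finally have "d x (q * m + i) = d y (q * m + i)" by (intro agree) (simp add: mult.commute)
        then show "bdigit q (t b x) = bdigit q (t b y)" using i by (simp add: d_def)
      qed (use t xy b in auto)
      have "\<bar>(x - y) \<bullet> b\<bar> \<le> (2 * R + 1) * (1 / 2^Q)" if b: "b \<in> Basis" for b
      proof -
        have "(x - y) \<bullet> b = (2 * R + 1) * (t b x - t b y)" 
          using R(1) unfolding t_def diff_divide_distrib[symmetric] by (simp add: inner_diff_left)
        then have "\<bar>(x - y) \<bullet> b\<bar> = (2 * R + 1) * \<bar>t b x - t b y\<bar>" using R(1) by (simp add: abs_mult)
        also have "\<dots> \<le> (2 * R + 1) * (1 / 2^Q)" using tb[OF b] R(1) by (intro mult_left_mono) auto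
        finally show ?thesis .
      qed
      then have "(\<Sum>b\<in>Basis. \<bar>(x - y) \<bullet> b\<bar>) \<le> (\<Sum>b\<in>(Basis::'a set). (2 * R + 1) * (1 / 2^Q))"
        by (rule sum_mono)
      then have "norm (x - y) \<le> real m * ((2 * R + 1) * (1 / 2^Q))"
        using norm_le_l1[of "x - y"] by (simp add: m_def)
      also have "\<dots> = (1/2)^Q * (real m * (2 * R + 1))" by (simp add: power_divide)
      also have "\<dots> < r"
      proof -
        have "0 < real m * (2 * R + 1)" using m0 R(1) by simp
        from pos_less_divide_eq[OF this] Q show ?thesis by blast
      qed
      finally show "dist x y < r" by (simp add: dist_norm)
    qed simp
  qed
  have inj: "inj_on s C"
  proof (rule inj_onI)
    fix x y assume xy: "x \<in> C" "y \<in> C" "s x = s y"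
    have "dist x y < r" if "r > 0" for r using sep[OF that] xy by fastforce
    then have "dist x y \<le> 0" by (meson dense_le_bounded less_imp_le not_le)
    then show "x = y" by simp
  qed
  have uc: "uniformly_continuous_on (s ` C) (inv_into C s)"
    unfolding uniformly_continuous_on_def
  proof (intro allI impI)
    fix r :: real assume "r > 0"
    from sep[OF this] obtain \<delta> where \<delta>: "\<delta> > 0" "\<And>x y. x \<in> C \<Longrightarrow> y \<in> C \<Longrightarrow> \<bar>s x - s y\<bar> < \<delta> \<Longrightarrow> dist x y < r" by blast
    show "\<exists>\<delta>>0. \<forall>x\<in>s ` C. \<forall>x'\<in>s ` C. dist x' x < \<delta> \<longrightarrow> dist (inv_into C s x') (inv_into C s x) < r"
      using \<delta> by (intro exI[of _ \<delta>]) (auto simp: inv_into_f_f[OF inj] dist_real_def)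
  qed
  \<comment> \<open>The inverse is extended first to the closure of the codes, by uniform
    continuity, and then to the whole line by Dugundji's theorem; convexity of \<open>C\<close>
    keeps the values of the second extension in \<open>C\<close>.\<close>
  obtain h where h: "uniformly_continuous_on (closure (s ` C)) h" "\<And>y. y \<in> s ` C \<Longrightarrow> inv_into C s y = h y"
    using uniformly_continuous_on_extension_on_closure[OF uc] by metis
  have hc: "continuous_on (closure (s ` C)) h" using h(1) by (rule uniformly_continuous_imp_continuous)
  have hC: "h ` closure (s ` C) \<subseteq> C"
    by (rule image_closure_subset[OF hc compact_imp_closed[OF C(1)]]) (auto simp: h(2)[symmetric] inv_into_f_f[OF inj])
  obtain g where g: "continuous_on UNIV g" "g ` UNIV \<subseteq> C" "\<And>y. y \<in> closure (s ` C) \<Longrightarrow> g y = h y"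
    using Dugundji[OF C(2,3) _ hc hC, of UNIV] by auto
  show ?thesis
  proof (rule that[OF sm g(1,2)])
    show "g (s x) = x" if "x \<in> C" for x
      using g(3)[of "s x"] h(2)[of "s x"] that closure_subset[of "s ` C"] inv_into_f_f[OF inj that] by auto
    show "0 \<le> s x \<and> s x \<le> 3/2" for x unfolding s_def using cantor_series(2,3)[of "d x"] d by blast
  qed
qed

text \<open>The codes lie in a bounded interval, so the images under \<open>s\<close> are tight and
  a subsequence converges weakly on the line; \<open>g\<close> carries its limit back. As
  \<open>g\<close> is continuous, so is \<open>f\<close> composed with \<open>g\<close>, and it is
  bounded because \<open>g\<close> takes values in the compact \<open>C\<close>.\<close>

lemma prob_weak_compact:
  fixes N :: "nat \<Rightarrow> 'a::euclidean_space measure"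
  assumes C: "compact C" "convex C" "C \<noteq> {}"
    and N: "\<And>j. prob_space (N j)" "\<And>j. sets (N j) = sets borel" "\<And>j. AE x in N j. x \<in> C"
  obtains r L where "strict_mono (r::nat \<Rightarrow> nat)" "prob_space L" "sets L = sets borel" "AE x in L. x \<in> C"
    "\<And>f :: 'a \<Rightarrow> real. continuous_on UNIV f \<Longrightarrow> (\<lambda>j. \<integral>x. f x \<partial>N (r j)) \<longlonglongrightarrow> (\<integral>x. f x \<partial>L)"
proof -
  obtain s :: "'a \<Rightarrow> real" and g where sg: "s \<in> borel_measurable borel" "continuous_on UNIV g"
    "range g \<subseteq> C" "\<And>x. x \<in> C \<Longrightarrow> g (s x) = x" "\<And>x. 0 \<le> s x \<and> s x \<le> 3/2"
    by (rule borel_coding[OF C]) blast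
  have sN: "s \<in> measurable (N j) borel" for j using sg(1) N(2) by (simp cong: measurable_cong_sets)
  define \<nu> where "\<nu> j = distr (N j) borel s" for j
  have \<nu>: "real_distribution (\<nu> j)" for j
    unfolding \<nu>_def real_distribution_def real_distribution_axioms_def
    by (auto intro: prob_space.prob_space_distr[OF N(1) sN])
  have "tight \<nu>"
    unfolding tight_def
  proof (intro conjI allI impI \<nu>)
    fix \<epsilon> :: real assume "\<epsilon> > 0"
    have "measure (\<nu> n) {-1<..2} = 1" for n
    proof -
      interpret prob_space "N n" by (rule N(1))
      have "s x \<in> {-1<..2}" for x using sg(5)[of x] by auto
      then have "s -` {-1<..2} \<inter> space (N n) = space (N n)" by auto
      then show ?thesis unfolding \<nu>_def by (subst measure_distr[OF sN]) (auto simp: prob_space)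
    qed
    then show "\<exists>a b. a < b \<and> (\<forall>n. 1 - \<epsilon> < measure (\<nu> n) {a<..b})"
      using \<open>\<epsilon> > 0\<close> by (intro exI[of _ "-1"] exI[of _ 2]) auto
  qed
  from tight_imp_convergent_subsubsequence[OF this strict_mono_id]
  obtain r \<nu>' where r: "strict_mono r" "real_distribution \<nu>'" "weak_conv_m (\<nu> \<circ> r) \<nu>'" by auto
  interpret \<nu>': real_distribution \<nu>' by fact
  have gm: "g \<in> measurable \<nu>' borel"
    using borel_measurable_continuous_onI[OF sg(2)] by (simp cong: measurable_cong_sets)
  have Cb: "C \<in> sets borel" using compact_imp_closed[OF C(1)] by simp
  show ?thesis
  proof (rule that[of r "distr \<nu>' borel g"])
    show "prob_space (distr \<nu>' borel g)" by (rule \<nu>'.prob_space_distr[OF gm])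
    show "AE x in distr \<nu>' borel g. x \<in> C"
      using sg(3) Cb by (subst AE_distr_iff[OF gm]) auto
    fix f :: "'a \<Rightarrow> real" assume f: "continuous_on UNIV f"
    have fm: "f \<in> borel_measurable borel" using f by (rule borel_measurable_continuous_onI)
    have fg: "continuous_on UNIV (\<lambda>y. f (g y))" by (rule continuous_on_compose2[OF f sg(2)]) simp
    have "compact (f ` C)" by (rule compact_continuous_image[OF continuous_on_subset[OF f] C(1)]) simp
    then obtain B where B: "\<And>x. x \<in> C \<Longrightarrow> norm (f x) \<le> B" using compact_imp_bounded by (force simp: bounded_iff)
    have eq: "(\<integral>x. f x \<partial>N j) = (\<integral>y. f (g y) \<partial>\<nu> j)" for j
    proof -
      have "(\<integral>y. f (g y) \<partial>\<nu> j) = (\<integral>x. f (g (s x)) \<partial>N j)"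
        unfolding \<nu>_def by (rule integral_distr[OF sN borel_measurable_continuous_onI[OF fg]])
      also have "\<dots> = (\<integral>x. f x \<partial>N j)"
      proof (rule integral_cong_AE)
        show "(\<lambda>x. f (g (s x))) \<in> borel_measurable (N j)"
          by (rule measurable_compose[OF sN borel_measurable_continuous_onI[OF fg]])
        show "f \<in> borel_measurable (N j)" using fm N(2) by (simp cong: measurable_cong_sets)
        show "AE x in N j. f (g (s x)) = f x" using N(3)[of j] by eventually_elim (simp add: sg(4))
      qed
      finally show ?thesis by simp
    qed
    have "(\<lambda>n. integral\<^sup>L ((\<nu> \<circ> r) n) (\<lambda>y. f (g y))) \<longlonglongrightarrow> integral\<^sup>L \<nu>' (\<lambda>y. f (g y))"
    proof (rule weak_conv_imp_integral_bdd_continuous_conv[OF _ r(2,3), of "\<lambda>y. f (g y)" B])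
      show "real_distribution ((\<nu> \<circ> r) n)" for n using \<nu> by simp
      show "isCont (\<lambda>y. f (g y)) x" for x using fg by (simp add: continuous_on_eq_continuous_at)
      show "norm (f (g x)) \<le> B" for x using sg(3) by (intro B) auto
    qed
    also have "integral\<^sup>L \<nu>' (\<lambda>y. f (g y)) = (\<integral>x. f x \<partial>distr \<nu>' borel g)"
      by (rule integral_distr[OF gm fm, symmetric])
    finally show "(\<lambda>j. \<integral>x. f x \<partial>N (r j)) \<longlonglongrightarrow> (\<integral>x. f x \<partial>distr \<nu>' borel g)" by (simp add: eq)
  qed (use r in auto)
qed

text \<open>The total masses converge along a first subsequence, the normalised measures along a
  further one.\<close>

lemma measure_weak_compact:
  fixes N :: "nat \<Rightarrow> 'a::euclidean_space measure"
  assumes C: "compact C" "convex C" "C \<noteq> {}"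
    and N: "\<And>j. finite_measure (N j)" "\<And>j. sets (N j) = sets borel" "\<And>j. AE x in N j. x \<in> C"
    and m: "\<And>j. measure (N j) UNIV \<le> m"
  obtains r L where "strict_mono (r::nat \<Rightarrow> nat)" "finite_measure L" "sets L = sets borel" "AE x in L. x \<in> C"
    "\<And>f :: 'a \<Rightarrow> real. continuous_on UNIV f \<Longrightarrow> (\<lambda>j. \<integral>x. f x \<partial>N (r j)) \<longlonglongrightarrow> (\<integral>x. f x \<partial>L)"
proof -
  obtain x0 where x0: "x0 \<in> C" using C(3) by blast
  have Cb: "C \<in> sets borel" using compact_imp_closed[OF C(1)] by simp
  define c where "c j = measure (N j) UNIV" for j
  have c: "c j \<in> {0..m}" for j using m by (simp add: c_def)
  obtain r1 l where r1: "strict_mono r1" "l \<in> {0..m}" "(c \<circ> r1) \<longlonglongrightarrow> l"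
    using compact_Icc[of 0 m] c unfolding compact_def by blast
  \<comment> \<open>For vanishing mass the normalisation is replaced by a point mass in
    \<open>C\<close>; it is multiplied by 0 afterwards, so the integrals are unaffected.\<close>
  define \<nu> where "\<nu> j = (if c j = 0 then return borel x0 else density (N j) (\<lambda>_. ennreal (1 / c j)))" for j
  have sp: "space (N j) = UNIV" for j using sets_eq_imp_space_eq[OF N(2)[of j]] by simp
  have "prob_space (\<nu> j)" for j
  proof (cases "c j = 0")
    case True
    then show ?thesis by (simp add: \<nu>_def prob_space_return)
  next
    case False
    interpret finite_measure "N j" by (rule N(1))
    have "c j > 0" using False c[of j] by simp
    then show ?thesis using False
      by (intro prob_spaceI)
         (simp add: \<nu>_def emeasure_density_const sp N(2) emeasure_eq_measure c_def ennreal_mult[symmetric])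
  qed
  moreover have "sets (\<nu> j) = sets borel" for j using N(2) by (simp add: \<nu>_def)
  moreover have "AE x in \<nu> j. x \<in> C" for j
  proof (cases "c j = 0")
    case True
    have "Measurable.pred borel (\<lambda>x. x \<in> C)" using Cb by simp
    from AE_return[OF _ this, of x0] have "AE x in return borel x0. x \<in> C" using x0 by simp
    moreover have "\<nu> j = return borel x0" using True by (simp add: \<nu>_def)
    ultimately show ?thesis by (simp only:)
  next
    case False
    then have "\<nu> j = density (N j) (\<lambda>_. ennreal (1 / c j))" by (simp add: \<nu>_def)
    moreover have "AE x in density (N j) (\<lambda>_. ennreal (1 / c j)). x \<in> C"
      using N(3)[of j] by (auto simp: AE_density)
    ultimately show ?thesis by (simp only:)
  qed
  ultimately obtain r2 \<nu>' where r2: "strict_mono (r2::nat \<Rightarrow> nat)" "prob_space \<nu>'" "sets \<nu>' = sets borel" "AE x in \<nu>'. x \<in> C"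
    "\<And>f :: 'a \<Rightarrow> real. continuous_on UNIV f \<Longrightarrow> (\<lambda>j. \<integral>x. f x \<partial>\<nu> (r1 (r2 j))) \<longlonglongrightarrow> (\<integral>x. f x \<partial>\<nu>')"
    using prob_weak_compact[OF C, of "\<lambda>j. \<nu> (r1 j)"] by blast
  interpret \<nu>': prob_space \<nu>' by fact
  have int_eq: "(\<integral>x. f x \<partial>N j) = c j * (\<integral>x. f x \<partial>\<nu> j)" if f: "continuous_on UNIV f" for f :: "'a \<Rightarrow> real" and j
  proof (cases "c j = 0")
    case True
    interpret finite_measure "N j" by (rule N(1))
    have "emeasure (N j) (space (N j)) = 0" using True by (simp add: emeasure_eq_measure c_def sp)
    then have "AE x in N j. False" by (intro AE_I[where N="space (N j)"]) auto
    then have "(\<integral>x. f x \<partial>N j) = (\<integral>x. 0 \<partial>N j)"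
      using borel_measurable_continuous_onI[OF f] N(2) by (intro integral_cong_AE) (auto cong: measurable_cong_sets)
    then show ?thesis using True by simp
  next
    case False
    have "c j > 0" using False c[of j] by simp
    moreover have "f \<in> borel_measurable (N j)" using borel_measurable_continuous_onI[OF f] N(2) by (simp cong: measurable_cong_sets)
    ultimately have "(\<integral>x. f x \<partial>\<nu> j) = (\<integral>x. 1 / c j * f x \<partial>N j)"
      using False unfolding \<nu>_def by (simp, subst integral_density) auto
    then show ?thesis using \<open>c j > 0\<close> by simp
  qed
  show ?thesis
  proof (rule that[of "r1 \<circ> r2" "density \<nu>' (\<lambda>_. ennreal l)"])
    show "strict_mono (r1 \<circ> r2)" using r1 r2 by (simp add: strict_mono_o)
    show "finite_measure (density \<nu>' (\<lambda>_. ennreal l))"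
      by (rule finite_measureI) (simp add: emeasure_density nn_integral_cmult \<nu>'.emeasure_space_1)
    show "AE x in density \<nu>' (\<lambda>_. ennreal l). x \<in> C" using r2(4) by (auto simp: AE_density)
    show "sets (density \<nu>' (\<lambda>_. ennreal l)) = sets borel" using r2(3) by simp
    fix f :: "'a \<Rightarrow> real" assume f: "continuous_on UNIV f"
    have "f \<in> borel_measurable \<nu>'" using borel_measurable_continuous_onI[OF f] r2(3) by (simp cong: measurable_cong_sets)
    then have "(\<integral>x. f x \<partial>density \<nu>' (\<lambda>_. ennreal l)) = l * (\<integral>x. f x \<partial>\<nu>')"
      using r1(2) by (subst integral_density) auto
    moreover have "(\<lambda>j. c (r1 (r2 j))) \<longlonglongrightarrow> l" using LIMSEQ_subseq_LIMSEQ[OF r1(3) r2(1)] by (simp add: o_def)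
    ultimately show "(\<lambda>j. \<integral>x. f x \<partial>N ((r1 \<circ> r2) j)) \<longlonglongrightarrow> (\<integral>x. f x \<partial>density \<nu>' (\<lambda>_. ennreal l))"
      unfolding int_eq[OF f] using tendsto_mult[OF _ r2(5)[OF f]] by simp
  qed
qed

text \<open>Convergence is tested on all continuous functions, bounded or not: the measures to which
  this is applied all live on the compact \<open>C\<close>.\<close>

definition weak_limit_on :: "'a::euclidean_space set \<Rightarrow> (nat \<Rightarrow> 'a measure) \<Rightarrow> 'a measure \<Rightarrow> bool" where
  "weak_limit_on C N L \<longleftrightarrow> finite_measure L \<and> sets L = sets borel \<and> (AE x in L. x \<in> C) \<and>
     (\<forall>f :: 'a \<Rightarrow> real. continuous_on UNIV f \<longrightarrow> (\<lambda>j. \<integral>x. f x \<partial>N j) \<longlonglongrightarrow> (\<integral>x. f x \<partial>L))"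

lemma weak_limit_on_subseq:
  "weak_limit_on C N L \<Longrightarrow> strict_mono r \<Longrightarrow> weak_limit_on C (\<lambda>j. N (r j)) L"
  unfolding weak_limit_on_def using LIMSEQ_subseq_LIMSEQ by (fastforce simp: o_def)

text \<open>A single subsequence has to serve the measure and all matrix entries at once; induction
  refines it finitely often.\<close>

lemma family_weak_compact:
  fixes N :: "'i \<Rightarrow> nat \<Rightarrow> 'a::euclidean_space measure"
  assumes C: "compact C" "convex C" "C \<noteq> {}" and I: "finite I"
    and N: "\<And>i j. i \<in> I \<Longrightarrow> finite_measure (N i j)" "\<And>i j. i \<in> I \<Longrightarrow> sets (N i j) = sets borel"
      "\<And>i j. i \<in> I \<Longrightarrow> AE x in N i j. x \<in> C"
    and m: "\<And>i j. i \<in> I \<Longrightarrow> measure (N i j) UNIV \<le> m"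
  shows "\<exists>r L. strict_mono (r::nat \<Rightarrow> nat) \<and> (\<forall>i\<in>I. weak_limit_on C (\<lambda>j. N i (r j)) (L i))"
  using I N m
proof (induction I)
  case empty
  then show ?case using strict_mono_id by auto
next
  case (insert i I)
  then obtain r L where r: "strict_mono (r::nat \<Rightarrow> nat)" "\<And>k. k \<in> I \<Longrightarrow> weak_limit_on C (\<lambda>j. N k (r j)) (L k)"
    by (metis insertCI)
  obtain r' L' where r': "strict_mono (r'::nat \<Rightarrow> nat)" "finite_measure L'" "sets L' = sets borel" "AE x in L'. x \<in> C"
    "\<And>f :: 'a \<Rightarrow> real. continuous_on UNIV f \<Longrightarrow> (\<lambda>j. \<integral>x. f x \<partial>N i (r (r' j))) \<longlonglongrightarrow> (\<integral>x. f x \<partial>L')"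
    by (rule measure_weak_compact[OF C, of "\<lambda>j. N i (r j)" m]) (use insert.prems in blast)+
  show ?case
  proof (intro exI conjI ballI)
    show "strict_mono (r \<circ> r')" using r(1) r'(1) by (rule strict_mono_o)
    fix k assume k: "k \<in> insert i I"
    show "weak_limit_on C (\<lambda>j. N k ((r \<circ> r') j)) ((L(i := L')) k)"
    proof (cases "k = i")
      case True
      then show ?thesis using r' by (simp add: weak_limit_on_def)
    next
      case False
      then show ?thesis using weak_limit_on_subseq[OF r(2) r'(1)] k by auto
    qed
  qed
qed

text \<open>Regularity squeezes \<open>A\<close> between a compact and an open set that are good for
  every \<open>N i\<close> simultaneously, and a Urysohn function in between replaces the indicator
  of \<open>A\<close>. The coefficients may have any sign, so this yields semidefiniteness as well
  as equality of measures.\<close>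

lemma combination_nonneg:
  fixes N :: "'i \<Rightarrow> 'a::euclidean_space measure"
  assumes I: "finite I" and N: "\<And>i. i \<in> I \<Longrightarrow> finite_measure (N i)" "\<And>i. i \<in> I \<Longrightarrow> sets (N i) = sets borel"
    and pos: "\<And>\<phi>. continuous_on UNIV \<phi> \<Longrightarrow> (\<And>x. 0 \<le> \<phi> x \<and> \<phi> x \<le> 1) \<Longrightarrow> 0 \<le> (\<Sum>i\<in>I. c i * (\<integral>x. \<phi> x \<partial>N i))"
    and A: "A \<in> sets borel"
  shows "0 \<le> (\<Sum>i\<in>I. c i * measure (N i) A)"
proof (rule field_le_epsilon)
  fix e0 :: real assume e0: "e0 > 0"
  \<comment> \<open>Each integral misses the measure of \<open>A\<close> by at most
    \<open>e\<close>, so the weighted sum is off by at most S e = e0; the summand 1 keeps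
    \<open>S\<close> positive.\<close>
  define S where "S = (\<Sum>i\<in>I. \<bar>c i\<bar>) + 1"
  have S: "S > 0" unfolding S_def by (intro add_nonneg_pos sum_nonneg) auto
  define e where "e = e0 / S"
  have e: "e > 0" using e0 S by (simp add: e_def)
  have KU: "\<exists>K U. K \<subseteq> A \<and> compact K \<and> A \<subseteq> U \<and> open U \<and> measure (N i) (U - K) \<le> e" if i: "i \<in> I" for i
  proof -
    interpret finite_measure "N i" by (rule N(1)[OF i])
    have sets: "sets (N i) = sets borel" by (rule N(2)[OF i])
    have "emeasure (N i) A < emeasure (N i) A + ennreal (e/2)"
      using e by (simp add: emeasure_eq_measure ennreal_plus[symmetric] ennreal_less_iff del: ennreal_plus)
    then have "(INF U \<in> {U. A \<subseteq> U \<and> open U}. emeasure (N i) U) < emeasure (N i) A + ennreal (e/2)"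
      using outer_regular[OF sets _ A] by simp
    then obtain U where U: "A \<subseteq> U" "open U" "emeasure (N i) U < emeasure (N i) A + ennreal (e/2)"
      by (auto simp: INF_less_iff)
    have U': "measure (N i) U \<le> measure (N i) A + e/2"
      using U(3) e by (simp add: emeasure_eq_measure ennreal_plus[symmetric] ennreal_less_iff del: ennreal_plus)
    have "\<exists>K. K \<subseteq> A \<and> compact K \<and> measure (N i) A \<le> measure (N i) K + e/2"
    proof (rule ccontr)
      assume "\<not> ?thesis"
      then have "measure (N i) K \<le> measure (N i) A - e/2" if "K \<subseteq> A" "compact K" for K
        using that by force
      then have "emeasure (N i) K \<le> ennreal (measure (N i) A - e/2)" if "K \<subseteq> A" "compact K" for K
        using that by (simp add: emeasure_eq_measure ennreal_leI)
      then have "emeasure (N i) A \<le> ennreal (measure (N i) A - e/2)"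
        using inner_regular[OF sets _ A] by (auto intro!: SUP_least)
      moreover have "0 \<le> measure (N i) A - e/2"
        using \<open>\<And>K. K \<subseteq> A \<Longrightarrow> compact K \<Longrightarrow> measure (N i) K \<le> measure (N i) A - e/2\<close>[of "{}"] by simp
      ultimately have "measure (N i) A \<le> measure (N i) A - e/2"
        unfolding emeasure_eq_measure by (subst (asm) ennreal_le_iff) auto
      then show False using e by simp
    qed
    then obtain K where K: "K \<subseteq> A" "compact K" "measure (N i) A \<le> measure (N i) K + e/2" by blast
    have "measure (N i) (U - K) = measure (N i) U - measure (N i) K"
      using U K sets compact_imp_closed[OF K(2)] by (intro finite_measure_Diff) auto
    then show ?thesis using U K U' by (intro exI[of _ K] exI[of _ U]) auto
  qed
  then obtain K U where KU: "\<And>i. i \<in> I \<Longrightarrow> K i \<subseteq> A \<and> compact (K i) \<and> A \<subseteq> U i \<and> open (U i) \<and> measure (N i) (U i - K i) \<le> e"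
    by metis
  \<comment> \<open>A finite union of compact sets and a finite intersection of open sets: one pair
    that works for all indices.\<close>
  define K0 where "K0 = (\<Union>i\<in>I. K i)"
  define U0 where "U0 = (\<Inter>i\<in>I. U i)"
  have K0: "closed K0" "K0 \<subseteq> A" unfolding K0_def using KU I by (auto intro!: closed_UN compact_imp_closed)
  have U0: "open U0" "A \<subseteq> U0" unfolding U0_def using KU I by (auto intro!: open_INT)
  obtain \<phi> :: "'a \<Rightarrow> real" where \<phi>: "continuous_on UNIV \<phi>" "\<And>x. \<phi> x \<in> closed_segment 1 0"
    "\<And>x. x \<in> K0 \<Longrightarrow> \<phi> x = 1" "\<And>x. x \<in> - U0 \<Longrightarrow> \<phi> x = 0"
  proof (rule Urysohn[of K0 "- U0" "1::real" "0::real"])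
    show "closed K0" "closed (- U0)" "K0 \<inter> - U0 = {}" using K0 U0 by auto
  qed blast
  have \<phi>01: "0 \<le> \<phi> x \<and> \<phi> x \<le> 1" for x using \<phi>(2)[of x] by (simp add: closed_segment_eq_real_ivl)
  have "\<bar>(\<integral>x. \<phi> x \<partial>N i) - measure (N i) A\<bar> \<le> e" if i: "i \<in> I" for i
  proof -
    interpret finite_measure "N i" by (rule N(1)[OF i])
    have sets: "sets (N i) = sets borel" by (rule N(2)[OF i])
    have As: "A \<in> sets (N i)" using A sets by simp
    have sp: "space (N i) = UNIV" using sets_eq_imp_space_eq[OF sets] by simp
    have UK: "U0 - K0 \<in> sets (N i)" using K0 U0 sets by auto
    have \<phi>i: "integrable (N i) \<phi>"
      using borel_measurable_continuous_onI[OF \<phi>(1)] sets \<phi>01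
      by (intro integrable_const_bound[of _ 1]) (auto cong: measurable_cong_sets)
    have "\<bar>(\<integral>x. \<phi> x \<partial>N i) - measure (N i) A\<bar> = \<bar>\<integral>x. \<phi> x - indicator A x \<partial>N i\<bar>"
      using \<phi>i As by (subst Bochner_Integration.integral_diff) (auto simp: sp emeasure_eq_measure)
    also have "\<dots> \<le> (\<integral>x. \<bar>\<phi> x - indicator A x\<bar> \<partial>N i)" by (rule integral_abs_bound)
    also have "\<dots> \<le> (\<integral>x. indicator (U0 - K0) x \<partial>N i)"
    proof (rule integral_mono)
      show "integrable (N i) (\<lambda>x. \<bar>\<phi> x - indicator A x\<bar>)" using \<phi>i As by (auto simp: emeasure_eq_measure)
      show "integrable (N i) (indicator (U0 - K0) :: 'a \<Rightarrow> real)" using UK by (simp add: emeasure_eq_measure)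
      show "\<bar>\<phi> x - indicator A x\<bar> \<le> indicator (U0 - K0) x" for x
        using \<phi>01[of x] \<phi>(3)[of x] \<phi>(4)[of x] K0(2) U0(2) by (auto simp: indicator_def)
    qed
    also have "\<dots> = measure (N i) (U0 - K0)" using UK by (simp add: sp)
    also have "\<dots> \<le> measure (N i) (U i - K i)"
    proof (rule finite_measure_mono)
      show "U i - K i \<in> sets (N i)" unfolding sets using KU[OF i]
        by (intro sets.Diff borel_open borel_closed compact_imp_closed) auto
      show "U0 - K0 \<subseteq> U i - K i" using i by (auto simp: U0_def K0_def)
    qed
    also have "\<dots> \<le> e" using KU i by blast
    finally show ?thesis .
  qed
  then have "(\<Sum>i\<in>I. c i * (\<integral>x. \<phi> x \<partial>N i)) - (\<Sum>i\<in>I. c i * measure (N i) A) \<le> (\<Sum>i\<in>I. \<bar>c i\<bar> * e)"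
    unfolding sum_subtractf[symmetric] right_diff_distrib[symmetric]
    by (intro sum_mono) (metis abs_ge_self abs_ge_zero abs_mult mult_left_mono order_trans)
  also have "(\<Sum>i\<in>I. \<bar>c i\<bar> * e) \<le> e0"
  proof -
    have "(\<Sum>i\<in>I. \<bar>c i\<bar> * e) = (S - 1) * e" by (simp add: S_def sum_distrib_right)
    also have "\<dots> \<le> S * e" using e by (simp add: algebra_simps)
    also have "\<dots> = e0" using S by (simp add: e_def)
    finally show ?thesis .
  qed
  finally show "0 \<le> (\<Sum>i\<in>I. c i * measure (N i) A) + e0" using pos[OF \<phi>(1) \<phi>01] by linarith
qed

section \<open>Mollification\<close>

text \<open>Differentiation under the integral sign. The rule used has operator-valued derivatives,
  so the gradient enters as the functional \<open>blinfun_inner_right\<close>, and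
  \<open>integral_linear\<close> turns the integral back into a vector.\<close>

lemma integral_param_has_derivative:
  fixes \<phi> :: "'a::euclidean_space \<Rightarrow> 'b::euclidean_space \<Rightarrow> real" and G :: "'a \<Rightarrow> 'b \<Rightarrow> 'a"
  assumes d: "\<And>x t. ((\<lambda>x. \<phi> x t) has_derivative (\<lambda>w. G x t \<bullet> w)) (at x)"
    and c: "\<And>x. continuous_on UNIV (\<phi> x)"
    and G: "continuous_on UNIV (\<lambda>z. G (fst z) (snd z))"
  shows "((\<lambda>x. integral (cbox a b) (\<phi> x)) has_derivative (\<lambda>w. integral (cbox a b) (G x) \<bullet> w)) (at x)"
    "continuous_on UNIV (\<lambda>x. integral (cbox a b) (G x))"
proof -
  have Gx: "G x integrable_on cbox a b" for x
    by (intro integrable_continuous continuous_on_compose2[OF G, of _ "\<lambda>t. (x, t)", simplified] continuous_intros)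
  have "((\<lambda>x. integral (cbox a b) (\<phi> x)) has_derivative blinfun_apply (integral (cbox a b) (\<lambda>t. blinfun_inner_right (G x t)))) (at x within UNIV)"
  proof (rule leibniz_rule)
    show "((\<lambda>x. \<phi> x t) has_derivative blinfun_apply (blinfun_inner_right (G x t))) (at x within UNIV)" for x t
      using d[of t x] by (simp add: blinfun_inner_right.rep_eq)
    show "\<phi> x integrable_on cbox a b" for x
      by (intro integrable_continuous continuous_on_subset[OF c]) auto
    show "continuous_on (UNIV \<times> cbox a b) (\<lambda>(x, t). blinfun_inner_right (G x t))"
      unfolding case_prod_beta
      by (intro bounded_linear.continuous_on[OF bounded_linear_blinfun_inner_right] continuous_on_subset[OF G]) auto
  qed auto
  moreover have "integral (cbox a b) (\<lambda>t. blinfun_inner_right (G x t)) = blinfun_inner_right (integral (cbox a b) (G x))"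
    using integral_linear[OF Gx bounded_linear_blinfun_inner_right] by (simp add: o_def)
  ultimately show "((\<lambda>x. integral (cbox a b) (\<phi> x)) has_derivative (\<lambda>w. integral (cbox a b) (G x) \<bullet> w)) (at x)"
    by (simp add: blinfun_inner_right.rep_eq)
  show "continuous_on UNIV (\<lambda>x. integral (cbox a b) (G x))"
    by (rule integral_continuous_on_param) (use continuous_on_subset[OF G] in \<open>auto simp: case_prod_beta\<close>)
qed

text \<open>A C^1 kernel supported in the ball of radius \<open>h\<close>. One derivative suffices,
  because the function to be smoothed is C^1 itself and supplies the other.\<close>

definition bump :: "real \<Rightarrow> real^'n \<Rightarrow> real" where
  "bump h v = (max 0 (h\<^sup>2 - v \<bullet> v))\<^sup>2"

lemma DERIV_pos_part_sq: "((\<lambda>s::real. (max 0 s)\<^sup>2) has_real_derivative 2 * max 0 s) (at s)"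
proof -
  \<comment> \<open>Isolates the only term that is not polynomial; at 0 its difference quotient is
    |h|, which tends to 0.\<close>
  have eq: "(max 0 s)\<^sup>2 = (s * \<bar>s\<bar> + s\<^sup>2) / 2" for s :: real
    by (auto simp: max_def power2_eq_square abs_if)
  have "((\<lambda>s::real. s * \<bar>s\<bar>) has_real_derivative 2 * \<bar>s\<bar>) (at s)"
  proof (cases "s = 0")
    case True
    have "((\<lambda>h::real. \<bar>h\<bar>) \<longlongrightarrow> 0) (at 0)" by (intro tendsto_eq_intros) auto
    then have "((\<lambda>h::real. (h * \<bar>h\<bar>) / h) \<longlongrightarrow> 0) (at 0)"
      by (rule Lim_transform_eventually) (auto simp: eventually_at_filter)
    then show ?thesis using True by (simp add: DERIV_def)
  next
    case False
    have "((\<lambda>s::real. s * \<bar>s\<bar>) has_real_derivative s * sgn s + \<bar>s\<bar>) (at s)"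
    proof (cases "s > 0")
      case True
      have "((\<lambda>s::real. s * s) has_real_derivative s + s) (at s)" by (auto intro!: derivative_eq_intros)
      moreover have "\<forall>\<^sub>F x in nhds s. x * x = x * \<bar>x\<bar>"
        using eventually_nhds_in_open[OF open_greaterThan, of s 0] True by (auto elim!: eventually_mono)
      ultimately have "((\<lambda>s::real. s * \<bar>s\<bar>) has_real_derivative s + s) (at s)"
        by (subst (asm) DERIV_cong_ev[OF refl _ refl]) auto
      then show ?thesis using True by simp
    next
      case F: False
      have "((\<lambda>s::real. - (s * s)) has_real_derivative - (s + s)) (at s)" by (auto intro!: derivative_eq_intros)
      moreover have "\<forall>\<^sub>F x in nhds s. - (x * x) = x * \<bar>x\<bar>"
        using eventually_nhds_in_open[OF open_lessThan, of s 0] False F by (auto elim!: eventually_mono)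
      ultimately have "((\<lambda>s::real. s * \<bar>s\<bar>) has_real_derivative - (s + s)) (at s)"
        by (subst (asm) DERIV_cong_ev[OF refl _ refl]) auto
      then show ?thesis using False F by simp
    qed
    moreover have "s * sgn s + \<bar>s\<bar> = 2 * \<bar>s\<bar>" by (simp add: abs_sgn mult.commute)
    ultimately show ?thesis by simp
  qed
  moreover have "((\<lambda>s::real. s\<^sup>2) has_real_derivative 2 * s) (at s)"
    by (auto intro!: derivative_eq_intros)
  ultimately have "((\<lambda>s::real. (s * \<bar>s\<bar> + s\<^sup>2) / 2) has_real_derivative (2 * \<bar>s\<bar> + 2 * s) / 2) (at s)"
    by (intro DERIV_cdivide DERIV_add)
  moreover have "(2 * \<bar>s\<bar> + 2 * s) / 2 = 2 * max 0 s" by (auto simp: max_def)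
  ultimately show ?thesis unfolding eq by simp
qed

lemma bump_has_derivative:
  "(bump h has_derivative (\<lambda>w. ((- 4 * max 0 (h\<^sup>2 - v \<bullet> v)) *\<^sub>R v) \<bullet> w)) (at v)"
proof -
  have 1: "((\<lambda>v. h\<^sup>2 - v \<bullet> v) has_derivative (\<lambda>w. - (2 * (v \<bullet> w)))) (at v)"
    by (auto intro!: derivative_eq_intros simp: inner_commute)
  have "((\<lambda>v. (max 0 (h\<^sup>2 - v \<bullet> v))\<^sup>2) has_derivative (\<lambda>w. 2 * max 0 (h\<^sup>2 - v \<bullet> v) * (- (2 * (v \<bullet> w))))) (at v)"
    using has_derivative_compose[OF 1 DERIV_pos_part_sq[unfolded has_field_derivative_def]] by simp
  then show ?thesis by (simp add: bump_def[abs_def] algebra_simps)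
qed

lemma bump_continuous: "continuous_on UNIV (bump h)"
  unfolding bump_def[abs_def] by (intro continuous_intros)

lemma bump_support:
  assumes "0 < h" "h \<le> norm v" shows "bump h v = 0"
  using assms power_mono[of h "norm v" 2] by (simp add: bump_def power2_norm_eq_inner)

lemma compact_support_integral:
  fixes \<phi> :: "real^'n \<Rightarrow> real"
  assumes c: "continuous_on UNIV \<phi>" and s: "\<And>x. x \<notin> cbox a b \<Longrightarrow> \<phi> x = 0"
  shows "integral (cbox a b) \<phi> = (\<integral>x. \<phi> x \<partial>lborel)"
proof -
  have "integrable lborel (\<lambda>x. indicator (cbox a b) x *\<^sub>R \<phi> x)"
    by (rule borel_integrable_compact) (auto intro: continuous_on_subset[OF c])
  moreover have "(\<lambda>x. indicator (cbox a b) x *\<^sub>R \<phi> x) = \<phi>"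
    using s by (auto simp: indicator_def fun_eq_iff)
  ultimately have "integrable lborel \<phi>" by simp
  then have "integral UNIV \<phi> = (\<integral>x. \<phi> x \<partial>lborel)" by (rule integral_lborel)
  moreover have "integral (cbox a b) \<phi> = integral UNIV (\<lambda>x. if x \<in> cbox a b then \<phi> x else 0)"
    by (rule integral_restrict_UNIV[symmetric])
  moreover have "(\<lambda>x. if x \<in> cbox a b then \<phi> x else 0) = \<phi>" using s by auto
  ultimately show ?thesis by simp
qed

text \<open>Convolution with the kernel without normalisation; the constant is divided out where the
  approximation is built. For h \<le> 1 the cube contains the support of the kernel.\<close>

definition mollify :: "real \<Rightarrow> (real^'n \<Rightarrow> real) \<Rightarrow> real^'n \<Rightarrow> real" where
  "mollify h f x = integral (cbox (vec (-1)) (vec 1)) (\<lambda>t. bump h t * f (x + t))"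

text \<open>Moves the variable \<open>x\<close> from \<open>f\<close> into the kernel, where it can
  be differentiated even if \<open>f\<close> is merely continuous. The domain no longer depends on
  \<open>x\<close>: the kernel lives within distance 2 of \<open>x0\<close>, inside the cube of
  half-width 3.\<close>

lemma mollify_shift:
  fixes f :: "real^'n \<Rightarrow> real"
  assumes f: "continuous_on UNIV f" and h: "0 < h" "h \<le> 1" and x: "dist x x0 < 1"
  shows "mollify h f x = integral (cbox (x0 - vec 3) (x0 + vec 3)) (\<lambda>z. f z * bump h (z - x))"
proof -
  define F where "F z = f z * bump h (z - x)" for z
  have Fc: "continuous_on UNIV F" unfolding F_def
    by (intro continuous_intros f continuous_on_compose2[OF bump_continuous]) auto
  have Fm: "F \<in> borel_measurable borel" by (rule borel_measurable_continuous_onI[OF Fc])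
  have cc: "continuous_on UNIV (\<lambda>t. bump h t * f (x + t))"
    by (intro continuous_intros bump_continuous continuous_on_compose2[OF f]) auto
  have "mollify h f x = (\<integral>t. bump h t * f (x + t) \<partial>lborel)"
    unfolding mollify_def
  proof (rule compact_support_integral[OF cc])
    fix t :: "real^'n" assume "t \<notin> cbox (vec (-1)) (vec 1)"
    then obtain i where "1 < \<bar>t $ i\<bar>" unfolding mem_box_cart by (auto simp: not_le) (smt (verit))+
    then have "h \<le> norm t" using component_le_norm_cart[of t i] h by linarith
    then show "bump h t * f (x + t) = 0" using bump_support[OF h(1), of t] by simp
  qed
  also have "\<dots> = (\<integral>t. F (x + t) \<partial>lborel)" by (simp add: F_def mult.commute)
  also have "\<dots> = (\<integral>z. F z \<partial>distr lborel borel ((+) x))"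
    by (rule integral_distr[symmetric]) (use Fm in auto)
  also have "\<dots> = (\<integral>z. F z \<partial>lborel)" by (simp add: lborel_distr_plus)
  also have "\<dots> = integral (cbox (x0 - vec 3) (x0 + vec 3)) F"
  proof (rule compact_support_integral[OF Fc, symmetric])
    fix z assume "z \<notin> cbox (x0 - vec 3) (x0 + vec 3)"
    then obtain i where "\<not> (x0 $ i - 3 \<le> z $ i \<and> z $ i \<le> x0 $ i + 3)" unfolding mem_box_cart by auto
    then have "3 < \<bar>(z - x0) $ i\<bar>" by (simp add: abs_if split: if_splits) linarith
    then have "3 < norm (z - x0)" using component_le_norm_cart[of "z - x0" i] by linarith
    moreover have "norm (z - x0) \<le> norm (z - x) + norm (x - x0)" using norm_triangle_ineq[of "z - x" "x - x0"] by simp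
    ultimately have "h \<le> norm (z - x)" using x h by (simp add: dist_norm)
    then show "F z = 0" using bump_support[OF h(1), of "z - x"] by (simp add: F_def)
  qed
  finally show ?thesis unfolding F_def .
qed

lemma mollify_C1:
  fixes f :: "real^'n \<Rightarrow> real"
  assumes f: "continuous_on UNIV f" and h: "0 < h" "h \<le> 1"
  shows "Ck (Suc 0) (mollify h f)"
proof -
  define G where "G x z = (4 * f z * max 0 (h\<^sup>2 - (z - x) \<bullet> (z - x))) *\<^sub>R (z - x)" for x z
  have d: "((\<lambda>x. f z * bump h (z - x)) has_derivative (\<lambda>w. G x z \<bullet> w)) (at x)" for x z
  proof -
    have "((\<lambda>x. z - x) has_derivative (\<lambda>w. - w)) (at x)" by (auto intro!: derivative_eq_intros)
    from has_derivative_compose[OF this bump_has_derivative]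
    have "((\<lambda>x. f z * bump h (z - x)) has_derivative (\<lambda>w. f z * (((- 4 * max 0 (h\<^sup>2 - (z - x) \<bullet> (z - x))) *\<^sub>R (z - x)) \<bullet> (- w)))) (at x)"
      by (rule has_derivative_mult_right)
    then show ?thesis by (simp add: G_def mult_ac)
  qed
  have c: "continuous_on UNIV (\<lambda>z. f z * bump h (z - x))" for x
    by (intro continuous_intros f continuous_on_compose2[OF bump_continuous]) auto
  have Gc: "continuous_on UNIV (\<lambda>z. G (fst z) (snd z))"
    unfolding G_def by (intro continuous_intros continuous_on_compose2[OF f]) auto
  \<comment> \<open>The gradient formula is local, with domain centred at \<open>x0\<close>. By
    uniqueness of derivatives \<open>D x0 x\<close> and \<open>D x x\<close> agree near
    \<open>x0\<close>, which makes the diagonal continuous.\<close>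
  define D where "D x0 x = integral (cbox (x0 - vec 3) (x0 + vec 3)) (G x)" for x0 x
  have D: "(mollify h f has_derivative (\<lambda>w. D x0 x \<bullet> w)) (at x)" if x: "dist x x0 < 1" for x x0
  proof -
    have "((\<lambda>x. integral (cbox (x0 - vec 3) (x0 + vec 3)) (\<lambda>z. f z * bump h (z - x))) has_derivative (\<lambda>w. D x0 x \<bullet> w)) (at x)"
      unfolding D_def by (rule integral_param_has_derivative(1)[OF d c Gc])
    then show ?thesis
    proof (rule has_derivative_transform_within_open)
      show "open (ball x0 1)" by simp
      show "x \<in> ball x0 1" using x by (simp add: dist_commute)
      show "integral (cbox (x0 - vec 3) (x0 + vec 3)) (\<lambda>z. f z * bump h (z - y)) = mollify h f y" if "y \<in> ball x0 1" for y
        using that by (intro mollify_shift[OF f h, symmetric]) (simp add: dist_commute)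
    qed
  qed
  have Dc: "continuous_on UNIV (D x0)" for x0
    unfolding D_def by (rule integral_param_has_derivative(2)[OF d c Gc])
  have "continuous_on UNIV (\<lambda>x. D x x \<bullet> w)" for w
  proof (rule continuous_at_imp_continuous_on, rule ballI)
    fix x0 :: "real^'n"
    have eq: "D x0 x \<bullet> w = D x x \<bullet> w" if "x \<in> ball x0 1" for x
      using has_derivative_unique[OF D[of x x0] D[of x x]] that by (metis dist_commute dist_self mem_ball zero_less_one)
    have "isCont (\<lambda>x. D x0 x \<bullet> w) x0"
      using Dc[of x0] by (intro continuous_intros) (simp add: continuous_on_eq_continuous_at)
    moreover have "\<forall>\<^sub>F x in nhds x0. D x0 x \<bullet> w = D x x \<bullet> w"
      using eventually_nhds_in_open[of "ball x0 1" x0] eq by (auto elim!: eventually_mono)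
    ultimately show "isCont (\<lambda>x. D x x \<bullet> w) x0" by (simp add: isCont_cong)
  qed
  then show ?thesis
    by (intro Ck_SucI[where f'="\<lambda>w x. D x x \<bullet> w"] D) auto
qed

text \<open>The first derivative falls on \<open>f\<close> and leaves a mollified continuous
  function, the second then falls on the kernel.\<close>

lemma mollify_deriv:
  fixes f :: "real^'n \<Rightarrow> real"
  assumes f: "Ck (Suc 0) f" and h: "0 < h" "h \<le> 1"
  shows "Ck 2 (mollify h f)" "grad (mollify h f) x $ i = mollify h (\<lambda>y. grad f y $ i) x"
proof -
  have gc: "continuous_on UNIV (grad f)" using f by (rule grad_continuous)
  have gi: "continuous_on UNIV (\<lambda>y. grad f y $ i)" for i using gc by (rule continuous_on_component)
  define G where "G x t = bump h t *\<^sub>R grad f (x + t)" for x t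
  have d: "((\<lambda>x. bump h t * f (x + t)) has_derivative (\<lambda>w. G x t \<bullet> w)) (at x)" for x t
  proof -
    have "((\<lambda>x. x + t) has_derivative (\<lambda>w. w)) (at x)" by (auto intro!: derivative_eq_intros)
    from has_derivative_compose[OF this grad_has_derivative[OF f]]
    have "((\<lambda>x. bump h t * f (x + t)) has_derivative (\<lambda>w. bump h t * (grad f (x + t) \<bullet> w))) (at x)"
      by (rule has_derivative_mult_right)
    then show ?thesis by (simp add: G_def)
  qed
  have c: "continuous_on UNIV (\<lambda>t. bump h t * f (x + t))" for x
    by (intro continuous_intros bump_continuous continuous_on_compose2[OF Ck_continuous[OF f]]) auto
  have Gc: "continuous_on UNIV (\<lambda>z. G (fst z) (snd z))"
    unfolding G_def by (intro continuous_intros continuous_on_compose2[OF bump_continuous] continuous_on_compose2[OF gc]) auto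
  have D: "(mollify h f has_derivative (\<lambda>w. integral (cbox (vec (-1)) (vec 1)) (G x) \<bullet> w)) (at x)" for x
    unfolding mollify_def[abs_def] by (rule integral_param_has_derivative(1)[OF d c Gc])
  have Gx: "G x integrable_on cbox (vec (-1)) (vec 1)" for x
    by (intro integrable_continuous continuous_on_compose2[OF Gc, of _ "\<lambda>t. (x, t)", simplified] continuous_intros)
  have comp: "integral (cbox (vec (-1)) (vec 1)) (G x) $ i = mollify h (\<lambda>y. grad f y $ i) x" for x i
    using integral_linear[OF Gx bounded_linear_vec_nth] by (simp add: o_def G_def mollify_def)
  show "grad (mollify h f) x $ i = mollify h (\<lambda>y. grad f y $ i) x"
  proof -
    have "grad (mollify h f) x $ i = dderiv (mollify h f) (axis i 1) x" by (simp add: grad_def)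
    then show ?thesis unfolding dderiv_eq[OF D] by (simp add: inner_axis comp[simplified])
  qed
  have D': "(mollify h f has_derivative (\<lambda>w. \<Sum>i\<in>UNIV. mollify h (\<lambda>y. grad f y $ i) x * w $ i)) (at x)" for x
    using D[of x] unfolding inner_vec_def inner_real_def comp .
  have "Ck (Suc (Suc 0)) (mollify h f)"
    by (rule Ck_SucI[OF D']) (intro Ck_sum Ck_mult Ck_const mollify_C1 gi h)
  then show "Ck 2 (mollify h f)" by (simp only: numeral_2_eq_2)
qed

text \<open>The gradient of the normalised mollification averages \<open>grad f\<close> over a ball
  of radius \<open>h\<close>, and by periodicity \<open>grad f\<close> is uniformly
  continuous.\<close>

lemma C1_approx_C2:
  fixes f :: "real^'n \<Rightarrow> real"
  assumes f: "Ck (Suc 0) f" and p: "periodic f" and e: "e > 0"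
  obtains g where "Ck 2 g" "periodic g" "\<And>x. norm (grad g x - grad f x) \<le> e"
proof -
  let ?B = "cbox (vec (-1)) (vec 1) :: (real^'n) set"
  have gc: "continuous_on UNIV (grad f)" using f by (rule grad_continuous)
  have gi: "continuous_on UNIV (\<lambda>y. grad f y $ i)" for i using gc by (rule continuous_on_component)
  have "e / real CARD('n) > 0" using e by simp
  then obtain d where d: "d > 0" "\<And>x y. dist x y < d \<Longrightarrow> dist (grad f x) (grad f y) < e / real CARD('n)"
    using periodic_uniformly_continuous[OF grad_periodic[OF p f] gc] unfolding uniformly_continuous_on_def by (metis UNIV_I)
  define h where "h = min d 1"
  have h: "0 < h" "h \<le> 1" "h \<le> d" using d by (auto simp: h_def)
  have bi: "bump h integrable_on ?B"
    by (intro integrable_continuous continuous_on_subset[OF bump_continuous]) auto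
  define c where "c = integral ?B (bump h)"
  have "c \<ge> 0" unfolding c_def by (rule integral_nonneg[OF bi]) (simp add: bump_def)
  \<comment> \<open>A nonnegative continuous function with zero integral would vanish at the origin,
    where the kernel equals h^4.\<close>
  moreover have "c \<noteq> 0"
  proof
    assume "c = 0"
    then have "(bump h has_integral 0) ?B" using bi by (simp add: c_def has_integral_integral[symmetric] integrable_integral)
         (metis bi integrable_integral)
    then have "bump h (0::real^'n) = 0"
    proof (rule has_integral_0_cbox_imp_0[rotated 2])
      show "continuous_on ?B (bump h)" by (rule continuous_on_subset[OF bump_continuous]) simp
      show "box (vec (-1)) (vec 1 :: real^'n) \<noteq> {}" by (auto simp: interval_ne_empty_cart)
      show "0 \<in> ?B" by (simp add: mem_box_cart)
    qed (simp add: bump_def)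
    then show False using h(1) by (simp add: bump_def)
  qed
  ultimately have c: "c > 0" by simp
  define g where "g x = (1 / c) * mollify h f x" for x
  have m2: "Ck 2 (mollify h f)" by (rule mollify_deriv[OF f h(1,2)])
  have m1: "Ck (Suc 0) (mollify h f)" using m2 Ck_Suc_imp by (simp only: numeral_2_eq_2)
  show ?thesis
  proof (rule that)
    show "Ck 2 g" unfolding g_def by (intro Ck_mult Ck_const m2)
    show "periodic g"
      unfolding periodic_def g_def mollify_def
    proof (intro allI impI)
      fix x k :: "real^'n" assume k: "int_vec k"
      have "f (x + k + t) = f (x + t)" for t
        using p k unfolding periodic_def by (metis add.assoc add.commute)
      then show "1 / c * integral ?B (\<lambda>t. bump h t * f (x + k + t)) = 1 / c * integral ?B (\<lambda>t. bump h t * f (x + t))" by simp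
    qed
    fix x
    have gg: "grad g x $ i = (1 / c) * mollify h (\<lambda>y. grad f y $ i) x" for i
    proof -
      have "(g has_derivative (\<lambda>v. (1 / c) * dderiv (mollify h f) v x)) (at x)"
        unfolding g_def[abs_def] by (intro has_derivative_mult_right Ck_has_derivative[OF m1])
      from dderiv_eq[OF this] have "grad g x $ i = (1 / c) * grad (mollify h f) x $ i" by (simp add: grad_def)
      then show ?thesis by (simp only: mollify_deriv(2)[OF f h(1,2)])
    qed
    have comp: "\<bar>grad g x $ i - grad f x $ i\<bar> \<le> e / real CARD('n)" for i
    proof -
      have i1: "(\<lambda>t. bump h t * grad f (x + t) $ i) integrable_on ?B"
        by (intro integrable_continuous continuous_intros continuous_on_subset[OF bump_continuous] continuous_on_compose2[OF gi]) auto
      have i2: "(\<lambda>t. bump h t * grad f x $ i) integrable_on ?B" by (rule integrable_on_mult_left[OF bi])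
      have "c * (grad g x $ i - grad f x $ i) = integral ?B (\<lambda>t. bump h t * grad f (x + t) $ i) - integral ?B (\<lambda>t. bump h t * grad f x $ i)"
        using c by (simp add: gg mollify_def right_diff_distrib c_def)
      also have "\<dots> = integral ?B (\<lambda>t. bump h t * grad f (x + t) $ i - bump h t * grad f x $ i)"
        by (rule integral_diff[OF i1 i2, symmetric])
      also have "\<bar>\<dots>\<bar> \<le> integral ?B (\<lambda>t. bump h t * (e / real CARD('n)))"
        unfolding real_norm_def[symmetric]
      proof (rule integral_norm_bound_integral)
        show "(\<lambda>t. bump h t * grad f (x + t) $ i - bump h t * grad f x $ i) integrable_on ?B" by (rule integrable_diff[OF i1 i2])
        show "(\<lambda>t. bump h t * (e / real CARD('n))) integrable_on ?B" by (rule integrable_on_mult_left[OF bi])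
        fix t :: "real^'n"
        have b0: "0 \<le> bump h t" by (simp add: bump_def)
        show "norm (bump h t * grad f (x + t) $ i - bump h t * grad f x $ i) \<le> bump h t * (e / real CARD('n))"
        proof (cases "norm t < h")
          case True
          have "\<bar>(grad f (x + t) - grad f x) $ i\<bar> \<le> norm (grad f (x + t) - grad f x)" by (rule component_le_norm_cart)
          also have "\<dots> \<le> e / real CARD('n)" using d(2)[of "x + t" x] True h(3) by (simp add: dist_norm)
          finally have "bump h t * \<bar>(grad f (x + t) - grad f x) $ i\<bar> \<le> bump h t * (e / real CARD('n))" using b0 by (rule mult_left_mono)
          then show ?thesis using b0 by (simp add: right_diff_distrib[symmetric] abs_mult)
        next
          case False
          then show ?thesis using bump_support[OF h(1), of t] by simp
        qed
      qed
      also have "\<dots> = c * (e / real CARD('n))" by (simp add: c_def)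
      finally have "c * \<bar>grad g x $ i - grad f x $ i\<bar> \<le> c * (e / real CARD('n))" using c by (simp add: abs_mult)
      then show ?thesis using c by (rule mult_left_le_imp_le)
    qed
    have "norm (grad g x - grad f x) \<le> (\<Sum>i\<in>UNIV. \<bar>(grad g x - grad f x) $ i\<bar>)" by (rule norm_le_l1_cart)
    also have "\<dots> \<le> (\<Sum>i\<in>(UNIV::'n set). e / real CARD('n))" using comp by (intro sum_mono) simp
    also have "\<dots> = e" by simp
    finally show "norm (grad g x - grad f x) \<le> e" .
  qed
qed

section \<open>Energy estimates and integral identities\<close>

lemma integrable_compact_AE:
  fixes f :: "'a::euclidean_space \<Rightarrow> real"
  assumes N: "finite_measure N" "sets N = sets borel" "AE x in N. x \<in> C" and C: "compact C" and f: "continuous_on UNIV f"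
  shows "integrable N f"
proof -
  interpret finite_measure N by fact
  have "compact (f ` C)" by (rule compact_continuous_image[OF continuous_on_subset[OF f] C]) simp
  then obtain B where B: "\<And>x. x \<in> C \<Longrightarrow> norm (f x) \<le> B" using compact_imp_bounded by (force simp: bounded_iff)
  show ?thesis
  proof (rule integrable_const_bound[of _ B])
    show "AE x in N. norm (f x) \<le> B" using N(3) by eventually_elim (rule B)
    show "f \<in> borel_measurable N" using borel_measurable_continuous_onI[OF f] N(2) by (simp cong: measurable_cong_sets)
  qed
qed

text \<open>The closed cube, not \<open>fund_dom\<close>: extraction of weak limits requires a
  compact convex set.\<close>

definition cell_box :: "real \<Rightarrow> ((real^'n) \<times> (real^'n)) set" where
  "cell_box R = cbox 0 1 \<times> cball 0 R"

lemma cell_box: "compact (cell_box R)" "convex (cell_box R)" "0 \<le> R \<Longrightarrow> cell_box R \<noteq> {}"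
  unfolding cell_box_def by (auto intro!: compact_Times convex_Times simp: interval_ne_empty_cart)

lemma second_derivatives_continuous:
  assumes "Ck 2 \<Phi>"
  shows "continuous_on UNIV (\<lambda>z. dderiv (\<lambda>z. dderiv \<Phi> v z) w z)"
  using assms Ck_continuous[OF Ck_dderiv[OF Ck_dderiv]] by (simp only: numeral_2_eq_2)

lemma dpp_sym:
  fixes F :: "real^'n \<Rightarrow> real^'n \<Rightarrow> real"
  assumes "Ck 2 (\<lambda>z. F (fst z) (snd z))"
  shows "dpp F k j x p = dpp F j k x p"
  unfolding dpp_eq[OF assms] by (rule dderiv_commute[OF assms])

lemma dpp_continuous:
  fixes F :: "real^'n \<Rightarrow> real^'n \<Rightarrow> real"
  assumes "Ck 2 (\<lambda>z. F (fst z) (snd z))"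
  shows "continuous_on UNIV (\<lambda>z. dpp F k j (fst z) (snd z))"
  using second_derivatives_continuous[OF assms] by (simp add: dpp_eq[OF assms])

lemma poisson_continuous:
  fixes F G :: "real^'n \<Rightarrow> real^'n \<Rightarrow> real"
  assumes F: "Ck (Suc k) (\<lambda>z. F (fst z) (snd z))" and G: "Ck (Suc m) (\<lambda>z. G (fst z) (snd z))"
  shows "continuous_on UNIV (\<lambda>z. poisson F G (fst z) (snd z))"
  unfolding poisson_def by (intro continuous_intros gradp_continuous[OF F] gradp_continuous[OF G])

definition hess_sq :: "(real^'n \<Rightarrow> real) \<Rightarrow> real^'n \<Rightarrow> real" where
  "hess_sq u x = (\<Sum>k\<in>UNIV. \<Sum>i\<in>UNIV. (hess u x $ k $ i)^2)"

lemma hess_sq_nonneg: "0 \<le> hess_sq u x" unfolding hess_sq_def by (intro sum_nonneg) simp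

text \<open>An entry of the Gram matrix of the rows of D^2 u. With the factor \<epsilon>^2 / 2 it is
  the density whose weak limits become the matrix of measures.\<close>

definition hess_gram :: "(real^'n \<Rightarrow> real) \<Rightarrow> 'n \<Rightarrow> 'n \<Rightarrow> real^'n \<Rightarrow> real" where
  "hess_gram u k l x = (\<Sum>i\<in>UNIV. hess u x $ k $ i * hess u x $ l $ i)"

lemma hess_gram_sym: "hess_gram u k l = hess_gram u l k"
  by (simp add: hess_gram_def fun_eq_iff mult.commute)

lemma hess_gram_bound: "\<bar>hess_gram u k l x\<bar> \<le> hess_sq u x"
proof -
  let ?a = "\<lambda>k i. hess u x $ k $ i"
  have ab: "\<bar>a * b\<bar> \<le> a\<^sup>2 / 2 + b\<^sup>2 / 2" for a b :: real
    using zero_le_power2[of "\<bar>a\<bar> - \<bar>b\<bar>"] by (simp add: power2_diff abs_mult)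
  have row: "(\<Sum>i\<in>UNIV. (?a k i)\<^sup>2) \<le> hess_sq u x" for k
    unfolding hess_sq_def by (rule member_le_sum[where f="\<lambda>k. \<Sum>i\<in>UNIV. (?a k i)\<^sup>2"]) (auto intro: sum_nonneg)
  have "\<bar>hess_gram u k l x\<bar> \<le> (\<Sum>i\<in>UNIV. (?a k i)\<^sup>2 / 2 + (?a l i)\<^sup>2 / 2)"
    unfolding hess_gram_def by (rule order_trans[OF sum_abs sum_mono[OF ab]])
  also have "\<dots> = (\<Sum>i\<in>UNIV. (?a k i)\<^sup>2) / 2 + (\<Sum>i\<in>UNIV. (?a l i)\<^sup>2) / 2"
    by (simp add: sum.distrib sum_divide_distrib)
  finally show ?thesis using row[of k] row[of l] by linarith
qed

text \<open>The quadratic form is the squared length of the combination of the rows of D^2 u with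
  weights \<xi>.\<close>

lemma hess_gram_psd: "0 \<le> (\<Sum>k\<in>UNIV. \<Sum>l\<in>UNIV. \<xi> $ k * \<xi> $ l * hess_gram u k l x)" for \<xi> :: "real^'n"
proof -
  have "(\<Sum>k\<in>UNIV. \<Sum>l\<in>UNIV. \<xi> $ k * \<xi> $ l * hess_gram u k l x)
     = (\<Sum>k\<in>UNIV. \<Sum>i\<in>UNIV. \<Sum>l\<in>UNIV. \<xi> $ k * \<xi> $ l * (hess u x $ k $ i * hess u x $ l $ i))"
    unfolding hess_gram_def sum_distrib_left by (rule sum.cong[OF refl], rule sum.swap)
  also have "\<dots> = (\<Sum>i\<in>UNIV. \<Sum>k\<in>UNIV. \<Sum>l\<in>UNIV. \<xi> $ k * \<xi> $ l * (hess u x $ k $ i * hess u x $ l $ i))"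
    by (rule sum.swap)
  also have "\<dots> = (\<Sum>i\<in>UNIV. (\<Sum>k\<in>UNIV. \<xi> $ k * hess u x $ k $ i)\<^sup>2)"
    by (simp add: power2_eq_square sum_product mult_ac)
  finally show ?thesis by (simp add: sum_nonneg)
qed

lemma hess_gram_continuous:
  assumes "Ck 2 u"
  shows "continuous_on UNIV (hess_gram u k l)" "continuous_on UNIV (hess_sq u)"
  unfolding hess_gram_def[abs_def] hess_sq_def[abs_def]
  by (intro continuous_on_sum continuous_on_mult continuous_on_power continuous_on_component hess_continuous assms)+

section \<open>Estimates and identities at one noise level\<close>

context ergodic_measure
begin

interpretation \<mu>: prob_space \<mu> by (rule \<mu>(2))

lemma u_C2: "Ck 2 u" using u by (simp add: smooth_def)

lemma AE_fund_dom: "AE z in \<mu>. fst z \<in> fund_dom"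
proof (rule AE_I)
  show "emeasure \<mu> (- (fund_dom \<times> UNIV)) = 0" using \<mu>(1) by (simp add: torus_measure_def)
  have "{x. \<forall>i. 0 \<le> x $ i \<and> x $ i < (1::real)} \<in> sets (borel :: (real^'n) measure)" by measurable
  then have "(fund_dom :: (real^'n) set) \<in> sets borel" by (simp add: fund_dom_def)
  then have "(fund_dom :: (real^'n) set) \<times> (UNIV :: (real^'n) set) \<in> sets borel"
    unfolding borel_prod[symmetric] by (intro pair_measureI) auto
  from sets.compl_sets[OF this] show "- (fund_dom \<times> UNIV) \<in> sets \<mu>"
    by (simp add: sets_\<mu> Compl_eq_Diff_UNIV)
qed auto

context
  fixes R :: real
  assumes R: "\<And>x. norm (P + grad u x) \<le> R"
begin

lemma AE_cell_box: "AE z in \<mu>. z \<in> cell_box R"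
  using AE_fund_dom \<mu>_graph
proof eventually_elim
  case (elim z)
  have "fst z \<in> cbox 0 1" using elim(1) by (auto simp: fund_dom_def mem_box_cart less_imp_le)
  moreover have "snd z \<in> cball 0 R" using elim(2) R by simp
  ultimately show ?case unfolding cell_box_def by (metis mem_Times_iff)
qed

lemma integrable_continuous_\<mu>: "continuous_on UNIV f \<Longrightarrow> integrable \<mu> (f :: _ \<Rightarrow> real)"
  by (rule integrable_compact_AE[OF \<mu>.finite_measure_axioms sets_\<mu> AE_cell_box cell_box(1)])

lemma integrable_continuous_fst:
  fixes f :: "real^'n \<Rightarrow> real"
  assumes f: "continuous_on UNIV f"
  shows "integrable \<mu> (\<lambda>z. f (fst z))"
proof (rule integrable_continuous_\<mu>)
  have "continuous_on UNIV (fst :: (real^'n) \<times> (real^'n) \<Rightarrow> real^'n)" by (intro continuous_intros)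
  then show "continuous_on UNIV (\<lambda>z::(real^'n) \<times> (real^'n). f (fst z))"
    using continuous_on_compose2[OF f] by blast
qed

lemma transport_identity:
  fixes F :: "real^'n \<Rightarrow> real^'n \<Rightarrow> real"
  assumes F: "Ck 2 (\<lambda>z. F (fst z) (snd z))" and Fp: "periodic_x F"
  shows "(\<integral>z. poisson F H (fst z) (P + grad u (fst z)) + \<epsilon>\<^sup>2 / 2 * diffusion_part u F (fst z) (P + grad u (fst z)) \<partial>\<mu>) = 0"
proof -
  have "Ck 2 (\<lambda>x. F x (P + grad u x))" using Ck_graph(2)[OF u F, of P] by simp
  from \<mu>_stationary[OF this periodic_graph[OF u up Fp]]
  show ?thesis unfolding generator_graph[OF H u cell F] .
qed

text \<open>Stationarity with the kinetic test function equates the Hessian energy with the integral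
  of - D_xH . p. The bound depends only on \<open>H\<close> and \<open>R\<close>, hence not on the
  noise level.\<close>

lemma hess_sq_energy:
  assumes Q: "\<And>z. z \<in> cell_box R \<Longrightarrow> \<bar>gradx H (fst z) (snd z) \<bullet> snd z\<bar> \<le> Q"
  shows "(\<integral>z. \<epsilon>\<^sup>2 / 2 * hess_sq u (fst z) \<partial>\<mu>) \<le> Q"
proof -
  have Hk: "Ck k (\<lambda>z. H (fst z) (snd z))" for k using H by (simp add: smooth_def)
  let ?q = "\<lambda>z. gradx H (fst z) (snd z) \<bullet> snd z"
  have qc: "continuous_on UNIV ?q"
    by (intro continuous_intros gradp_continuous(2)[OF Hk[of "Suc 0"]])
  have pc: "continuous_on UNIV (\<lambda>z. (fst z, P + grad u (fst z)))"
    by (intro continuous_intros continuous_on_compose2[OF grad_u_continuous]) auto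
  have qg: "integrable \<mu> (\<lambda>z. gradx H (fst z) (P + grad u (fst z)) \<bullet> (P + grad u (fst z)))"
    using integrable_continuous_\<mu>[OF continuous_on_compose2[OF qc pc]] by simp
  have hi: "integrable \<mu> (\<lambda>z. \<epsilon>\<^sup>2 / 2 * hess_sq u (fst z))"
    by (intro integrable_mult_right integrable_continuous_fst hess_gram_continuous u_C2)
  have "(\<integral>z. gradx H (fst z) (P + grad u (fst z)) \<bullet> (P + grad u (fst z)) + \<epsilon>\<^sup>2 / 2 * hess_sq u (fst z) \<partial>\<mu>) = 0"
    using transport_identity[OF kinetic_derivatives(3)]
    unfolding kinetic_parts hess_sq_def by (simp add: periodic_x_def kinetic_def)
  then have "(\<integral>z. \<epsilon>\<^sup>2 / 2 * hess_sq u (fst z) \<partial>\<mu>) = - (\<integral>z. gradx H (fst z) (P + grad u (fst z)) \<bullet> (P + grad u (fst z)) \<partial>\<mu>)"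
    using qg hi by simp
  also have "\<dots> = (\<integral>z. - ?q z \<partial>\<mu>)" using integral_graph[OF qc] by simp
  also have "\<dots> \<le> Q"
  proof (rule \<mu>.integral_le_const)
    show "integrable \<mu> (\<lambda>z. - ?q z)" using integrable_continuous_\<mu>[OF qc] by simp
    show "AE z in \<mu>. - ?q z \<le> Q" using AE_cell_box by eventually_elim (use Q in \<open>force simp: abs_le_iff\<close>)
  qed
  finally show ?thesis .
qed

text \<open>On the graph H - c is \<epsilon>^2 / 2 times the Laplacian. Its square carries
  \<epsilon>^4, of which the energy absorbs \<epsilon>^2; the remaining \<epsilon>^2 drives the
  residual to 0.\<close>

lemma cell_residual:
  assumes Q: "(\<integral>z. \<epsilon>\<^sup>2 / 2 * hess_sq u (fst z) \<partial>\<mu>) \<le> Q"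
  shows "(\<integral>z. (H (fst z) (snd z) - c)\<^sup>2 \<partial>\<mu>) \<le> \<epsilon>\<^sup>2 / 2 * real CARD('n) * Q"
proof -
  have Hc: "continuous_on UNIV (\<lambda>z. H (fst z) (snd z))" using H Ck_continuous unfolding smooth_def by blast
  have c2: "continuous_on UNIV (\<lambda>z. (H (fst z) (snd z) - c)\<^sup>2)" by (intro continuous_intros Hc)
  have "(\<integral>z. (H (fst z) (snd z) - c)\<^sup>2 \<partial>\<mu>) = (\<integral>z. (H (fst z) (P + grad u (fst z)) - c)\<^sup>2 \<partial>\<mu>)"
    using integral_graph[OF c2] by simp
  also have "\<dots> \<le> (\<integral>z. \<epsilon>\<^sup>2 / 2 * real CARD('n) * (\<epsilon>\<^sup>2 / 2 * hess_sq u (fst z)) \<partial>\<mu>)"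
  proof (rule integral_mono)
    have pc: "continuous_on UNIV (\<lambda>z. (fst z, P + grad u (fst z)))"
      by (intro continuous_intros continuous_on_compose2[OF grad_u_continuous]) auto
    show "integrable \<mu> (\<lambda>z. (H (fst z) (P + grad u (fst z)) - c)\<^sup>2)"
      using integrable_continuous_\<mu>[OF continuous_on_compose2[OF c2 pc]] by simp
    show "integrable \<mu> (\<lambda>z. \<epsilon>\<^sup>2 / 2 * real CARD('n) * (\<epsilon>\<^sup>2 / 2 * hess_sq u (fst z)))"
      by (intro integrable_mult_right integrable_continuous_fst hess_gram_continuous u_C2)
    fix z :: "(real^'n) \<times> (real^'n)"
    have "H (fst z) (P + grad u (fst z)) - c = \<epsilon>\<^sup>2 / 2 * laplacian u (fst z)" using cell[of "fst z"] by simp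
    then have "(H (fst z) (P + grad u (fst z)) - c)\<^sup>2 = (\<epsilon>\<^sup>2 / 2)\<^sup>2 * (laplacian u (fst z))\<^sup>2" by (simp only: power_mult_distrib)
    also have "\<dots> \<le> (\<epsilon>\<^sup>2 / 2)\<^sup>2 * (real CARD('n) * hess_sq u (fst z))"
      unfolding hess_sq_def by (intro mult_left_mono laplacian_sq_le) simp
    finally show "(H (fst z) (P + grad u (fst z)) - c)\<^sup>2 \<le> \<epsilon>\<^sup>2 / 2 * real CARD('n) * (\<epsilon>\<^sup>2 / 2 * hess_sq u (fst z))"
      by (simp add: power2_eq_square mult_ac)
  qed
  also have "\<dots> = \<epsilon>\<^sup>2 / 2 * real CARD('n) * (\<integral>z. \<epsilon>\<^sup>2 / 2 * hess_sq u (fst z) \<partial>\<mu>)" by simp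
  also have "\<dots> \<le> \<epsilon>\<^sup>2 / 2 * real CARD('n) * Q" using Q by (intro mult_left_mono) auto
  finally show ?thesis .
qed

lemma momentum_identity:
  "(\<integral>z. (snd z - P) \<bullet> gradp H (fst z) (snd z) \<partial>\<mu>) = (\<integral>z. H (fst z) (snd z) \<partial>\<mu>) - c"
proof -
  have Hk: "Ck k (\<lambda>z. H (fst z) (snd z))" for k using H by (simp add: smooth_def)
  let ?m = "\<lambda>z. (snd z - P) \<bullet> gradp H (fst z) (snd z)" and ?H = "\<lambda>z. H (fst z) (snd z)"
  have mc: "continuous_on UNIV ?m" by (intro continuous_intros gradp_continuous(1)[OF Hk[of "Suc 0"]])
  have Hc: "continuous_on UNIV ?H" by (rule Ck_continuous[OF Hk])
  \<comment> \<open>With test function \<open>u\<close> the drift pairs D_pH with Du = p - P, and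
    the second-order term equals H - c by the cell equation.\<close>
  have "generator (\<lambda>x. - gradp H x (P + grad u x)) \<epsilon> (grad u) (hess u) x
     = - ((P + grad u x - P) \<bullet> gradp H x (P + grad u x)) + (H x (P + grad u x) - c)" for x
    using cell[of x] by (simp add: generator_def trace_hess inner_commute)
  then have "(\<integral>z. - ?m (fst z, P + grad u (fst z)) + (?H (fst z, P + grad u (fst z)) - c) \<partial>\<mu>) = 0"
    using \<mu>_stationary[OF u_C2 up] by simp
  then have "(\<integral>z. - ?m z + (?H z - c) \<partial>\<mu>) = 0"
    by (subst integral_graph) (auto intro!: continuous_intros mc Hc)
  then show ?thesis
    using integrable_continuous_\<mu>[OF mc] integrable_continuous_\<mu>[OF Hc] by (simp add: \<mu>.prob_space)
qed

text \<open>A test function of position alone leaves only the second-order term as error, of size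
  \<epsilon>^2 with a constant that depends on \<open>g\<close> alone.\<close>

lemma flow_identity:
  assumes g: "Ck 2 g" "periodic g" and B: "\<And>x. \<bar>laplacian g x\<bar> \<le> B"
  shows "\<bar>\<integral>z. gradp H (fst z) (snd z) \<bullet> grad g (fst z) \<partial>\<mu>\<bar> \<le> \<epsilon>\<^sup>2 / 2 * B"
proof -
  have Hk: "Ck k (\<lambda>z. H (fst z) (snd z))" for k using H by (simp add: smooth_def)
  have g1: "Ck (Suc 0) g" using g(1) Ck_Suc_imp by (simp only: numeral_2_eq_2)
  let ?m = "\<lambda>z. gradp H (fst z) (snd z) \<bullet> grad g (fst z)"
  have mc: "continuous_on UNIV ?m"
    by (intro continuous_intros gradp_continuous(1)[OF Hk[of "Suc 0"]] continuous_on_compose2[OF grad_continuous[OF g1]]) auto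
  have lc: "continuous_on UNIV (laplacian g)"
    using hess_continuous[OF g(1)] unfolding trace_hess[symmetric, abs_def] trace_def by (intro continuous_intros)
  have li: "integrable \<mu> (\<lambda>z. \<epsilon>\<^sup>2 / 2 * laplacian g (fst z))"
    by (intro integrable_mult_right integrable_continuous_fst lc)
  have "(\<integral>z. - ?m (fst z, P + grad u (fst z)) + \<epsilon>\<^sup>2 / 2 * laplacian g (fst z) \<partial>\<mu>) = 0"
    using \<mu>_stationary[OF g] by (simp add: generator_def trace_hess)
  then have "(\<integral>z. - ?m z + \<epsilon>\<^sup>2 / 2 * laplacian g (fst z) \<partial>\<mu>) = 0"
    by (subst integral_graph) (auto intro!: continuous_intros mc continuous_on_compose2[OF lc])
  then have "(\<integral>z. ?m z \<partial>\<mu>) = (\<integral>z. \<epsilon>\<^sup>2 / 2 * laplacian g (fst z) \<partial>\<mu>)"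
    using integrable_continuous_\<mu>[OF mc] li by simp
  also have "\<bar>\<dots>\<bar> \<le> (\<integral>z. \<bar>\<epsilon>\<^sup>2 / 2 * laplacian g (fst z)\<bar> \<partial>\<mu>)" by (rule integral_abs_bound)
  also have "\<dots> \<le> \<epsilon>\<^sup>2 / 2 * B"
  proof (rule \<mu>.integral_le_const[OF integrable_abs[OF li]])
    have "\<bar>\<epsilon>\<^sup>2 / 2 * laplacian g x\<bar> \<le> \<epsilon>\<^sup>2 / 2 * B" for x
      using mult_left_mono[OF B, of "\<epsilon>\<^sup>2 / 2" x] by (simp add: abs_mult)
    then show "AE z in \<mu>. \<bar>\<epsilon>\<^sup>2 / 2 * laplacian g (fst z)\<bar> \<le> \<epsilon>\<^sup>2 / 2 * B" by simp
  qed
  finally show ?thesis .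
qed

text \<open>Only the momentum-momentum part of the diffusion survives in the limit. The position
  part carries \<epsilon>^2; the mixed part is linear in D^2 u, so its factor \<epsilon>^2 is
  divided between the energy and a vanishing prefactor.\<close>

lemma poisson_identity:
  fixes F :: "real^'n \<Rightarrow> real^'n \<Rightarrow> real"
  assumes F: "Ck 2 (\<lambda>z. F (fst z) (snd z))" and Fp: "periodic_x F" and eps: "\<epsilon> > 0" "\<epsilon> \<le> 1"
    and Q: "(\<integral>z. \<epsilon>\<^sup>2 / 2 * hess_sq u (fst z) \<partial>\<mu>) \<le> Q"
    and B: "0 \<le> B" "\<And>z i. z \<in> cell_box R \<Longrightarrow> \<bar>dderiv (\<lambda>z. dderiv (\<lambda>z. F (fst z) (snd z)) (ex i) z) (ex i) z\<bar> \<le> B"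
      "\<And>z i l. z \<in> cell_box R \<Longrightarrow> \<bar>dderiv (\<lambda>z. dderiv (\<lambda>z. F (fst z) (snd z)) (ex i) z) (ep l) z + dderiv (\<lambda>z. dderiv (\<lambda>z. F (fst z) (snd z)) (ep l) z) (ex i) z\<bar> \<le> B"
  shows "\<bar>(\<integral>z. poisson F H (fst z) (snd z) \<partial>\<mu>)
      + (\<Sum>k\<in>UNIV. \<Sum>l\<in>UNIV. \<integral>z. \<epsilon>\<^sup>2 / 2 * hess_gram u k l (fst z) * dpp F k l (fst z) (snd z) \<partial>\<mu>)\<bar>
     \<le> \<epsilon> * (B * (real CARD('n) + (real CARD('n))\<^sup>2 + Q))"
proof -
  let ?n = "real CARD('n)"
  let ?\<Phi> = "\<lambda>z. F (fst z) (snd z)"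
  have Hk: "Ck k (\<lambda>z. H (fst z) (snd z))" for k using H by (simp add: smooth_def)
  have F1: "Ck (Suc (Suc 0)) ?\<Phi>" using F by (simp only: numeral_2_eq_2)
  define G1 where "G1 z = poisson F H (fst z) (snd z)" for z
  define G2 where "G2 k l z = \<epsilon>\<^sup>2 / 2 * hess_gram u k l (fst z) * dpp F k l (fst z) (snd z)" for k l z
  \<comment> \<open>The error: pure position derivatives and mixed ones, the latter linear in the
    Hessian.\<close>
  define G3 where "G3 z = \<epsilon>\<^sup>2 / 2 * ((\<Sum>i\<in>UNIV. dderiv (\<lambda>z. dderiv ?\<Phi> (ex i) z) (ex i) z)
    + (\<Sum>i\<in>UNIV. \<Sum>l\<in>UNIV. hess u (fst z) $ l $ i * (dderiv (\<lambda>z. dderiv ?\<Phi> (ex i) z) (ep l) z + dderiv (\<lambda>z. dderiv ?\<Phi> (ep l) z) (ex i) z)))" for z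
  have G1c: "continuous_on UNIV G1" unfolding G1_def[abs_def] by (rule poisson_continuous[OF F1 Hk[of "Suc 0"]])
  have G2c: "continuous_on UNIV (G2 k l)" for k l unfolding G2_def[abs_def]
    by (intro continuous_intros dpp_continuous[OF F] continuous_on_compose2[OF hess_gram_continuous(1)[OF u_C2]]) auto
  have hc: "continuous_on UNIV (\<lambda>z::(real^'n)\<times>(real^'n). hess u (fst z) $ l $ i)" for l i
    by (intro continuous_on_component continuous_on_compose2[OF hess_continuous[OF u_C2]] continuous_intros) auto
  have G3c: "continuous_on UNIV G3" unfolding G3_def[abs_def]
    by (intro continuous_intros second_derivatives_continuous[OF F] hc)
  have sum_c: "continuous_on UNIV (\<lambda>z. G1 z + ((\<Sum>k\<in>UNIV. \<Sum>l\<in>UNIV. G2 k l z) + G3 z))"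
    by (intro continuous_intros G1c G2c G3c)
  have eq: "poisson F H x p + \<epsilon>\<^sup>2 / 2 * diffusion_part u F x p = G1 (x, p) + ((\<Sum>k\<in>UNIV. \<Sum>l\<in>UNIV. G2 k l (x, p)) + G3 (x, p))" for x p
  proof -
    have "(\<Sum>k\<in>UNIV. \<Sum>l\<in>UNIV. (\<Sum>i\<in>UNIV. hess u x $ k $ i * hess u x $ l $ i) * dpp F l k x p)
       = (\<Sum>k\<in>UNIV. \<Sum>l\<in>UNIV. (\<Sum>i\<in>UNIV. hess u x $ k $ i * hess u x $ l $ i) * dpp F k l x p)"
      by (rule sum.cong[OF refl], rule sum.cong[OF refl], subst dpp_sym[OF F], rule refl)
    moreover have "(\<Sum>k\<in>UNIV. \<Sum>l\<in>UNIV. G2 k l (x, p)) = \<epsilon>\<^sup>2 / 2 * (\<Sum>k\<in>UNIV. \<Sum>l\<in>UNIV. (\<Sum>i\<in>UNIV. hess u x $ k $ i * hess u x $ l $ i) * dpp F k l x p)"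
      by (simp only: G2_def hess_gram_def fst_conv snd_conv mult.assoc sum_distrib_left[symmetric])
    ultimately show ?thesis by (simp only: G1_def G3_def diffusion_part_def Let_def distrib_left fst_conv snd_conv add.commute add.left_commute)
  qed
  have z: "(\<integral>z. G1 z + ((\<Sum>k\<in>UNIV. \<Sum>l\<in>UNIV. G2 k l z) + G3 z) \<partial>\<mu>) = 0"
    using transport_identity[OF F Fp] integral_graph[OF sum_c] unfolding eq by simp
  have i2: "integrable \<mu> (\<lambda>z. \<Sum>k\<in>UNIV. \<Sum>l\<in>UNIV. G2 k l z)"
    by (intro Bochner_Integration.integrable_sum integrable_continuous_\<mu>[OF G2c])
  have "(\<integral>z. G1 z \<partial>\<mu>) + (\<Sum>k\<in>UNIV. \<Sum>l\<in>UNIV. \<integral>z. G2 k l z \<partial>\<mu>) = - (\<integral>z. G3 z \<partial>\<mu>)"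
    using z integrable_continuous_\<mu>[OF G1c] integrable_continuous_\<mu>[OF G3c] i2 integrable_continuous_\<mu>[OF G2c]
    by (simp add: Bochner_Integration.integral_sum)
  moreover have "\<bar>\<integral>z. G3 z \<partial>\<mu>\<bar> \<le> \<epsilon> * (B * (?n + ?n\<^sup>2 + Q))"
  proof -
    have hi: "integrable \<mu> (\<lambda>z. \<epsilon>\<^sup>2 / 2 * hess_sq u (fst z))"
      by (intro integrable_mult_right integrable_continuous_fst hess_gram_continuous u_C2)
    have "\<bar>\<integral>z. G3 z \<partial>\<mu>\<bar> \<le> (\<integral>z. \<bar>G3 z\<bar> \<partial>\<mu>)" by (rule integral_abs_bound)
    also have "\<dots> \<le> (\<integral>z. \<epsilon> * (B * (?n + ?n\<^sup>2 + \<epsilon>\<^sup>2 / 2 * hess_sq u (fst z))) \<partial>\<mu>)"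
    proof (rule integral_mono_AE)
      show "integrable \<mu> (\<lambda>z. \<bar>G3 z\<bar>)" using integrable_continuous_\<mu>[OF G3c] by simp
      show "integrable \<mu> (\<lambda>z. \<epsilon> * (B * (?n + ?n\<^sup>2 + \<epsilon>\<^sup>2 / 2 * hess_sq u (fst z))))" using hi by simp
      show "AE z in \<mu>. \<bar>G3 z\<bar> \<le> \<epsilon> * (B * (?n + ?n\<^sup>2 + \<epsilon>\<^sup>2 / 2 * hess_sq u (fst z)))"
        using AE_cell_box
      proof eventually_elim
        case (elim z)
        let ?h = "\<lambda>l i. hess u (fst z) $ l $ i"
        have 1: "\<bar>\<Sum>i\<in>UNIV. dderiv (\<lambda>z. dderiv ?\<Phi> (ex i) z) (ex i) z\<bar> \<le> (\<Sum>i\<in>(UNIV::'n set). B)"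
          by (rule order_trans[OF sum_abs sum_mono[OF B(2)[OF elim]]])
        \<comment> \<open>Young's inequality consumes one power of \<epsilon> against the energy
          density; the other power remains as the factor in front. The constants 1 add up to the n^2
          of the bound, the pure position terms to its n.\<close>
        have ab: "\<epsilon> * \<bar>a\<bar> \<le> 1 + \<epsilon>\<^sup>2 / 2 * a\<^sup>2" for a :: real
          using zero_le_power2[of "\<epsilon> * \<bar>a\<bar> - 1"] by (simp add: power2_diff power_mult_distrib)
        have "\<bar>\<Sum>i\<in>UNIV. \<Sum>l\<in>UNIV. \<epsilon> * (?h l i * (dderiv (\<lambda>z. dderiv ?\<Phi> (ex i) z) (ep l) z + dderiv (\<lambda>z. dderiv ?\<Phi> (ep l) z) (ex i) z))\<bar>
          \<le> (\<Sum>i\<in>(UNIV::'n set). \<Sum>l\<in>(UNIV::'n set). (1 + \<epsilon>\<^sup>2 / 2 * (?h l i)\<^sup>2) * B)"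
        proof (rule order_trans[OF sum_abs sum_mono[OF order_trans[OF sum_abs sum_mono]]])
          fix i l :: 'n
          have "\<bar>\<epsilon> * (?h l i * (dderiv (\<lambda>z. dderiv ?\<Phi> (ex i) z) (ep l) z + dderiv (\<lambda>z. dderiv ?\<Phi> (ep l) z) (ex i) z))\<bar>
             = (\<epsilon> * \<bar>?h l i\<bar>) * \<bar>dderiv (\<lambda>z. dderiv ?\<Phi> (ex i) z) (ep l) z + dderiv (\<lambda>z. dderiv ?\<Phi> (ep l) z) (ex i) z\<bar>"
            using eps by (simp add: abs_mult)
          also have "\<dots> \<le> (1 + \<epsilon>\<^sup>2 / 2 * (?h l i)\<^sup>2) * B"
            by (rule mult_mono[OF ab B(3)[OF elim]]) auto
          finally show "\<bar>\<epsilon> * (?h l i * (dderiv (\<lambda>z. dderiv ?\<Phi> (ex i) z) (ep l) z + dderiv (\<lambda>z. dderiv ?\<Phi> (ep l) z) (ex i) z))\<bar> \<le> (1 + \<epsilon>\<^sup>2 / 2 * (?h l i)\<^sup>2) * B" .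
        qed
        also have "\<dots> = (?n\<^sup>2 + \<epsilon>\<^sup>2 / 2 * (\<Sum>i\<in>UNIV. \<Sum>l\<in>UNIV. (?h l i)\<^sup>2)) * B"
        proof -
          have "(\<Sum>i\<in>UNIV. \<Sum>l\<in>UNIV. 1 + \<epsilon>\<^sup>2 / 2 * (?h l i)\<^sup>2) = ?n\<^sup>2 + \<epsilon>\<^sup>2 / 2 * (\<Sum>i\<in>UNIV. \<Sum>l\<in>UNIV. (?h l i)\<^sup>2)"
            unfolding sum.distrib sum_distrib_left by (simp add: power2_eq_square[of ?n])
          then show ?thesis by (simp only: sum_distrib_right[symmetric])
        qed
        also have "(\<Sum>i\<in>UNIV. \<Sum>l\<in>UNIV. (?h l i)\<^sup>2) = hess_sq u (fst z)" unfolding hess_sq_def by (rule sum.swap)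
        finally have 2: "\<bar>\<epsilon> * (\<Sum>i\<in>UNIV. \<Sum>l\<in>UNIV. ?h l i * (dderiv (\<lambda>z. dderiv ?\<Phi> (ex i) z) (ep l) z + dderiv (\<lambda>z. dderiv ?\<Phi> (ep l) z) (ex i) z))\<bar>
          \<le> (?n\<^sup>2 + \<epsilon>\<^sup>2 / 2 * hess_sq u (fst z)) * B"
          by (simp add: sum_distrib_left)
        have "\<bar>\<epsilon> * (\<Sum>i\<in>UNIV. dderiv (\<lambda>z. dderiv ?\<Phi> (ex i) z) (ex i) z)\<bar> \<le> ?n * B"
          using 1 eps mult_mono[of \<epsilon> 1 "\<bar>\<Sum>i\<in>UNIV. dderiv (\<lambda>z. dderiv ?\<Phi> (ex i) z) (ex i) z\<bar>" "?n * B"]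
          by (simp add: abs_mult)
        with 2 have 3: "\<bar>\<epsilon> * (\<Sum>i\<in>UNIV. dderiv (\<lambda>z. dderiv ?\<Phi> (ex i) z) (ex i) z)
           + \<epsilon> * (\<Sum>i\<in>UNIV. \<Sum>l\<in>UNIV. ?h l i * (dderiv (\<lambda>z. dderiv ?\<Phi> (ex i) z) (ep l) z + dderiv (\<lambda>z. dderiv ?\<Phi> (ep l) z) (ex i) z))\<bar>
          \<le> B * (?n + ?n\<^sup>2 + \<epsilon>\<^sup>2 / 2 * hess_sq u (fst z))" (is "\<bar>?S\<bar> \<le> ?W")
          by (simp add: algebra_simps abs_le_iff)
        have "G3 z = \<epsilon> / 2 * ?S" by (simp add: G3_def power2_eq_square distrib_left)
        moreover have "\<bar>\<epsilon> / 2\<bar> = \<epsilon> / 2" using eps by simp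
        ultimately have "\<bar>G3 z\<bar> = \<epsilon> / 2 * \<bar>?S\<bar>" by (simp only: abs_mult)
        also have "\<dots> \<le> \<epsilon> / 2 * ?W" using 3 eps by (intro mult_left_mono) auto
        also have "\<dots> \<le> \<epsilon> * ?W"
          using eps B(1) hess_sq_nonneg[of u "fst z"] by (intro mult_right_mono mult_nonneg_nonneg add_nonneg_nonneg) auto
        finally show ?case .
      qed
    qed
    also have "\<dots> = \<epsilon> * (B * (?n + ?n\<^sup>2 + (\<integral>z. \<epsilon>\<^sup>2 / 2 * hess_sq u (fst z) \<partial>\<mu>)))"
      using hi by (simp add: \<mu>.prob_space)
    also have "\<dots> \<le> \<epsilon> * (B * (?n + ?n\<^sup>2 + Q))" using Q eps B(1) by (intro mult_left_mono add_left_mono) auto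
    finally show ?thesis .
  qed
  ultimately show ?thesis unfolding G1_def G2_def by simp
qed

end

end

section \<open>Passage to the limit\<close>

lemma weak_limit_combination:
  fixes N :: "'i \<Rightarrow> nat \<Rightarrow> 'a::euclidean_space measure"
  assumes I: "finite I" and L: "\<And>i. i \<in> I \<Longrightarrow> weak_limit_on C (N i) (L i)"
    and pos: "\<And>j \<phi>. continuous_on UNIV \<phi> \<Longrightarrow> (\<And>x. 0 \<le> \<phi> x \<and> \<phi> x \<le> 1) \<Longrightarrow> 0 \<le> (\<Sum>i\<in>I. c i * (\<integral>x. \<phi> x \<partial>N i j))"
    and B: "B \<in> sets borel"
  shows "0 \<le> (\<Sum>i\<in>I. c i * measure (L i) B)"
proof (rule combination_nonneg[OF I _ _ _ B])
  show "finite_measure (L i)" "sets (L i) = sets borel" if "i \<in> I" for i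
    using L[OF that] by (auto simp: weak_limit_on_def)
  fix \<phi> :: "'a \<Rightarrow> real" assume \<phi>: "continuous_on UNIV \<phi>" "\<And>x. 0 \<le> \<phi> x \<and> \<phi> x \<le> 1"
  have "(\<lambda>j. \<Sum>i\<in>I. c i * (\<integral>x. \<phi> x \<partial>N i j)) \<longlonglongrightarrow> (\<Sum>i\<in>I. c i * (\<integral>x. \<phi> x \<partial>L i))"
    using L \<phi>(1) by (intro tendsto_sum tendsto_mult tendsto_const) (auto simp: weak_limit_on_def)
  then show "0 \<le> (\<Sum>i\<in>I. c i * (\<integral>x. \<phi> x \<partial>L i))"
    by (rule LIMSEQ_le_const) (use pos[OF \<phi>] in auto)
qed

text \<open>Two copies of the same sequence with coefficients 1 and -1 combine to 0, which is
  nonnegative; the limits are compared by exchanging the signs.\<close>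

lemma weak_limit_unique:
  fixes N :: "nat \<Rightarrow> 'a::euclidean_space measure"
  assumes L: "weak_limit_on C N L" "weak_limit_on C N L'" and B: "B \<in> sets borel"
  shows "measure L B = measure L' B"
proof -
  have "0 \<le> (\<Sum>i\<in>{True, False}. (if i = b then 1 else -1) * measure (if i then L else L') B)" for b
    by (rule weak_limit_combination[where N="\<lambda>_. N", OF _ _ _ B]) (use L in auto)
  from this[of True] this[of False] show ?thesis by simp
qed

text \<open>Weak limits of measures on the half-open fundamental domain may charge its boundary; \<open>reduce\<close>
  folds them back without changing integrals of periodic functions.\<close>

definition reduce :: "(real^'n) \<times> (real^'n) \<Rightarrow> (real^'n) \<times> (real^'n)" where
  "reduce z = (fst z - intpart (fst z), snd z)"

lemma reduce_measurable: "reduce \<in> borel_measurable borel"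
proof -
  have "(\<lambda>x::real^'n. intpart x) \<in> borel_measurable borel"
    by (subst borel_measurable_euclidean_space) (auto simp: Basis_vec_def inner_axis intpart_def)
  then have "(\<lambda>z::(real^'n) \<times> (real^'n). intpart (fst z)) \<in> borel_measurable borel"
    by (rule measurable_compose[rotated]) (simp add: borel_prod[symmetric])
  moreover have "fst \<in> (borel :: ((real^'n) \<times> (real^'n)) measure) \<rightarrow>\<^sub>M borel" "snd \<in> (borel :: ((real^'n) \<times> (real^'n)) measure) \<rightarrow>\<^sub>M borel"
    by (simp_all add: borel_prod[symmetric])
  ultimately show ?thesis unfolding reduce_def[abs_def] by (intro borel_measurable_Pair borel_measurable_diff)
qed

lemma reduce_integral:
  fixes F :: "real^'n \<Rightarrow> real^'n \<Rightarrow> real"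
  assumes c: "continuous_on UNIV (\<lambda>z. F (fst z) (snd z))" and p: "periodic_x F" and L: "sets L = sets borel"
  shows "(\<integral>z. F (fst z) (snd z) \<partial>distr L borel reduce) = (\<integral>z. F (fst z) (snd z) \<partial>L)"
proof -
  have "reduce \<in> measurable L borel" using reduce_measurable L by (simp cong: measurable_cong_sets)
  moreover have "F (fst (reduce z)) (snd (reduce z)) = F (fst z) (snd z)" for z
    using p int_vec_intpart[of "fst z"] unfolding periodic_x_def reduce_def by (metis add_uminus_conv_diff fst_conv snd_conv)
  ultimately show ?thesis using borel_measurable_continuous_onI[OF c] by (simp add: integral_distr)
qed

lemma reduce_fund_dom: "reduce z \<in> fund_dom \<times> UNIV"
  using fracpart_mem(1) by (simp add: reduce_def)

lemma reduce_torus_measure: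
  fixes L :: "((real^'n) \<times> (real^'n)) measure"
  assumes "sets L = sets borel"
  shows "torus_measure (distr L borel reduce)"
proof -
  have m: "reduce \<in> measurable L borel" using reduce_measurable assms by (simp cong: measurable_cong_sets)
  have "emeasure (distr L borel reduce) (- (fund_dom \<times> UNIV)) = 0"
  proof (cases "- (fund_dom \<times> UNIV) \<in> sets (borel :: ((real^'n) \<times> (real^'n)) measure)")
    case True
    have "reduce -` (- (fund_dom \<times> UNIV)) \<inter> space L = {}" using reduce_fund_dom by blast
    then show ?thesis by (simp only: emeasure_distr[OF m True] emeasure_empty)
  next
    \<comment> \<open>A set outside the sigma-algebra has measure 0 by convention, so the claim
      holds whether or not measurability is known.\<close>
    case False
    then show ?thesis by (simp add: emeasure_notin_sets)
  qed
  then show ?thesis by (simp add: torus_measure_def)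
qed

lemma reduce_cell_box: "z \<in> cell_box R \<Longrightarrow> reduce z \<in> cell_box R"
  using fracpart_mem(2) by (auto simp: reduce_def cell_box_def)

lemma reduce_null:
  assumes L: "sets L = sets borel" "AE z in L. z \<in> cell_box R" and A: "A \<in> sets borel" "A \<inter> cell_box R = {}"
  shows "emeasure (distr L borel reduce) A = 0"
proof -
  have m: "reduce \<in> measurable L borel" using reduce_measurable L by (simp cong: measurable_cong_sets)
  have "AE z in L. z \<notin> reduce -` A \<inter> space L"
    using L(2) by eventually_elim (use A(2) reduce_cell_box in blast)
  then have "emeasure L (reduce -` A \<inter> space L) = 0"
    by (rule AE_iff_measurable[THEN iffD1, rotated 2]) (use measurable_sets[OF m A(1)] in auto)
  then show ?thesis by (simp only: emeasure_distr[OF m A(1)])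
qed

section \<open>Compactness of supports\<close>

lemma compact_measure_support:
  fixes M :: "'a::euclidean_space measure"
  assumes M: "sets M = sets borel" and C: "compact C" and null: "\<And>A. A \<in> sets borel \<Longrightarrow> A \<inter> C = {} \<Longrightarrow> emeasure M A = 0"
  shows "compact (measure_support M)"
proof -
  have "measure_support M \<subseteq> C"
  proof
    fix z assume z: "z \<in> measure_support M"
    show "z \<in> C"
    proof (rule ccontr)
      assume "z \<notin> C"
      then obtain e where "e > 0" "ball z e \<subseteq> - C"
        using compact_imp_closed[OF C] open_contains_ball[of "- C"] by auto
      then show False using null[of "ball z e"] z by (auto simp: measure_support_def)
    qed
  qed
  moreover have "open (- measure_support M)"
    unfolding open_contains_ball
  proof
    fix z assume "z \<in> - measure_support M"
    then obtain e where e: "e > 0" "emeasure M (ball z e) = 0" by (auto simp: measure_support_def)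
    have "ball z e \<subseteq> - measure_support M"
    proof
      fix y assume y: "y \<in> ball z e"
      have "ball y (e - dist z y) \<subseteq> ball z e"
      proof
        fix x assume "x \<in> ball y (e - dist z y)"
        then show "x \<in> ball z e" using dist_triangle[of z x y] by simp
      qed
      then have "emeasure M (ball y (e - dist z y)) \<le> emeasure M (ball z e)"
        using M by (intro emeasure_mono) auto
      then have "emeasure M (ball y (e - dist z y)) = 0" using e by simp
      moreover have "e - dist z y > 0" using y by simp
      ultimately have "\<not> (\<forall>d>0. emeasure M (ball y d) \<noteq> 0)" by metis
      then show "y \<in> - measure_support M" unfolding measure_support_def by simp
    qed
    then show "\<exists>e>0. ball z e \<subseteq> - measure_support M" using e by blast
  qed
  ultimately show ?thesis
    using compact_Int_closed[OF C, of "measure_support M"] by (simp add: closed_def Int_absorb1)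
qed

text \<open>A signed measure may vanish on a ball by cancellation, so a point outside the support
  has a ball all of whose Borel subsets have charge 0. Smaller balls inherit this, hence the support
  is closed.\<close>

lemma compact_smeasure_support:
  fixes m :: "'a::euclidean_space set \<Rightarrow> real"
  assumes C: "compact C" and null: "\<And>A. A \<in> sets borel \<Longrightarrow> A \<inter> C = {} \<Longrightarrow> m A = 0"
  shows "compact (smeasure_support m)"
proof -
  have "smeasure_support m \<subseteq> C"
  proof
    fix z assume z: "z \<in> smeasure_support m"
    show "z \<in> C"
    proof (rule ccontr)
      assume "z \<notin> C"
      then obtain e where e: "e > 0" "ball z e \<subseteq> - C"
        using compact_imp_closed[OF C] open_contains_ball[of "- C"] by auto
      then obtain A where "A \<in> sets borel" "A \<subseteq> ball z e" "m A \<noteq> 0"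
        using z unfolding smeasure_support_def by blast
      then show False using null[of A] e by blast
    qed
  qed
  moreover have "open (- smeasure_support m)"
    unfolding open_contains_ball
  proof
    fix z assume "z \<in> - smeasure_support m"
    then have "\<exists>e>0. \<not> (\<exists>A\<in>sets borel. A \<subseteq> ball z e \<and> m A \<noteq> 0)" unfolding smeasure_support_def by simp
    then obtain e where e: "e > 0" "\<And>A. A \<in> sets borel \<Longrightarrow> A \<subseteq> ball z e \<Longrightarrow> m A = 0" by metis
    have "ball z e \<subseteq> - smeasure_support m"
    proof
      fix y assume y: "y \<in> ball z e"
      have "ball y (e - dist z y) \<subseteq> ball z e"
      proof
        fix x assume "x \<in> ball y (e - dist z y)"
        then show "x \<in> ball z e" using dist_triangle[of z x y] by simp
      qed
      then have "\<not> (\<exists>A\<in>sets borel. A \<subseteq> ball y (e - dist z y) \<and> m A \<noteq> 0)"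
        using e(2) by (meson order_trans)
      moreover have "e - dist z y > 0" using y by simp
      ultimately have "\<not> (\<forall>d>0. \<exists>A\<in>sets borel. A \<subseteq> ball y d \<and> m A \<noteq> 0)" by (metis (no_types))
      then show "y \<in> - smeasure_support m" unfolding smeasure_support_def by simp
    qed
    then show "\<exists>e>0. ball z e \<subseteq> - smeasure_support m" using e by blast
  qed
  ultimately show ?thesis
    using compact_Int_closed[OF C, of "smeasure_support m"] by (simp add: closed_def Int_absorb1)
qed

text \<open>Noise levels \<open>e j\<close> tending to 0, with the gradient bound \<open>R\<close>
  and the energy constant \<open>Q\<close> common to all of them; these uniform constants make the
  limit possible.\<close>

locale vanishing_noise =
  fixes H :: "real^'n \<Rightarrow> real^'n \<Rightarrow> real" and P x0 :: "real^'n" and U :: "nat \<Rightarrow> real^'n \<Rightarrow> real" and e :: "nat \<Rightarrow> real"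
    and M :: "'w measure" and w :: "real \<Rightarrow> 'w \<Rightarrow> real^'n" and X :: "nat \<Rightarrow> real \<Rightarrow> 'w \<Rightarrow> real^'n"
    and \<mu> :: "nat \<Rightarrow> ((real^'n) \<times> (real^'n)) measure" and T :: "nat \<Rightarrow> nat \<Rightarrow> real" and c :: "nat \<Rightarrow> real" and Hbar R Q :: real
  assumes erg: "\<And>j. ergodic_measure H P x0 (U j) (e j) M w (X j) (\<mu> j) (T j) (c j)"
    and e: "\<And>j. 0 < e j" "\<And>j. e j \<le> 1" "e \<longlonglongrightarrow> 0"
    and c: "c \<longlonglongrightarrow> Hbar"
    and R: "\<And>j x. norm (P + grad (U j) x) \<le> R"
    and Q: "\<And>z. z \<in> cell_box R \<Longrightarrow> \<bar>gradx H (fst z) (snd z) \<bullet> snd z\<bar> \<le> Q"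
begin

sublocale E: ergodic_measure H P x0 "U j" "e j" M w "X j" "\<mu> j" "T j" "c j" for j
  by (rule erg)

interpretation \<mu>: prob_space "\<mu> j" for j by (rule E.\<mu>(2))

lemma R_nonneg: "0 \<le> R" using R[of 0 0] norm_ge_zero by (rule order_trans[rotated])

lemma H_Ck: "Ck k (\<lambda>z. H (fst z) (snd z))" using E.H by (simp add: smooth_def)

lemma energy: "(\<integral>z. (e j)\<^sup>2 / 2 * hess_sq (U j) (fst z) \<partial>\<mu> j) \<le> Q"
  by (rule E.hess_sq_energy[OF R Q])

lemma Q_nonneg: "0 \<le> Q"
  using energy[of 0] by (rule order_trans[rotated]) (simp add: hess_sq_nonneg integral_nonneg)

text \<open>Positive and negative parts of the entries of \<open>\<epsilon>\<^sup>2/2 D\<^sup>2u D\<^sup>2u\<close>: their weak limits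
  represent the signed measures \<open>m\<^sub>k\<^sub>l\<close>.\<close>

definition dens :: "bool \<Rightarrow> 'n \<Rightarrow> 'n \<Rightarrow> nat \<Rightarrow> real^'n \<Rightarrow> real" where
  "dens s k l j x = max 0 ((if s then 1 else -1) * ((e j)\<^sup>2 / 2 * hess_gram (U j) k l x))"

lemma dens_diff: "dens True k l j x - dens False k l j x = (e j)\<^sup>2 / 2 * hess_gram (U j) k l x"
  by (simp add: dens_def max_def)

lemma dens_bounds: "0 \<le> dens s k l j x" "dens s k l j x \<le> (e j)\<^sup>2 / 2 * hess_sq (U j) x"
proof -
  show "0 \<le> dens s k l j x" by (simp add: dens_def)
  have "(e j)\<^sup>2 / 2 * \<bar>hess_gram (U j) k l x\<bar> \<le> (e j)\<^sup>2 / 2 * hess_sq (U j) x"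
    by (intro mult_left_mono hess_gram_bound) simp
  moreover have "dens s k l j x \<le> \<bar>(e j)\<^sup>2 / 2 * hess_gram (U j) k l x\<bar>" by (auto simp: dens_def)
  ultimately show "dens s k l j x \<le> (e j)\<^sup>2 / 2 * hess_sq (U j) x" by (simp add: abs_mult)
qed

lemma dens_continuous: "continuous_on UNIV (dens s k l j)"
  unfolding dens_def[abs_def] by (intro continuous_on_max continuous_on_mult continuous_on_const hess_gram_continuous E.u_C2)

lemma dens_continuous_fst: "continuous_on UNIV (\<lambda>z::(real^'n) \<times> (real^'n). dens s k l j (fst z))"
  using continuous_on_compose2[OF dens_continuous, of UNIV fst] continuous_on_fst[OF continuous_on_id] by blast

lemma dens_integrable: "integrable (\<mu> j) (\<lambda>z. dens s k l j (fst z))"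
  by (rule E.integrable_continuous_fst[OF R dens_continuous])

text \<open>The measure itself, at \<open>None\<close>, and the parts of all matrix entries form one
  finite family, so that all of them converge along the same subsequence.\<close>

definition fam :: "(bool \<times> 'n \<times> 'n) option \<Rightarrow> nat \<Rightarrow> ((real^'n) \<times> (real^'n)) measure" where
  "fam i j = (case i of None \<Rightarrow> \<mu> j | Some (s, k, l) \<Rightarrow> density (\<mu> j) (\<lambda>z. ennreal (dens s k l j (fst z))))"

lemma fam_None: "fam None j = \<mu> j" by (simp add: fam_def)

lemma fam_integral:
  assumes "continuous_on UNIV (f :: _ \<Rightarrow> real)"
  shows "(\<integral>z. f z \<partial>fam (Some (s, k, l)) j) = (\<integral>z. dens s k l j (fst z) * f z \<partial>\<mu> j)"
  unfolding fam_def using dens_bounds(1)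
  by (simp, subst integral_density)
     (auto intro!: E.continuous_measurable_\<mu> assms dens_continuous_fst)

text \<open>The mass is 1 at \<open>None\<close> and at most the energy \<open>Q\<close> for the
  densities; 1 + Q covers both cases.\<close>

lemma fam_properties:
  "finite_measure (fam i j)" "sets (fam i j) = sets borel" "AE z in fam i j. z \<in> cell_box R" "measure (fam i j) UNIV \<le> 1 + Q"
proof -
  show sets: "sets (fam i j) = sets borel" by (auto simp: fam_def E.sets_\<mu> split: option.split)
  have "finite_measure (fam i j) \<and> (AE z in fam i j. z \<in> cell_box R) \<and> measure (fam i j) UNIV \<le> 1 + Q"
  proof (cases i)
    case None
    then have fi: "fam i j = \<mu> j" by (simp add: fam_None)
    show ?thesis unfolding fi
      using \<mu>.finite_measure_axioms \<mu>.prob_space[of j] E.AE_cell_box[OF R] Q_nonneg by (simp add: E.space_\<mu>)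
  next
    case (Some skl)
    obtain s k l where skl: "skl = (s, k, l)" by (cases skl)
    have D: "fam i j = density (\<mu> j) (\<lambda>z. ennreal (dens s k l j (fst z)))" by (simp add: fam_def Some skl)
    have dm: "(\<lambda>z. ennreal (dens s k l j (fst z))) \<in> borel_measurable (\<mu> j)"
      using borel_measurable_integrable[OF dens_integrable] by simp
    have "emeasure (fam i j) UNIV = (\<integral>\<^sup>+z. ennreal (dens s k l j (fst z)) \<partial>\<mu> j)"
      unfolding D using dm by (subst emeasure_density) (auto simp: E.sets_\<mu>)
    also have "\<dots> = ennreal (\<integral>z. dens s k l j (fst z) \<partial>\<mu> j)"
      by (rule nn_integral_eq_integral[OF dens_integrable]) (simp add: dens_bounds)
    finally have em: "emeasure (fam i j) UNIV = ennreal (\<integral>z. dens s k l j (fst z) \<partial>\<mu> j)" .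
    have sp: "space (fam i j) = UNIV" by (simp add: D E.space_\<mu>)
    have "(\<integral>z. dens s k l j (fst z) \<partial>\<mu> j) \<le> (\<integral>z. (e j)\<^sup>2 / 2 * hess_sq (U j) (fst z) \<partial>\<mu> j)"
      by (intro integral_mono dens_integrable dens_bounds integrable_mult_right E.integrable_continuous_fst[OF R] hess_gram_continuous E.u_C2)
    also have "\<dots> \<le> Q" by (rule energy)
    finally have "measure (fam i j) UNIV \<le> 1 + Q"
      unfolding measure_def em using dens_bounds(1) by (simp add: integral_nonneg)
    moreover have "finite_measure (fam i j)" by (rule finite_measureI) (simp add: sp em)
    moreover have "AE z in fam i j. z \<in> cell_box R"
      unfolding D by (subst AE_density[OF dm]) (use E.AE_cell_box[OF R, of j] in \<open>auto elim: eventually_mono\<close>)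
    ultimately show ?thesis by blast
  qed
  then show "finite_measure (fam i j)" "AE z in fam i j. z \<in> cell_box R" "measure (fam i j) UNIV \<le> 1 + Q" by auto
qed

lemma limits_exist:
  obtains r L where "strict_mono (r::nat \<Rightarrow> nat)" "\<And>i. weak_limit_on (cell_box R) (\<lambda>j. fam i (r j)) (L i)"
proof -
  have "\<exists>r L. strict_mono (r::nat \<Rightarrow> nat) \<and> (\<forall>i\<in>UNIV. weak_limit_on (cell_box R) (\<lambda>j. fam i (r j)) (L i))"
    by (rule family_weak_compact[OF cell_box(1,2) cell_box(3)[OF R_nonneg], where m="1 + Q"]) (simp, (rule fam_properties)+)
  then show ?thesis using that by auto
qed

context
  fixes r :: "nat \<Rightarrow> nat" and L :: "(bool \<times> 'n \<times> 'n) option \<Rightarrow> ((real^'n) \<times> (real^'n)) measure"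
  assumes r: "strict_mono r" and L: "\<And>i. weak_limit_on (cell_box R) (\<lambda>j. fam i (r j)) (L i)"
begin

section \<open>Properties inherited by the limit measures\<close>

lemma limit_properties: "finite_measure (L i)" "sets (L i) = sets borel" "AE z in L i. z \<in> cell_box R"
  "continuous_on UNIV (f :: _ \<Rightarrow> real) \<Longrightarrow> (\<lambda>j. \<integral>z. f z \<partial>fam i (r j)) \<longlonglongrightarrow> (\<integral>z. f z \<partial>L i)"
  using L[of i] by (auto simp: weak_limit_on_def)

lemma e_subseq: "(\<lambda>j. e (r j)) \<longlonglongrightarrow> 0" and c_subseq: "(\<lambda>j. c (r j)) \<longlonglongrightarrow> Hbar"
  using LIMSEQ_subseq_LIMSEQ[OF e(3) r] LIMSEQ_subseq_LIMSEQ[OF c r] by (simp_all add: o_def)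

definition \<nu> where "\<nu> = L None"

lemma \<nu>_lim: "continuous_on UNIV (f :: _ \<Rightarrow> real) \<Longrightarrow> (\<lambda>j. \<integral>z. f z \<partial>\<mu> (r j)) \<longlonglongrightarrow> (\<integral>z. f z \<partial>\<nu>)"
  using limit_properties(4)[of f None] by (simp add: fam_None \<nu>_def)

lemma \<nu>_prob: "prob_space \<nu>"
proof -
  interpret finite_measure \<nu> unfolding \<nu>_def by (rule limit_properties)
  have "(\<lambda>j. \<integral>z. 1 \<partial>\<mu> (r j)) \<longlonglongrightarrow> (\<integral>z. (1::real) \<partial>\<nu>)" by (rule \<nu>_lim) simp
  then have "measure \<nu> (space \<nu>) = 1" using \<mu>.prob_space by (simp add: LIMSEQ_const_iff)
  then show ?thesis by (intro prob_spaceI) (simp add: emeasure_eq_measure)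
qed

interpretation \<nu>: prob_space \<nu> by (rule \<nu>_prob)

lemma \<nu>_integrable: "continuous_on UNIV (f :: _ \<Rightarrow> real) \<Longrightarrow> integrable \<nu> f"
  unfolding \<nu>_def by (rule integrable_compact_AE[OF limit_properties(1-3) cell_box(1)])

lemma H_const: "AE z in \<nu>. H (fst z) (snd z) = Hbar" "(\<integral>z. H (fst z) (snd z) \<partial>\<nu>) = Hbar"
proof -
  have Hc: "continuous_on UNIV (\<lambda>z. H (fst z) (snd z))" by (rule Ck_continuous[OF H_Ck])
  have c2: "continuous_on UNIV (\<lambda>z. (H (fst z) (snd z) - b)\<^sup>2)" for b by (intro continuous_intros Hc)
  let ?n = "real CARD('n)"
  \<comment> \<open>The residual at level \<open>j\<close> is small relative to \<open>c j\<close>,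
    not to its limit; the square is split accordingly.\<close>
  have le: "(\<integral>z. (H (fst z) (snd z) - Hbar)\<^sup>2 \<partial>\<mu> j) \<le> 2 * ((e j)\<^sup>2 / 2 * ?n * Q) + 2 * (c j - Hbar)\<^sup>2" for j
  proof -
    have "(\<integral>z. (H (fst z) (snd z) - Hbar)\<^sup>2 \<partial>\<mu> j) \<le> (\<integral>z. 2 * (H (fst z) (snd z) - c j)\<^sup>2 + 2 * (c j - Hbar)\<^sup>2 \<partial>\<mu> j)"
    proof (rule integral_mono)
      show "integrable (\<mu> j) (\<lambda>z. (H (fst z) (snd z) - Hbar)\<^sup>2)" by (rule E.integrable_continuous_\<mu>[OF R c2])
      show "integrable (\<mu> j) (\<lambda>z. 2 * (H (fst z) (snd z) - c j)\<^sup>2 + 2 * (c j - Hbar)\<^sup>2)"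
        using E.integrable_continuous_\<mu>[OF R c2[of "c j"]] by simp
      fix z :: "(real^'n) \<times> (real^'n)"
      let ?h = "H (fst z) (snd z)"
      have "0 \<le> ((?h - c j) - (c j - Hbar))\<^sup>2" by simp
      then show "(?h - Hbar)\<^sup>2 \<le> 2 * (?h - c j)\<^sup>2 + 2 * (c j - Hbar)\<^sup>2"
        by (simp add: power2_eq_square algebra_simps)
    qed
    also have "\<dots> = 2 * (\<integral>z. (H (fst z) (snd z) - c j)\<^sup>2 \<partial>\<mu> j) + 2 * (c j - Hbar)\<^sup>2"
      using E.integrable_continuous_\<mu>[OF R c2[of "c j"]] \<mu>.prob_space by simp
    also have "\<dots> \<le> 2 * ((e j)\<^sup>2 / 2 * ?n * Q) + 2 * (c j - Hbar)\<^sup>2"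
      using E.cell_residual[OF R energy, of j] by simp
    finally show ?thesis .
  qed
  have "(\<lambda>j. 2 * ((e (r j))\<^sup>2 / 2 * ?n * Q) + 2 * (c (r j) - Hbar)\<^sup>2) \<longlonglongrightarrow> 2 * (0\<^sup>2 / 2 * ?n * Q) + 2 * (Hbar - Hbar)\<^sup>2"
    by (intro tendsto_intros e_subseq c_subseq) auto
  then have "(\<lambda>j. 2 * ((e (r j))\<^sup>2 / 2 * ?n * Q) + 2 * (c (r j) - Hbar)\<^sup>2) \<longlonglongrightarrow> 0" by simp
  then have "(\<integral>z. (H (fst z) (snd z) - Hbar)\<^sup>2 \<partial>\<nu>) \<le> 0"
    by (rule LIMSEQ_le[OF \<nu>_lim[OF c2]]) (use le in auto)
  then have "(\<integral>z. (H (fst z) (snd z) - Hbar)\<^sup>2 \<partial>\<nu>) = 0" by (simp add: antisym integral_nonneg)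
  then show AE: "AE z in \<nu>. H (fst z) (snd z) = Hbar"
    using integral_nonneg_eq_0_iff_AE[OF \<nu>_integrable[OF c2[of Hbar]]] by simp
  have "(\<integral>z. H (fst z) (snd z) \<partial>\<nu>) = (\<integral>z. Hbar \<partial>\<nu>)"
    using borel_measurable_integrable[OF \<nu>_integrable[OF Hc]] AE by (intro integral_cong_AE) auto
  then show "(\<integral>z. H (fst z) (snd z) \<partial>\<nu>) = Hbar" by (simp add: \<nu>.prob_space)
qed

lemma momentum: "(\<integral>z. (snd z - P) \<bullet> gradp H (fst z) (snd z) \<partial>\<nu>) = 0"
proof -
  have mc: "continuous_on UNIV (\<lambda>z. (snd z - P) \<bullet> gradp H (fst z) (snd z))"
    by (intro continuous_intros gradp_continuous(1)[OF H_Ck[of "Suc 0"]])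
  have "(\<lambda>j. (\<integral>z. H (fst z) (snd z) \<partial>\<mu> (r j)) - c (r j)) \<longlonglongrightarrow> (\<integral>z. H (fst z) (snd z) \<partial>\<nu>) - Hbar"
    by (intro tendsto_diff c_subseq \<nu>_lim Ck_continuous[OF H_Ck])
  then have "(\<lambda>j. \<integral>z. (snd z - P) \<bullet> gradp H (fst z) (snd z) \<partial>\<mu> (r j)) \<longlonglongrightarrow> 0"
    unfolding E.momentum_identity[OF R] H_const(2) by simp
  then show ?thesis using \<nu>_lim[OF mc] LIMSEQ_unique by blast
qed

lemma flow_C2:
  assumes g: "Ck 2 g" "periodic g"
  shows "(\<integral>z. gradp H (fst z) (snd z) \<bullet> grad g (fst z) \<partial>\<nu>) = 0"
proof -
  have g1: "Ck (Suc 0) g" using g(1) Ck_Suc_imp by (simp only: numeral_2_eq_2)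
  have lc: "continuous_on UNIV (laplacian g)"
    using hess_continuous[OF g(1)] unfolding trace_hess[symmetric, abs_def] trace_def by (intro continuous_intros)
  have lp: "periodic (laplacian g)"
    using hess_periodic[OF g(2,1)] unfolding trace_hess[symmetric, abs_def] by (simp add: periodic_def)
  obtain B where B: "\<And>x. \<bar>laplacian g x\<bar> \<le> B" using periodic_bounded[OF lp lc] by (metis real_norm_def)
  have mc: "continuous_on UNIV (\<lambda>z. gradp H (fst z) (snd z) \<bullet> grad g (fst z))"
    by (intro continuous_intros gradp_continuous(1)[OF H_Ck[of "Suc 0"]] continuous_on_compose2[OF grad_continuous[OF g1]]) auto
  have "(\<lambda>j. (e (r j))\<^sup>2 / 2 * B) \<longlonglongrightarrow> 0\<^sup>2 / 2 * B" by (intro tendsto_intros e_subseq) simp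
  then have "(\<lambda>j. (e (r j))\<^sup>2 / 2 * B) \<longlonglongrightarrow> 0" by simp
  then have "(\<lambda>j. \<integral>z. gradp H (fst z) (snd z) \<bullet> grad g (fst z) \<partial>\<mu> (r j)) \<longlonglongrightarrow> 0"
    by (rule Lim_null_comparison[rotated]) (use E.flow_identity[OF R g B] in auto)
  then show ?thesis using \<nu>_lim[OF mc] LIMSEQ_unique by blast
qed

text \<open>The functional is continuous in the gradient under uniform convergence, with norm at
  most the integral \<open>B\<close> of |D_pH|, so the C^2 case passes to C^1. The tolerance is
  divided by B + 1 because \<open>B\<close> may be 0.\<close>

lemma flow_C1:
  assumes f: "Ck 1 f" "periodic f"
  shows "(\<integral>z. gradp H (fst z) (snd z) \<bullet> grad f (fst z) \<partial>\<nu>) = 0"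
proof -
  have f1: "Ck (Suc 0) f" using f(1) by (simp only: One_nat_def)
  let ?V = "\<lambda>z. gradp H (fst z) (snd z)"
  have Vc: "continuous_on UNIV ?V" by (rule gradp_continuous(1)[OF H_Ck[of "Suc 0"]])
  have mc: "continuous_on UNIV (\<lambda>z. ?V z \<bullet> grad f (fst z))" if "Ck (Suc 0) f" for f
    by (intro continuous_intros Vc continuous_on_compose2[OF grad_continuous[OF that]]) auto
  define B where "B = (\<integral>z. norm (?V z) \<partial>\<nu>)"
  have Bi: "integrable \<nu> (\<lambda>z. norm (?V z))" by (intro \<nu>_integrable continuous_intros Vc)
  have B0: "B \<ge> 0" unfolding B_def by (simp add: integral_nonneg)
  have "\<bar>\<integral>z. ?V z \<bullet> grad f (fst z) \<partial>\<nu>\<bar> \<le> 0 + d" if d: "d > 0" for d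
  proof -
    have "d / (B + 1) > 0" using d B0 by simp
    then obtain g where g: "Ck 2 g" "periodic g" "\<And>x. norm (grad g x - grad f x) \<le> d / (B + 1)"
      using C1_approx_C2[OF f1 f(2)] by blast
    have g1: "Ck (Suc 0) g" using g(1) Ck_Suc_imp by (simp only: numeral_2_eq_2)
    have i0: "integrable \<nu> (\<lambda>z. ?V z \<bullet> grad f (fst z) - ?V z \<bullet> grad g (fst z))"
      using \<nu>_integrable[OF mc[OF f1]] \<nu>_integrable[OF mc[OF g1]] by (rule Bochner_Integration.integrable_diff)
    have i1: "integrable \<nu> (\<lambda>z. \<bar>?V z \<bullet> grad f (fst z) - ?V z \<bullet> grad g (fst z)\<bar>)"
      by (rule integrable_abs[OF i0])
    have i2: "integrable \<nu> (\<lambda>z. norm (?V z) * (d / (B + 1)))"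
      by (rule integrable_mult_left) (rule Bi)
    have le: "\<bar>?V z \<bullet> grad f (fst z) - ?V z \<bullet> grad g (fst z)\<bar> \<le> norm (?V z) * (d / (B + 1))" for z
    proof -
      have "?V z \<bullet> grad f (fst z) - ?V z \<bullet> grad g (fst z) = - (?V z \<bullet> (grad g (fst z) - grad f (fst z)))"
        by (simp only: inner_diff_right minus_diff_eq)
      then have "\<bar>?V z \<bullet> grad f (fst z) - ?V z \<bullet> grad g (fst z)\<bar> = \<bar>?V z \<bullet> (grad g (fst z) - grad f (fst z))\<bar>"
        by (simp only: abs_minus_cancel)
      also have "\<dots> \<le> norm (?V z) * norm (grad g (fst z) - grad f (fst z))" by (rule Cauchy_Schwarz_ineq2)
      also have "\<dots> \<le> norm (?V z) * (d / (B + 1))" by (intro mult_left_mono g(3)) simp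
      finally show ?thesis .
    qed
    have "(\<integral>z. ?V z \<bullet> grad f (fst z) \<partial>\<nu>) = (\<integral>z. ?V z \<bullet> grad f (fst z) \<partial>\<nu>) - (\<integral>z. ?V z \<bullet> grad g (fst z) \<partial>\<nu>)"
      using flow_C2[OF g(1,2)] by simp
    also have "\<dots> = (\<integral>z. ?V z \<bullet> grad f (fst z) - ?V z \<bullet> grad g (fst z) \<partial>\<nu>)"
      by (rule Bochner_Integration.integral_diff[OF \<nu>_integrable[OF mc[OF f1]] \<nu>_integrable[OF mc[OF g1]], symmetric])
    finally have "\<bar>\<integral>z. ?V z \<bullet> grad f (fst z) \<partial>\<nu>\<bar> \<le> (\<integral>z. \<bar>?V z \<bullet> grad f (fst z) - ?V z \<bullet> grad g (fst z)\<bar> \<partial>\<nu>)"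
      by (simp only: integral_abs_bound)
    also have "\<dots> \<le> (\<integral>z. norm (?V z) * (d / (B + 1)) \<partial>\<nu>)"
      by (rule integral_mono[OF i1 i2 le])
    also have "\<dots> = B * (d / (B + 1))" by (simp add: B_def)
    also have "\<dots> \<le> d" using B0 d by (simp add: field_simps)
    finally show ?thesis by simp
  qed
  then have "\<bar>\<integral>z. ?V z \<bullet> grad f (fst z) \<partial>\<nu>\<bar> \<le> 0" by (rule field_le_epsilon)
  then show ?thesis by simp
qed

lemma compact_bound:
  fixes f :: "(real^'n) \<times> (real^'n) \<Rightarrow> real"
  assumes "continuous_on UNIV f"
  obtains B where "0 \<le> B" "\<And>z. z \<in> cell_box R \<Longrightarrow> \<bar>f z\<bar> \<le> B"
proof -
  have "compact (f ` cell_box R)" by (rule compact_continuous_image[OF continuous_on_subset[OF assms] cell_box(1)]) simp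
  then obtain B where "\<And>z. z \<in> cell_box R \<Longrightarrow> norm (f z) \<le> B" using compact_imp_bounded by (force simp: bounded_iff)
  then show ?thesis by (intro that[of "max 0 B"]) (auto simp: le_max_iff_disj)
qed

text \<open>The error at level \<open>j\<close> is \<open>e j\<close> times a constant built from
  bounds of second derivatives over the common compact cell, hence vanishes along the sequence,
  while every other term is an integral of a continuous function.\<close>

lemma transport_limit:
  fixes F :: "real^'n \<Rightarrow> real^'n \<Rightarrow> real"
  assumes F: "Ck 2 (\<lambda>z. F (fst z) (snd z))" and Fp: "periodic_x F"
  shows "(\<integral>z. poisson F H (fst z) (snd z) \<partial>\<nu>)
     + (\<Sum>k\<in>UNIV. \<Sum>l\<in>UNIV. (\<integral>z. dpp F k l (fst z) (snd z) \<partial>L (Some (True, k, l))) - (\<integral>z. dpp F k l (fst z) (snd z) \<partial>L (Some (False, k, l)))) = 0"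
proof -
  let ?\<Phi> = "\<lambda>z. F (fst z) (snd z)"
  have F1: "Ck (Suc (Suc 0)) ?\<Phi>" using F by (simp only: numeral_2_eq_2)
  note c2 = second_derivatives_continuous[OF F]
  define d1 where "d1 i z = dderiv (\<lambda>z. dderiv ?\<Phi> (ex i) z) (ex i) z" for i z
  define d2 where "d2 i l z = dderiv (\<lambda>z. dderiv ?\<Phi> (ex i) z) (ep l) z + dderiv (\<lambda>z. dderiv ?\<Phi> (ep l) z) (ex i) z" for i l z
  have d1c: "continuous_on UNIV (d1 i)" for i unfolding d1_def[abs_def] by (rule c2)
  have d2c: "continuous_on UNIV (d2 i l)" for i l unfolding d2_def[abs_def] by (intro continuous_on_add c2)
  have "\<forall>i. \<exists>B. 0 \<le> B \<and> (\<forall>z\<in>cell_box R. \<bar>d1 i z\<bar> \<le> B)"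
    by (rule allI, rule compact_bound[OF d1c]) blast
  from choice[OF this] obtain B1 where B1': "\<forall>i. 0 \<le> B1 i \<and> (\<forall>z\<in>cell_box R. \<bar>d1 i z\<bar> \<le> B1 i)" by (rule exE)
  have "\<forall>il. \<exists>B. 0 \<le> B \<and> (\<forall>z\<in>cell_box R. \<bar>d2 (fst il) (snd il) z\<bar> \<le> B)"
    by (rule allI, rule compact_bound[OF d2c]) blast
  from choice[OF this] obtain B2' where B2': "\<forall>il. 0 \<le> B2' il \<and> (\<forall>z\<in>cell_box R. \<bar>d2 (fst il) (snd il) z\<bar> \<le> B2' il)" by (rule exE)
  define B2 where "B2 i l = B2' (i, l)" for i l
  have B1: "0 \<le> B1 i" "z \<in> cell_box R \<Longrightarrow> \<bar>d1 i z\<bar> \<le> B1 i" for i z using B1' by auto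
  have B2: "0 \<le> B2 i l" "z \<in> cell_box R \<Longrightarrow> \<bar>d2 i l z\<bar> \<le> B2 i l" for i l z
    using B2'[rule_format, of "(i, l)"] by (auto simp: B2_def)
  \<comment> \<open>One number above all the finitely many bounds; summation serves as
    maximum.\<close>
  define B where "B = (\<Sum>i\<in>UNIV. B1 i) + (\<Sum>i\<in>UNIV. \<Sum>l\<in>UNIV. B2 i l)"
  have s1: "B1 i \<le> (\<Sum>i\<in>UNIV. B1 i)" for i by (rule member_le_sum) (use B1 in auto)
  have s2: "B2 i l \<le> (\<Sum>i\<in>UNIV. \<Sum>l\<in>UNIV. B2 i l)" for i l
  proof -
    have "B2 i l \<le> (\<Sum>l\<in>UNIV. B2 i l)" by (rule member_le_sum) (use B2 in auto)
    also have "\<dots> \<le> (\<Sum>i\<in>UNIV. \<Sum>l\<in>UNIV. B2 i l)"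
      by (rule member_le_sum[where f="\<lambda>i. \<Sum>l\<in>UNIV. B2 i l"]) (use B2 in \<open>auto intro: sum_nonneg\<close>)
    finally show ?thesis .
  qed
  have n1: "0 \<le> (\<Sum>i\<in>UNIV. B1 i)" and n2: "0 \<le> (\<Sum>i\<in>UNIV. \<Sum>l\<in>UNIV. B2 i l)"
    using B1(1) B2(1) by (auto intro!: sum_nonneg)
  have B: "0 \<le> B" "B1 i \<le> B" "B2 i l \<le> B" for i l
    unfolding B_def using s1[of i] s2[of i l] n1 n2 by linarith+
  let ?W = "B * (real CARD('n) + (real CARD('n))\<^sup>2 + Q)"
  have bd: "\<bar>(\<integral>z. poisson F H (fst z) (snd z) \<partial>\<mu> j)
      + (\<Sum>k\<in>UNIV. \<Sum>l\<in>UNIV. \<integral>z. (e j)\<^sup>2 / 2 * hess_gram (U j) k l (fst z) * dpp F k l (fst z) (snd z) \<partial>\<mu> j)\<bar> \<le> e j * ?W" for j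
    by (rule E.poisson_identity[OF R F Fp e(1,2) energy B(1)])
       (fold d1_def d2_def, rule order_trans[OF B1(2) B(2)], assumption, rule order_trans[OF B2(2) B(3)], assumption)
  \<comment> \<open>The splitting into positive and negative parts, undone at the level of
    integrals, so that each part converges separately.\<close>
  have eq: "(\<integral>z. (e j)\<^sup>2 / 2 * hess_gram (U j) k l (fst z) * dpp F k l (fst z) (snd z) \<partial>\<mu> j)
    = (\<integral>z. dpp F k l (fst z) (snd z) \<partial>fam (Some (True, k, l)) j) - (\<integral>z. dpp F k l (fst z) (snd z) \<partial>fam (Some (False, k, l)) j)" for k l j
  proof -
    have i: "integrable (\<mu> j) (\<lambda>z. dens s k l j (fst z) * dpp F k l (fst z) (snd z))" for s
      by (rule E.integrable_continuous_\<mu>[OF R]) (intro continuous_on_mult dens_continuous_fst dpp_continuous[OF F])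
    show ?thesis
      unfolding fam_integral[OF dpp_continuous[OF F]] dens_diff[symmetric] left_diff_distrib
      by (rule Bochner_Integration.integral_diff[OF i i])
  qed
  have lim: "(\<lambda>j. (\<integral>z. poisson F H (fst z) (snd z) \<partial>\<mu> (r j))
      + (\<Sum>k\<in>UNIV. \<Sum>l\<in>UNIV. (\<integral>z. dpp F k l (fst z) (snd z) \<partial>fam (Some (True, k, l)) (r j)) - (\<integral>z. dpp F k l (fst z) (snd z) \<partial>fam (Some (False, k, l)) (r j))))
     \<longlonglongrightarrow> (\<integral>z. poisson F H (fst z) (snd z) \<partial>\<nu>)
     + (\<Sum>k\<in>UNIV. \<Sum>l\<in>UNIV. (\<integral>z. dpp F k l (fst z) (snd z) \<partial>L (Some (True, k, l))) - (\<integral>z. dpp F k l (fst z) (snd z) \<partial>L (Some (False, k, l))))"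
    by (intro tendsto_add tendsto_sum tendsto_diff \<nu>_lim limit_properties(4) poisson_continuous[OF F1 H_Ck[of "Suc 0"]] dpp_continuous[OF F])
  have "(\<lambda>j. e (r j) * ?W) \<longlonglongrightarrow> 0 * ?W" by (intro tendsto_mult e_subseq tendsto_const)
  then have "(\<lambda>j. e (r j) * ?W) \<longlonglongrightarrow> 0" by simp
  then have "(\<lambda>j. (\<integral>z. poisson F H (fst z) (snd z) \<partial>\<mu> (r j))
      + (\<Sum>k\<in>UNIV. \<Sum>l\<in>UNIV. (\<integral>z. dpp F k l (fst z) (snd z) \<partial>fam (Some (True, k, l)) (r j)) - (\<integral>z. dpp F k l (fst z) (snd z) \<partial>fam (Some (False, k, l)) (r j))))
     \<longlonglongrightarrow> 0"
    by (rule Lim_null_comparison[rotated]) (use bd[unfolded eq] in simp)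
  with lim show ?thesis by (rule LIMSEQ_unique)
qed

text \<open>The approximating measures for (k,l) and (l,k) coincide, but their limits were selected
  separately; uniqueness identifies them on Borel sets.\<close>

lemma limit_symmetric: "B \<in> sets borel \<Longrightarrow> measure (L (Some (s, k, l))) B = measure (L (Some (s, l, k))) B"
proof -
  have "fam (Some (s, k, l)) = fam (Some (s, l, k))"
    by (simp add: fam_def fun_eq_iff dens_def hess_gram_sym[of _ k l])
  then show "B \<in> sets borel \<Longrightarrow> measure (L (Some (s, k, l))) B = measure (L (Some (s, l, k))) B"
    using weak_limit_unique[OF L[of "Some (s, k, l)"]] L[of "Some (s, l, k)"] by simp
qed

text \<open>The two parts of all entries are treated as one family with coefficients
  \<plusminus>\<xi>_k \<xi>_l. Before the limit the combination integrates a nonnegative function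
  against the Gram form, and nonnegativity on test functions survives on Borel sets.\<close>

lemma limit_psd:
  fixes \<xi> :: "real^'n"
  assumes B: "B \<in> sets borel"
  shows "0 \<le> (\<Sum>k\<in>UNIV. \<Sum>l\<in>UNIV. \<xi> $ k * \<xi> $ l * (measure (L (Some (True, k, l))) B - measure (L (Some (False, k, l))) B))"
proof -
  define I where "I = Some ` (UNIV :: (bool \<times> 'n \<times> 'n) set)"
  define a :: "(bool \<times> 'n \<times> 'n) option \<Rightarrow> real" where
    "a i = (case i of None \<Rightarrow> 0 | Some (s, k, l) \<Rightarrow> (if s then 1 else -1) * (\<xi> $ k * \<xi> $ l))" for i
  have split: "(\<Sum>i\<in>I. a i * f i) = (\<Sum>k\<in>UNIV. \<Sum>l\<in>UNIV. \<xi> $ k * \<xi> $ l * (f (Some (True, k, l)) - f (Some (False, k, l))))" for f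
  proof -
    have "(\<Sum>i\<in>I. a i * f i) = (\<Sum>x\<in>UNIV. a (Some x) * f (Some x))"
      unfolding I_def by (subst sum.reindex) auto
    also have "\<dots> = (\<Sum>s\<in>UNIV. \<Sum>k\<in>UNIV. \<Sum>l\<in>UNIV. a (Some (s, k, l)) * f (Some (s, k, l)))"
      unfolding UNIV_Times_UNIV[symmetric] sum.cartesian_product by (simp add: case_prod_beta)
    also have "\<dots> = (\<Sum>k\<in>UNIV. \<Sum>l\<in>UNIV. \<xi> $ k * \<xi> $ l * (f (Some (True, k, l)) - f (Some (False, k, l))))"
      by (simp add: UNIV_bool a_def right_diff_distrib sum_subtractf sum_negf)
    finally show ?thesis .
  qed
  have "0 \<le> (\<Sum>i\<in>I. a i * measure (L i) B)"
  proof (rule weak_limit_combination[OF _ _ _ B])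
    show "finite I" by (simp add: I_def)
    show "weak_limit_on (cell_box R) (\<lambda>j. fam i (r j)) (L i)" for i by (rule L)
    fix j and \<phi> :: "(real^'n) \<times> (real^'n) \<Rightarrow> real"
    assume \<phi>: "continuous_on UNIV \<phi>" "\<And>x. 0 \<le> \<phi> x \<and> \<phi> x \<le> 1"
    have i: "integrable (\<mu> j) (\<lambda>z. dens s k l j (fst z) * \<phi> z)" for s k l j
      by (rule E.integrable_continuous_\<mu>[OF R]) (intro continuous_on_mult dens_continuous_fst \<phi>)
    have d: "(\<integral>z. \<phi> z \<partial>fam (Some (True, k, l)) j) - (\<integral>z. \<phi> z \<partial>fam (Some (False, k, l)) j) = (\<integral>z. (e j)\<^sup>2 / 2 * hess_gram (U j) k l (fst z) * \<phi> z \<partial>\<mu> j)" for k l j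
      unfolding fam_integral[OF \<phi>(1)] dens_diff[symmetric] left_diff_distrib
      by (rule Bochner_Integration.integral_diff[OF i i, symmetric])
    have ii: "integrable (\<mu> j) (\<lambda>z. (e j)\<^sup>2 / 2 * hess_gram (U j) k l (fst z) * \<phi> z)" for k l j
      unfolding dens_diff[symmetric] left_diff_distrib by (intro Bochner_Integration.integrable_diff i)
    have "(\<Sum>i\<in>I. a i * (\<integral>z. \<phi> z \<partial>fam i (r j))) = (\<Sum>k\<in>UNIV. \<Sum>l\<in>UNIV. \<xi> $ k * \<xi> $ l * (\<integral>z. (e (r j))\<^sup>2 / 2 * hess_gram (U (r j)) k l (fst z) * \<phi> z \<partial>\<mu> (r j)))"
      unfolding split d ..
    also have "\<dots> = (\<integral>z. (\<Sum>k\<in>UNIV. \<Sum>l\<in>UNIV. \<xi> $ k * \<xi> $ l * ((e (r j))\<^sup>2 / 2 * hess_gram (U (r j)) k l (fst z) * \<phi> z)) \<partial>\<mu> (r j))"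
      (is "_ = integral\<^sup>L _ (\<lambda>z. \<Sum>k\<in>UNIV. \<Sum>l\<in>UNIV. ?G k l z)")
    proof -
      have "(\<integral>z. (\<Sum>k\<in>UNIV. \<Sum>l\<in>UNIV. ?G k l z) \<partial>\<mu> (r j)) = (\<Sum>k\<in>UNIV. \<integral>z. (\<Sum>l\<in>UNIV. ?G k l z) \<partial>\<mu> (r j))"
        by (rule Bochner_Integration.integral_sum) (intro Bochner_Integration.integrable_sum integrable_mult_right ii)
      also have "\<dots> = (\<Sum>k\<in>UNIV. \<Sum>l\<in>UNIV. \<integral>z. ?G k l z \<partial>\<mu> (r j))"
        by (intro sum.cong refl Bochner_Integration.integral_sum integrable_mult_right ii)
      finally show ?thesis by (simp only: integral_mult_right_zero)
    qed
    also have "\<dots> \<ge> 0"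
    proof (rule Bochner_Integration.integral_nonneg)
      fix z
      have "(\<Sum>k\<in>UNIV. \<Sum>l\<in>UNIV. \<xi> $ k * \<xi> $ l * ((e (r j))\<^sup>2 / 2 * hess_gram (U (r j)) k l (fst z) * \<phi> z))
        = (e (r j))\<^sup>2 / 2 * \<phi> z * (\<Sum>k\<in>UNIV. \<Sum>l\<in>UNIV. \<xi> $ k * \<xi> $ l * hess_gram (U (r j)) k l (fst z))"
        by (simp add: sum_distrib_left mult_ac)
      also have "\<dots> \<ge> 0" using \<phi>(2)[of z] by (intro mult_nonneg_nonneg hess_gram_psd) auto
      finally show "0 \<le> (\<Sum>k\<in>UNIV. \<Sum>l\<in>UNIV. \<xi> $ k * \<xi> $ l * ((e (r j))\<^sup>2 / 2 * hess_gram (U (r j)) k l (fst z) * \<phi> z))" .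
    qed
    finally show "0 \<le> (\<Sum>i\<in>I. a i * (\<integral>z. \<phi> z \<partial>fam i (r j)))" .
  qed
  then show ?thesis unfolding split .
qed

end

end

section \<open>Choice of the constants, and folding back onto the torus\<close>

theorem theorem5p1:
  fixes H :: "real^'n \<Rightarrow> real^'n \<Rightarrow> real"
    and P xbar :: "real^'n"
    and u :: "real \<Rightarrow> real^'n \<Rightarrow> real"
    and Hbe :: "real \<Rightarrow> real"
    and Hbar :: real
    and M :: "'w measure"
    and w :: "real \<Rightarrow> 'w \<Rightarrow> real^'n"
    and X :: "real \<Rightarrow> real \<Rightarrow> 'w \<Rightarrow> real^'n"
    and mu :: "real \<Rightarrow> ((real^'n) \<times> (real^'n)) measure"
  assumes H_smooth: "smooth (\<lambda>z. H (fst z) (snd z))"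
    and H_periodic: "periodic_x H"
    and H_coercive: "\<forall>C. \<exists>R. \<forall>x p. norm p \<ge> R \<longrightarrow>
                        (H x p)\<^sup>2 / 2 + gradx H x p \<bullet> p \<ge> C"
    and cell: "\<forall>\<epsilon>>0. smooth (u \<epsilon>) \<and> periodic (u \<epsilon>) \<and>
                 (\<forall>x. - (\<epsilon>\<^sup>2 / 2) * laplacian (u \<epsilon>) x + H x (P + grad (u \<epsilon>) x) = Hbe \<epsilon>)"
    and Hbar_lim: "(Hbe \<longlongrightarrow> Hbar) (at_right 0)"
    and BM: "brownian_motion M w"
    and SDE: "\<forall>\<epsilon>>0. \<forall>\<omega>\<in>space M. continuous_on {0..} (\<lambda>t. X \<epsilon> t \<omega>) \<and>
                 (\<forall>t\<ge>0. X \<epsilon> t \<omega> = xbar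
                    + integral {0..t} (\<lambda>s. - gradp H (X \<epsilon> s \<omega>) (P + grad (u \<epsilon>) (X \<epsilon> s \<omega>)))
                    + \<epsilon> *\<^sub>R w t \<omega>)"
    and mu_eps: "\<forall>\<epsilon>>0. torus_measure (mu \<epsilon>) \<and> prob_space (mu \<epsilon>) \<and>
                 (\<exists>T :: nat \<Rightarrow> real. filterlim T at_top sequentially \<and>
                    (\<forall>\<phi>. Cc_torus \<phi> \<longrightarrow>
                       (\<lambda>j. (1 / T j) * (\<integral>\<omega>. integral {0..T j}
                              (\<lambda>t. \<phi> (X \<epsilon> t \<omega>) (P + grad (u \<epsilon>) (X \<epsilon> t \<omega>))) \<partial>M))
                       \<longlonglongrightarrow> (\<integral>z. \<phi> (fst z) (snd z) \<partial>mu \<epsilon>)))"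
  shows "\<exists>eps :: nat \<Rightarrow> real. (\<forall>j. 0 < eps j) \<and> eps \<longlonglongrightarrow> 0 \<and>
    (\<exists>\<mu> (Mp :: 'n \<Rightarrow> 'n \<Rightarrow> ((real^'n) \<times> (real^'n)) measure) Mn.
       torus_measure \<mu> \<and> prob_space \<mu> \<and>
       (\<forall>k j. torus_measure (Mp k j) \<and> finite_measure (Mp k j) \<and>
              torus_measure (Mn k j) \<and> finite_measure (Mn k j)) \<and>
       (\<forall>k j. \<forall>A\<in>sets borel. smeasure (Mp k j) (Mn k j) A = smeasure (Mp j k) (Mn j k) A) \<and>
       (\<forall>\<xi> :: real^'n. \<forall>A\<in>sets borel.
          0 \<le> (\<Sum>k\<in>UNIV. \<Sum>j\<in>UNIV. \<xi> $ k * \<xi> $ j * smeasure (Mp k j) (Mn k j) A)) \<and>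
       \<comment> \<open>(1) weak-* convergence\<close>
       (\<forall>\<phi>. Cc_torus \<phi> \<longrightarrow>
          (\<lambda>j. \<integral>z. \<phi> (fst z) (snd z) \<partial>mu (eps j)) \<longlonglongrightarrow> (\<integral>z. \<phi> (fst z) (snd z) \<partial>\<mu>)) \<and>
       \<comment> \<open>(2) Mather measure properties\<close>
       (\<integral>z. H (fst z) (snd z) \<partial>\<mu>) = Hbar \<and>
       (AE z in \<mu>. H (fst z) (snd z) = Hbar) \<and>
       (\<integral>z. (snd z - P) \<bullet> gradp H (fst z) (snd z) \<partial>\<mu>) = 0 \<and>
       (\<forall>\<psi> :: real^'n \<Rightarrow> real. Ck 1 \<psi> \<and> periodic \<psi> \<longrightarrow>
          (\<integral>z. gradp H (fst z) (snd z) \<bullet> grad \<psi> (fst z) \<partial>\<mu>) = 0) \<and>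
       \<comment> \<open>(3)\<close>
       (\<forall>\<phi>. C2c_torus \<phi> \<longrightarrow>
          (\<integral>z. poisson \<phi> H (fst z) (snd z) \<partial>\<mu>)
          + (\<Sum>k\<in>UNIV. \<Sum>j\<in>UNIV. sintegral (Mp k j) (Mn k j) (\<lambda>z. dpp \<phi> k j (fst z) (snd z))) = 0) \<and>
       \<comment> \<open>(4) compact supports\<close>
       compact (measure_support \<mu>) \<and>
       (\<forall>k j. compact (smeasure_support (smeasure (Mp k j) (Mn k j)))))"
proof -
  have Hk: "Ck k (\<lambda>z. H (fst z) (snd z))" for k using H_smooth by (simp add: smooth_def)
  \<comment> \<open>Dominates |Hbe| for all small noise levels, since these values lie within 1 of
    \<open>Hbar\<close>.\<close>
  define C where "C = \<bar>Hbar\<bar> + 1"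
  have "\<forall>\<^sub>F \<epsilon> in at_right 0. dist (Hbe \<epsilon>) Hbar < 1" using Hbar_lim by (rule tendstoD) simp
  then obtain e1 where e1: "e1 > 0" "\<And>\<epsilon>. 0 < \<epsilon> \<Longrightarrow> \<epsilon> < e1 \<Longrightarrow> dist (Hbe \<epsilon>) Hbar < 1"
    unfolding eventually_at_right_field by auto
  \<comment> \<open>Coercivity at the level that the gradient bound asks for; it depends on
    \<open>Hbar\<close> only, so one radius serves every small noise level.\<close>
  obtain R0 where R0: "\<And>x p. R0 \<le> norm p \<Longrightarrow> C\<^sup>2 + 1 \<le> (H x p)\<^sup>2 / 2 + gradx H x p \<bullet> p"
    using H_coercive by blast
  define R where "R = max 0 R0"
  \<comment> \<open>Below \<open>e1\<close> the effective Hamiltonians are controlled by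
    \<open>C\<close>; below 1 / n both \<epsilon> \<le> 1 and the smallness condition of the
    gradient bound hold.\<close>
  define e0 where "e0 = min e1 (1 / real CARD('n))"
  have e0: "e0 > 0" using e1(1) by (simp add: e0_def)
  have e0_le: "e0 \<le> 1 / real CARD('n)" "e0 \<le> e1" by (simp_all add: e0_def)
  have n1: "1 / real CARD('n) \<le> 1" by (simp add: Suc_le_eq)
  \<comment> \<open>The offset 2 keeps even the first term strictly below \<open>e0\<close>.\<close>
  define e where "e j = e0 / (real j + 2)" for j
  have e_pos: "0 < e j" for j using e0 by (simp add: e_def)
  have e_less: "e j < e0" for j 
  proof -
    have "e0 * 1 < e0 * (real j + 2)" using e0 by (intro mult_strict_left_mono) auto
    then show ?thesis by (simp add: e_def pos_divide_less_eq)
  qed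
  have e_lim: "e \<longlonglongrightarrow> 0"
  proof -
    have "filterlim (\<lambda>j. real j + 2) at_top sequentially"
      using filterlim_tendsto_add_at_top[OF tendsto_const filterlim_real_sequentially, of 2] by (simp add: add.commute)
    from filterlim_at_top_imp_at_infinity[OF this] show ?thesis
      unfolding e_def by (rule tendsto_divide_0[OF tendsto_const])
  qed
  have e_le1: "e j \<le> 1" for j using e_less[of j] e0_le n1 by linarith
  have e_sq: "(e j)\<^sup>2 * real CARD('n) \<le> 2" for j
  proof -
    have "e j \<le> 1 / real CARD('n)" using e_less[of j] e0_le by linarith
    then have "e j * real CARD('n) \<le> 1" by (simp add: field_simps)
    then have "e j * (e j * real CARD('n)) \<le> 1 * 1" using e_pos[of j] e_le1[of j] by (intro mult_mono) auto
    then show ?thesis by (simp add: power2_eq_square)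
  qed
  have erg: "\<exists>T. ergodic_measure H P xbar (u (e j)) (e j) M w (X (e j)) (mu (e j)) T (Hbe (e j))" for j
  proof -
    note mu = mu_eps[rule_format, OF e_pos[of j]]
    from mu obtain T :: "nat \<Rightarrow> real" where T: "filterlim T at_top sequentially"
      "\<And>\<phi>. Cc_torus \<phi> \<Longrightarrow> (\<lambda>i. (1 / T i) * (\<integral>\<omega>. integral {0..T i}
          (\<lambda>t. \<phi> (X (e j) t \<omega>) (P + grad (u (e j)) (X (e j) t \<omega>))) \<partial>M)) \<longlonglongrightarrow> (\<integral>z. \<phi> (fst z) (snd z) \<partial>mu (e j))"
      by blast
    have "ergodic_measure H P xbar (u (e j)) (e j) M w (X (e j)) (mu (e j)) T (Hbe (e j))"
    proof (rule ergodic_measure.intro)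
      show "smooth (u (e j))" "periodic (u (e j))"
        "\<And>x. - ((e j)\<^sup>2 / 2) * laplacian (u (e j)) x + H x (P + grad (u (e j)) x) = Hbe (e j)"
        using cell e_pos[of j] by blast+
      show "continuous_on {0..} (\<lambda>t. X (e j) t \<omega>)" if "\<omega> \<in> space M" for \<omega>
        using SDE e_pos[of j] that by blast
      show "X (e j) t \<omega> = xbar + integral {0..t} (\<lambda>s. - gradp H (X (e j) s \<omega>) (P + grad (u (e j)) (X (e j) s \<omega>))) + e j *\<^sub>R w t \<omega>"
        if "\<omega> \<in> space M" "0 \<le> t" for \<omega> t
        using SDE e_pos[of j] that by blast
      show "torus_measure (mu (e j))" "prob_space (mu (e j))" using mu by blast+
    qed (fact H_smooth H_periodic BM T)+
    then show ?thesis by (intro exI)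
  qed
  then have "\<forall>j. \<exists>T. ergodic_measure H P xbar (u (e j)) (e j) M w (X (e j)) (mu (e j)) T (Hbe (e j))" by (rule allI)
  from choice[OF this] obtain T where "\<forall>j. ergodic_measure H P xbar (u (e j)) (e j) M w (X (e j)) (mu (e j)) (T j) (Hbe (e j))"
    by (rule exE)
  then have T: "ergodic_measure H P xbar (u (e j)) (e j) M w (X (e j)) (mu (e j)) (T j) (Hbe (e j))" for j
    by (rule spec)
  have grad_bound: "norm (P + grad (u (e j)) x) \<le> R" for j x
  proof -
    have "dist (Hbe (e j)) Hbar < 1" using e_less[of j] e0_le by (intro e1(2) e_pos) linarith
    then have C: "\<bar>Hbe (e j)\<bar> \<le> C" unfolding C_def dist_real_def by linarith
    interpret ergodic_measure H P xbar "u (e j)" "e j" M w "X (e j)" "mu (e j)" "T j" "Hbe (e j)" by (rule T)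
    show ?thesis
      by (rule gradient_bound[OF H_smooth u up cell e_pos e_sq C]) (rule R0, simp add: R_def)
  qed
  have "continuous_on UNIV (\<lambda>z. gradx H (fst z) (snd z) \<bullet> snd z)"
    by (intro continuous_intros gradp_continuous(2)[OF Hk[of "Suc 0"]])
  then have "compact ((\<lambda>z. gradx H (fst z) (snd z) \<bullet> snd z) ` cell_box R)"
    by (intro compact_continuous_image cell_box(1)) (rule continuous_on_subset, auto)
  \<comment> \<open>A maximum over the compact cell, hence an energy constant independent of the
    noise level.\<close>
  then obtain Q where Q: "\<And>z. z \<in> cell_box R \<Longrightarrow> \<bar>gradx H (fst z) (snd z) \<bullet> snd z\<bar> \<le> Q"
    using compact_imp_bounded by (force simp: bounded_iff)
  have e_ne: "e j \<noteq> 0" for j using e_pos[of j] by simp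
  have Hbe_lim: "(\<lambda>j. Hbe (e j)) \<longlonglongrightarrow> Hbar"
    by (rule filterlim_compose[OF Hbar_lim])
       (use e_lim e_pos e_ne in \<open>auto simp: filterlim_at intro!: always_eventually\<close>)
  interpret V: vanishing_noise H P xbar "\<lambda>j. u (e j)" e M w "\<lambda>j. X (e j)" "\<lambda>j. mu (e j)" T "\<lambda>j. Hbe (e j)" Hbar R Q
    by (rule vanishing_noise.intro[OF T e_pos e_le1 e_lim Hbe_lim grad_bound Q])
  obtain r L where r: "strict_mono r" and L: "\<And>i. weak_limit_on (cell_box R) (\<lambda>j. V.fam i (r j)) (L i)"
    by (rule V.limits_exist) blast
  note Lp = V.limit_properties[OF r L]
  have L0: "V.\<nu> L = L None" by (rule V.\<nu>_def[OF r L])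
  \<comment> \<open>Integrals of functions periodic in \<open>x\<close> agree for \<open>N i\<close>
    and \<open>L i\<close>, and values on Borel sets are compared through preimages under
    \<open>reduce\<close>; so each property of the limits is transferred in one of these two
    ways.\<close>
  define N where "N i = distr (L i) borel reduce" for i
  have rm: "reduce \<in> measurable (L i) borel" for i
    using reduce_measurable Lp(2)[of i] by (simp cong: measurable_cong_sets)
  have N_fin: "finite_measure (N i)" for i
    unfolding N_def by (rule finite_measure.finite_measure_distr[OF Lp(1) rm])
  have N_torus: "torus_measure (N i)" for i unfolding N_def by (rule reduce_torus_measure[OF Lp(2)])
  have N_prob: "prob_space (N None)"
    unfolding N_def using V.\<nu>_prob[OF r L] unfolding L0 by (rule prob_space.prob_space_distr[OF _ rm])
  have N_meas: "measure (N i) A = measure (L i) (reduce -` A)" if "A \<in> sets borel" for i A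
    unfolding N_def using measure_distr[OF rm that] sets_eq_imp_space_eq[OF Lp(2)[of i]] by simp
  have pre: "reduce -` A \<in> sets borel" if "A \<in> sets borel" for A
    using measurable_sets[OF reduce_measurable that] by simp
  have N_int: "(\<integral>z. F (fst z) (snd z) \<partial>N i) = (\<integral>z. F (fst z) (snd z) \<partial>L i)"
    if "continuous_on UNIV (\<lambda>z. F (fst z) (snd z))" "periodic_x F" for F :: "real^'n \<Rightarrow> real^'n \<Rightarrow> real" and i
    unfolding N_def by (rule reduce_integral[OF that Lp(2)])
  have N_null: "emeasure (N i) A = 0" if "A \<in> sets borel" "A \<inter> cell_box R = {}" for i A
    unfolding N_def by (rule reduce_null[OF Lp(2,3) that])
  have Hc: "continuous_on UNIV (\<lambda>z. H (fst z) (snd z))" by (rule Ck_continuous[OF Hk])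
  note gp = gradp_periodic_x(1)[OF Hk[of "Suc 0"] H_periodic] and gpc = gradp_continuous(1)[OF Hk[of "Suc 0"]]
  let ?Mp = "\<lambda>k l. N (Some (True, k, l))" and ?Mn = "\<lambda>k l. N (Some (False, k, l))"
  have sm: "smeasure (?Mp k l) (?Mn k l) A = measure (L (Some (True, k, l))) (reduce -` A) - measure (L (Some (False, k, l))) (reduce -` A)"
    if "A \<in> sets borel" for k l A
    by (simp add: smeasure_def N_meas that)
  show ?thesis
  proof (rule exI[of _ "\<lambda>j. e (r j)"], rule conjI[rotated], rule conjI[rotated],
      rule exI[of _ "N None"], rule exI[of _ ?Mp], rule exI[of _ ?Mn], intro conjI allI ballI impI)
    show "\<forall>j. 0 < e (r j)" using e_pos by blast
    show "(\<lambda>j. e (r j)) \<longlonglongrightarrow> 0" by (rule V.e_subseq[OF r L])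
    show "torus_measure (N None)" "prob_space (N None)" by (fact N_torus N_prob)+
    show "torus_measure (?Mp k l)" "finite_measure (?Mp k l)" "torus_measure (?Mn k l)" "finite_measure (?Mn k l)" for k l
      by (rule N_torus N_fin)+
    show "smeasure (?Mp k l) (?Mn k l) A = smeasure (?Mp l k) (?Mn l k) A" if "A \<in> sets borel" for k l A
      using V.limit_symmetric[OF r L pre[OF that]] by (simp add: sm[OF that])
    show "0 \<le> (\<Sum>k\<in>UNIV. \<Sum>j\<in>UNIV. \<xi> $ k * \<xi> $ j * smeasure (?Mp k j) (?Mn k j) A)" if "A \<in> sets borel" for \<xi> :: "real^'n" and A
      unfolding sm[OF that] by (rule V.limit_psd[OF r L pre[OF that]])
    show "(\<lambda>j. \<integral>z. \<phi> (fst z) (snd z) \<partial>mu (e (r j))) \<longlonglongrightarrow> (\<integral>z. \<phi> (fst z) (snd z) \<partial>N None)"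
      if "Cc_torus \<phi>" for \<phi> :: "real^'n \<Rightarrow> real^'n \<Rightarrow> real"
      using that V.\<nu>_lim[OF r L] unfolding Cc_torus_def L0 by (subst N_int) auto
    show "(\<integral>z. H (fst z) (snd z) \<partial>N None) = Hbar"
      unfolding N_int[OF Hc H_periodic] using V.H_const(2)[OF r L] by (simp add: L0)
    show "AE z in N None. H (fst z) (snd z) = Hbar"
    proof -
      have "Measurable.pred borel (\<lambda>z. H (fst z) (snd z) = Hbar)"
        using borel_measurable_continuous_onI[OF Hc] by measurable
      moreover have "H (fst (reduce z)) (snd (reduce z)) = H (fst z) (snd z)" for z
        using H_periodic int_vec_intpart[of "fst z"] unfolding periodic_x_def reduce_def
        by (metis add_uminus_conv_diff fst_conv snd_conv)
      ultimately show ?thesis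
        unfolding N_def using V.H_const(1)[OF r L, unfolded L0] by (subst AE_distr_iff[OF rm]) simp_all
    qed
    show "(\<integral>z. (snd z - P) \<bullet> gradp H (fst z) (snd z) \<partial>N None) = 0"
      using N_int[of "\<lambda>x p. (p - P) \<bullet> gradp H x p" None] V.momentum[OF r L] gp gpc
      by (simp add: L0 periodic_x_def continuous_intros)
    show "(\<integral>z. gradp H (fst z) (snd z) \<bullet> grad \<psi> (fst z) \<partial>N None) = 0" if "Ck 1 \<psi> \<and> periodic \<psi>" for \<psi>
    proof -
      have \<psi>: "Ck (Suc 0) \<psi>" "periodic \<psi>" using that by (simp_all only: One_nat_def)
      have "continuous_on UNIV (\<lambda>z. gradp H (fst z) (snd z) \<bullet> grad \<psi> (fst z))"
        by (intro continuous_intros gpc continuous_on_compose2[OF grad_continuous[OF \<psi>(1)]]) auto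
      moreover have "periodic_x (\<lambda>x p. gradp H x p \<bullet> grad \<psi> x)"
        using gp grad_periodic[OF \<psi>(2,1)] by (simp add: periodic_x_def periodic_def)
      ultimately show ?thesis
        using N_int[of "\<lambda>x p. gradp H x p \<bullet> grad \<psi> x" None] V.flow_C1[OF r L] that by (simp add: L0)
    qed
    show "(\<integral>z. poisson \<phi> H (fst z) (snd z) \<partial>N None)
       + (\<Sum>k\<in>UNIV. \<Sum>j\<in>UNIV. sintegral (?Mp k j) (?Mn k j) (\<lambda>z. dpp \<phi> k j (fst z) (snd z))) = 0"
      if "C2c_torus \<phi>" for \<phi> :: "real^'n \<Rightarrow> real^'n \<Rightarrow> real"
    proof -
      have \<phi>: "Ck 2 (\<lambda>z. \<phi> (fst z) (snd z))" "periodic_x \<phi>" using that by (auto simp: C2c_torus_def)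
      have \<phi>1: "Ck (Suc (Suc 0)) (\<lambda>z. \<phi> (fst z) (snd z))" using \<phi>(1) by (simp only: numeral_2_eq_2)
      have "periodic_x (poisson \<phi> H)"
        using gradp_periodic_x[OF \<phi>1 \<phi>(2)] gradp_periodic_x[OF Hk[of "Suc 0"] H_periodic]
        by (simp add: periodic_x_def poisson_def)
      note pi = N_int[OF poisson_continuous[OF \<phi>1 Hk[of "Suc 0"]] this]
      have dp: "periodic_x (\<lambda>x p. dpp \<phi> k l x p)" for k l
      proof -
        have c1: "Ck (Suc 0) (\<lambda>z. dderiv (\<lambda>z. \<phi> (fst z) (snd z)) (ep l) (fst z, snd z))"
          using Ck_dderiv[OF \<phi>1, of "ep l"] by (simp only: prod.collapse)
        have "periodic_x (\<lambda>x p. dderiv (\<lambda>z. \<phi> (fst z) (snd z)) (ep l) (x, p))"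
          unfolding periodic_x_def using periodic_x_dderiv[OF \<phi>(2) \<phi>1] by blast
        from periodic_x_dderiv[OF this c1] show ?thesis
          unfolding periodic_x_def dpp_eq[OF \<phi>(1)] prod.collapse by blast
      qed
      have di: "(\<integral>z. dpp \<phi> k l (fst z) (snd z) \<partial>N i) = (\<integral>z. dpp \<phi> k l (fst z) (snd z) \<partial>L i)" for k l i
        by (rule N_int[OF dpp_continuous[OF \<phi>(1)] dp])
      show ?thesis
        unfolding sintegral_def pi di using V.transport_limit[OF r L \<phi>] by (simp only: L0)
    qed
    show "compact (measure_support (N None))"
      by (rule compact_measure_support[OF _ cell_box(1) N_null]) (simp_all add: N_def)
    show "compact (smeasure_support (smeasure (?Mp k l) (?Mn k l)))" for k l
      by (rule compact_smeasure_support[OF cell_box(1)[of R]])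
         (simp add: smeasure_def measure_def N_null)
  qed
qed

end
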